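(* Assume the Riemann Hypothesis. There exists an absolute constant $c>0$ such that for any $v<c$ the following holds: for every zero $1/2+i\gamma$ of $\zeta(s)$ with $\gamma$ larger than a suitable absolute constant and with $\gamma^+-\gamma<v/\log\gamma$, the box $$\Big\{s=\sigma+it:\ \tfrac12<\sigma<\tfrac12+\frac{v^2}{4\log\gamma},\ \gamma\le t\le\gamma^+\Big\}$$ contains exactly one zero of $\zeta'(s)$ (counted with multiplicity), and this zero does not lie on the boundary of the box.
   Context: Write $s=\sigma+it$. If $\zeta(1/2+i\gamma)=0$ with $\gamma>0$, then $\gamma^+$ denotes the smallest $t>\gamma$ with $\zeta(1/2+it)=0$ (so $\gamma$ and $\gamma^+$ are ordinates of consecutive distinct zeros on the critical line). *)

theory Defs
  imports "HOL-Complex_Analysis.Complex_Analysis"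
begin

lemma series_holomorphic:
  fixes f :: "nat \<Rightarrow> complex \<Rightarrow> complex"
  assumes hol: "\<And>n. f n holomorphic_on S" and S: "open S"
    and bd: "\<And>z. z \<in> S \<Longrightarrow> \<exists>d>0. \<exists>M. cball z d \<subseteq> S \<and> summable M \<and>
                 (\<forall>n. \<forall>w\<in>cball z d. norm (f n w) \<le> M n)"
  shows "(\<lambda>z. \<Sum>n. f n z) holomorphic_on S"
proof (rule holomorphic_uniform_sequence[where f = "\<lambda>n z. \<Sum>i<n. f i z", OF S])
  show "(\<lambda>z. \<Sum>i<n. f i z) holomorphic_on S" for n
    by (intro holomorphic_intros hol)
  fix z assume "z \<in> S"
  from bd[OF this] obtain d M where "d > 0" "cball z d \<subseteq> S" "summable M"
    "\<And>n w. w \<in> cball z d \<Longrightarrow> norm (f n w) \<le> M n" by blast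
  then show "\<exists>d>0. cball z d \<subseteq> S \<and>
      uniform_limit (cball z d) (\<lambda>n z. \<Sum>i<n. f i z) (\<lambda>z. \<Sum>n. f n z) sequentially"
    using Weierstrass_m_test[of "cball z d" f M] by blast
qed

lemma summable_Suc_powr:
  fixes a :: real
  assumes "a < -1"
  shows "summable (\<lambda>n. real (Suc n) powr a)"
  using assms summable_Suc_iff[of "\<lambda>n. real n powr a"] summable_real_powr_iff by simp

lemma norm_Suc_powr: "norm (of_nat (Suc n) powr (s::complex)) = real (Suc n) powr Re s"
  using norm_powr_real_powr[of "of_nat (Suc n)" s] by (simp del: of_nat_Suc)

lemma zeta_series_summable:
  fixes s :: complex
  assumes "Re s > 1"
  shows "summable (\<lambda>n. of_nat (Suc n) powr (-s))"
proof (rule summable_norm_cancel)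
  show "summable (\<lambda>n. norm (of_nat (Suc n) powr (-s)))"
    unfolding norm_Suc_powr by (rule summable_Suc_powr) (use assms in simp)
qed

lemma zeta_series_holomorphic:
  "(\<lambda>s::complex. \<Sum>n. of_nat (Suc n) powr (-s)) holomorphic_on {s. Re s > 1}"
proof (rule series_holomorphic)
  show "open {s. Re s > 1}" by (rule open_halfspace_Re_gt)
  show "(\<lambda>s. of_nat (Suc n) powr (-s)) holomorphic_on {s. Re s > 1}" for n
    by (intro holomorphic_intros) (auto simp del: of_nat_Suc)
  fix z :: complex assume "z \<in> {s. Re s > 1}"
  then have z: "Re z > 1" by simp
  define d where "d = (Re z - 1) / 2"
  have d: "d > 0" using z by (simp add: d_def)
  have *: "Re w \<ge> 1 + d" if "w \<in> cball z d" for w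
  proof -
    have "\<bar>Re (z - w)\<bar> \<le> d" using that abs_Re_le_cmod[of "z - w"] by (simp add: dist_norm)
    then have "Re z - Re w \<le> d" by simp
    moreover have "Re z = 1 + 2 * d" by (simp add: d_def field_simps)
    ultimately show ?thesis by linarith
  qed
  show "\<exists>d>0. \<exists>M. cball z d \<subseteq> {s. Re s > 1} \<and> summable M \<and>
          (\<forall>n. \<forall>w\<in>cball z d. norm (of_nat (Suc n) powr (-w)) \<le> M n)"
  proof (intro exI conjI allI ballI)
    show "cball z d \<subseteq> {s. Re s > 1}" using * d by fastforce
    show "summable (\<lambda>n. real (Suc n) powr (-(1+d)))" using d by (intro summable_Suc_powr) simp
    show "norm (of_nat (Suc n) powr (-w)) \<le> real (Suc n) powr (-(1+d))" if "w \<in> cball z d" for n w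
      unfolding norm_Suc_powr using *[OF that] by (intro powr_mono) auto
  qed (fact d)
qed

definition zeta_rem :: "nat \<Rightarrow> nat \<Rightarrow> complex \<Rightarrow> complex" where
  "zeta_rem m n s = of_nat (Suc (Suc n)) powr (1 - s) -
     (\<Sum>k\<le>m. ((1 - s) gchoose k) * of_nat (Suc n) powr (1 - s - of_nat k))"

lemma gchoose_fact_prod:
  "(\<Prod>i<k. a - of_nat i) / fact k = ((a::complex) gchoose k)"
  by (simp add: gbinomial_prod_rev atLeast0LessThan)

lemma norm_zeta_rem_le:
  "norm (zeta_rem m n s) \<le>
     (\<Prod>i<Suc m. norm s + 1 + real i) * 2 powr (\<bar>Re s + real m\<bar>) * real (Suc n) powr (- Re s - real m)"
proof -
  define x where "x = real (Suc n)"
  define S where "S = closed_segment (complex_of_real x) (of_real (x + 1))"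
  have x: "x \<ge> 1" by (simp add: x_def)
  have S: "\<exists>t\<ge>x. t \<le> x + 1 \<and> y = of_real t" if "y \<in> S" for y
  proof -
    from that obtain t where t: "0 \<le> t" "t \<le> 1" "y = (1 - t) *\<^sub>R complex_of_real x + t *\<^sub>R of_real (x + 1)"
      unfolding S_def in_segment by blast
    then have "y = of_real (x + t)" by (simp add: algebra_simps scaleR_conv_of_real)
    then show ?thesis using t by (intro exI[of _ "x + t"]) auto
  qed
  define f where "f = (\<lambda>k z. (\<Prod>i<k. 1 - s - of_nat i) * z powr (1 - s - of_nat k))"
  define C where "C = (\<Prod>i<Suc m. norm s + 1 + real i)"
  define B where "B = C * (2 powr (\<bar>Re s + real m\<bar>) * x powr (- Re s - real m))"
  have "norm (f 0 (of_real (x+1)) - (\<Sum>k\<le>m. f k (of_real x) * (of_real (x+1) - of_real x) ^ k / fact k))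
        \<le> B * norm (complex_of_real (x+1) - of_real x) ^ Suc m / fact m"
  proof (rule complex_Taylor)
    show "convex S" by (simp add: S_def)
    show "complex_of_real (x+1) \<in> S" "complex_of_real x \<in> S" by (auto simp: S_def)
    fix k y assume y: "y \<in> S"
    from S[OF y] obtain t where t: "t \<ge> x" "t \<le> x + 1" "y = of_real t" by blast
    have "y \<notin> \<real>\<^sub>\<le>\<^sub>0" using t x by auto
    then show "(f k has_field_derivative f (Suc k) y) (at y within S)"
      unfolding f_def by (auto intro!: derivative_eq_intros simp: algebra_simps)
    have "norm (f (Suc m) y) = (\<Prod>i<Suc m. norm (1 - s - of_nat i)) * t powr (- Re s - real m)"
      using t x by (simp add: f_def norm_mult prod_norm norm_powr_real_powr)
    also have "\<dots> \<le> C * (2 powr (\<bar>Re s + real m\<bar>) * x powr (- Re s - real m))"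
    proof (rule mult_mono)
      show "(\<Prod>i<Suc m. norm (1 - s - of_nat i)) \<le> C" unfolding C_def
      proof (rule prod_mono, safe)
        fix i
        have "norm (1 - s - of_nat i) \<le> norm (1 - s) + norm (of_nat i :: complex)"
          by (rule norm_triangle_ineq4)
        also have "norm (1 - s) \<le> 1 + norm s" using norm_triangle_ineq4[of 1 s] by simp
        finally show "norm (1 - s - of_nat i) \<le> norm s + 1 + real i" by simp
      qed simp
      show "t powr (- Re s - real m) \<le> 2 powr (\<bar>Re s + real m\<bar>) * x powr (- Re s - real m)"
      proof -
        have "t powr (- Re s - real m) = x powr (- Re s - real m) * (t/x) powr (- Re s - real m)"
          using t x by (simp flip: powr_mult)
        also have "(t/x) powr (- Re s - real m) \<le> (t/x) powr \<bar>Re s + real m\<bar>"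
          using t x by (intro powr_mono) auto
        also have "\<dots> \<le> 2 powr \<bar>Re s + real m\<bar>"
          using t x by (intro powr_mono2) (auto simp: field_simps)
        finally show ?thesis using x by (simp add: mult_ac)
      qed
      show "0 \<le> C" unfolding C_def by (intro prod_nonneg) auto
    qed auto
    finally show "norm (f (Suc m) y) \<le> B" by (simp add: B_def)
  qed
  also have "f 0 (of_real (x+1)) = of_nat (Suc (Suc n)) powr (1 - s)"
    by (simp add: f_def x_def add_ac)
  also have "(\<Sum>k\<le>m. f k (of_real x) * (of_real (x+1) - of_real x) ^ k / fact k) =
     (\<Sum>k\<le>m. ((1 - s) gchoose k) * of_nat (Suc n) powr (1 - s - of_nat k))"
    by (intro sum.cong refl) (simp add: f_def x_def flip: gchoose_fact_prod)
  also have "B * norm (complex_of_real (x+1) - of_real x) ^ Suc m / fact m = B / fact m" by simp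
  also have "B / fact m \<le> B / 1"
  proof (rule divide_left_mono)
    show "0 \<le> B" unfolding B_def C_def by (intro mult_nonneg_nonneg prod_nonneg) auto
  qed (auto simp: fact_ge_1)
  finally show ?thesis by (simp add: zeta_rem_def B_def C_def x_def mult_ac)
qed

lemma zeta_rem_sum_holomorphic:
  "(\<lambda>s. \<Sum>n. zeta_rem m n s) holomorphic_on {s. Re s > 1 - real m}"
proof (rule series_holomorphic)
  show "open {s. Re s > 1 - real m}" by (rule open_halfspace_Re_gt)
  show "zeta_rem m n holomorphic_on {s. Re s > 1 - real m}" for n
    unfolding zeta_rem_def gchoose_fact_prod[symmetric]
    by (intro holomorphic_intros) (auto simp del: of_nat_Suc)
  fix z :: complex assume "z \<in> {s. Re s > 1 - real m}"
  then have z: "Re z + real m > 1" by simp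
  define d where "d = (Re z + real m - 1) / 2"
  have d: "d > 0" and zd: "Re z = 1 - real m + 2 * d" using z by (simp_all add: d_def field_simps)
  have *: "Re w \<ge> 1 - real m + d" "Re w \<le> Re z + d" "norm w \<le> norm z + d" if "w \<in> cball z d" for w
  proof -
    have "\<bar>Re (z - w)\<bar> \<le> d" using that abs_Re_le_cmod[of "z - w"] by (simp add: dist_norm)
    then show "Re w \<ge> 1 - real m + d" "Re w \<le> Re z + d" using zd by auto
    show "norm w \<le> norm z + d" 
      using that norm_triangle_sub[of w z] by (simp add: dist_norm norm_minus_commute)
  qed
  define M where "M = (\<lambda>n. (\<Prod>i<Suc m. (norm z + d) + 1 + real i) * 2 powr (Re z + d + real m) *
                       real (Suc n) powr (- (1 + d)))"
  show "\<exists>d>0. \<exists>M. cball z d \<subseteq> {s. Re s > 1 - real m} \<and> summable M \<and>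
          (\<forall>n. \<forall>w\<in>cball z d. norm (zeta_rem m n w) \<le> M n)"
  proof (intro exI conjI allI ballI)
    show "cball z d \<subseteq> {s. Re s > 1 - real m}" using * d by fastforce
    show "summable M" unfolding M_def using d
      by (intro summable_mult summable_Suc_powr) simp
    fix n w assume w: "w \<in> cball z d"
    note w' = *[OF w]
    have "norm (zeta_rem m n w) \<le> (\<Prod>i<Suc m. norm w + 1 + real i) * 2 powr (\<bar>Re w + real m\<bar>) *
            real (Suc n) powr (- Re w - real m)" by (rule norm_zeta_rem_le)
    also have "\<dots> \<le> M n" unfolding M_def
    proof (intro mult_mono)
      show "(\<Prod>i<Suc m. norm w + 1 + real i) \<le> (\<Prod>i<Suc m. norm z + d + 1 + real i)"
        using w' by (intro prod_mono) auto
      show "2 powr \<bar>Re w + real m\<bar> \<le> 2 powr (Re z + d + real m)"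
        using w' d by (intro powr_mono) auto
      show "real (Suc n) powr (- Re w - real m) \<le> real (Suc n) powr (- (1 + d))"
        using w' d by (intro powr_mono) auto
    qed (use d in \<open>auto intro!: prod_nonneg mult_nonneg_nonneg\<close>)
    finally show "norm (zeta_rem m n w) \<le> M n" .
  qed (fact d)
qed

lemma zeta_series_recurrence:
  fixes s :: complex
  defines "D \<equiv> \<lambda>s::complex. \<Sum>n. of_nat (Suc n) powr (-s)"
  assumes s: "Re s > 1"
  shows "(s - 1) * D s = 1 + (\<Sum>n. zeta_rem (Suc m) n s)
           - (\<Sum>j<m. ((1 - s) gchoose Suc j) / of_nat (j + 2) * ((s + of_nat j) * D (s + of_nat (Suc j))))"
proof -
  define u where "u = (\<lambda>n. complex_of_nat (Suc n) powr (1 - s))"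
  have "u \<longlonglongrightarrow> 0"
  proof (rule tendsto_norm_zero_cancel)
    have "(\<lambda>n. real (Suc n) powr (1 - Re s)) \<longlonglongrightarrow> 0"
      using s by (intro tendsto_neg_powr filterlim_compose[OF filterlim_real_sequentially filterlim_Suc]) auto
    then show "(\<lambda>n. norm (u n)) \<longlonglongrightarrow> 0"
      unfolding u_def norm_Suc_powr by simp
  qed
  from telescope_sums[OF this] have A: "(\<lambda>n. u (Suc n) - u n) sums (-1)" by (simp add: u_def)
  have B: "(\<lambda>n. of_nat (Suc n) powr (- (s + of_nat k))) sums D (s + of_nat k)" for k
    unfolding D_def using s by (intro summable_sums zeta_series_summable) simp
  have C: "(\<lambda>n. \<Sum>k\<le>m. ((1 - s) gchoose Suc k) * of_nat (Suc n) powr (- (s + of_nat k)))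
             sums (\<Sum>k\<le>m. ((1 - s) gchoose Suc k) * D (s + of_nat k))"
    by (intro sums_sum sums_mult B)
  have rem: "zeta_rem (Suc m) n s = (u (Suc n) - u n) -
      (\<Sum>k\<le>m. ((1 - s) gchoose Suc k) * of_nat (Suc n) powr (- (s + of_nat k)))" for n
    unfolding zeta_rem_def u_def by (subst sum.atMost_Suc_shift) (simp add: algebra_simps)
  have "(\<lambda>n. zeta_rem (Suc m) n s) sums (-1 - (\<Sum>k\<le>m. ((1 - s) gchoose Suc k) * D (s + of_nat k)))"
    unfolding rem by (rule sums_diff[OF A C])
  then have "(\<Sum>n. zeta_rem (Suc m) n s) = -1 - (\<Sum>k\<le>m. ((1 - s) gchoose Suc k) * D (s + of_nat k))"
    by (simp add: sums_iff)
  also have "(\<Sum>k\<le>m. ((1 - s) gchoose Suc k) * D (s + of_nat k)) =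
      (1 - s) * D s + (\<Sum>j<m. ((1 - s) gchoose Suc (Suc j)) * D (s + of_nat (Suc j)))"
    unfolding lessThan_Suc_atMost[symmetric] by (subst sum.lessThan_Suc_shift) simp
  also have "(\<Sum>j<m. ((1 - s) gchoose Suc (Suc j)) * D (s + of_nat (Suc j))) =
     - (\<Sum>j<m. ((1 - s) gchoose Suc j) / of_nat (j + 2) * ((s + of_nat j) * D (s + of_nat (Suc j))))"
    unfolding sum_negf[symmetric]
  proof (rule sum.cong[OF refl])
    fix j
    have "((1 - s) gchoose Suc (Suc j)) = ((1 - s) gchoose Suc j) * (1 - s - of_nat (Suc j)) / of_nat (j + 2)"
      by (simp add: gchoose_fact_prod[symmetric] mult_ac del: of_nat_Suc)
    also have "1 - s - of_nat (Suc j) = - (s + of_nat j)" by simp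
    finally show "((1 - s) gchoose Suc (Suc j)) * D (s + of_nat (Suc j)) =
       - (((1 - s) gchoose Suc j) / of_nat (j + 2) * ((s + of_nat j) * D (s + of_nat (Suc j))))"
      by (simp only: mult_minus_left mult_minus_right times_divide_eq_left minus_divide_left mult.assoc)
  qed
  finally show ?thesis by (simp add: algebra_simps)
qed

lemma zeta_continuation_halfplane:
  "\<exists>F. F holomorphic_on {s. Re s > 1 - real m} \<and>
     (\<forall>s. Re s > 1 \<longrightarrow> F s = (s - 1) * (\<Sum>n. of_nat (Suc n) powr (-s)))"
proof (induction m)
  case 0
  then show ?case
    by (intro exI[of _ "\<lambda>s. (s - 1) * (\<Sum>n. of_nat (Suc n) powr (-s))"])
       (auto intro!: holomorphic_intros zeta_series_holomorphic simp del: of_nat_Suc)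
next
  case (Suc m)
  then obtain F where F: "F holomorphic_on {s. Re s > 1 - real m}"
    and F_eq: "\<And>s. Re s > 1 \<Longrightarrow> F s = (s - 1) * (\<Sum>n. of_nat (Suc n) powr (-s))" by blast
  define G where "G = (\<lambda>s. 1 + (\<Sum>n. zeta_rem (Suc m) n s)
     - (\<Sum>j<m. ((1 - s) gchoose Suc j) / of_nat (j + 2) * F (s + of_nat (Suc j))))"
  have F': "(\<lambda>s. F (s + of_nat (Suc j))) holomorphic_on {s. Re s > 1 - real (Suc m)}" for j
    by (rule holomorphic_on_compose_gen[OF _ F, unfolded o_def]) (auto intro!: holomorphic_intros)
  have "G holomorphic_on {s. Re s > 1 - real (Suc m)}"
    unfolding G_def gchoose_fact_prod[symmetric]
    by (intro holomorphic_intros zeta_rem_sum_holomorphic F') auto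
  moreover have "G s = (s - 1) * (\<Sum>n. of_nat (Suc n) powr (-s))" if "Re s > 1" for s
    unfolding zeta_series_recurrence[OF that, of m] G_def using that
    by (simp add: F_eq del: of_nat_Suc) (simp add: algebra_simps)
  ultimately show ?case by blast
qed

lemma zeta_continuation:
  "\<exists>F. F holomorphic_on UNIV \<and>
     (\<forall>s. Re s > 1 \<longrightarrow> F s = (s - 1) * (\<Sum>n. of_nat (Suc n) powr (-s)))"
proof -
  define H where "H = (\<lambda>m. {s. Re s > 1 - real m})"
  have H: "open (H m)" "connected (H m)" for m
    unfolding H_def by (auto intro: open_halfspace_Re_gt convex_connected convex_halfspace_Re_gt)
  from zeta_continuation_halfplane obtain F where F: "\<And>m. F m holomorphic_on H m"
    and F_eq: "\<And>m s. Re s > 1 \<Longrightarrow> F m s = (s - 1) * (\<Sum>n. of_nat (Suc n) powr (-s))"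
    unfolding H_def by metis
  have agree: "F m s = F n s" if "m \<le> n" "s \<in> H m" for m n s
  proof (rule analytic_continuation_open[of "H 0" "H m" "F m" "F n"])
    show "H 0 \<noteq> {}" unfolding H_def by (auto intro!: exI[of _ 2])
    show "F n holomorphic_on H m"
      by (rule holomorphic_on_subset[OF F]) (use that in \<open>auto simp: H_def\<close>)
  qed (use that H F F_eq in \<open>auto simp: H_def open_halfspace_Re_gt\<close>)
  define N where "N = (\<lambda>s. nat \<lceil>\<bar>Re s\<bar>\<rceil> + 2)"
  have N: "s \<in> H (N s)" for s unfolding H_def N_def by simp linarith
  define G where "G = (\<lambda>s. F (N s) s)"
  have G: "G s = F m s" if "s \<in> H m" for m s
    unfolding G_def using agree[OF _ that] agree[OF _ N] by (metis nle_le)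
  have "G holomorphic_on (\<Union>m. H m)"
  proof (rule holomorphic_on_UN_open)
    fix m
    have "G holomorphic_on H m \<longleftrightarrow> F m holomorphic_on H m"
      by (rule holomorphic_cong[OF refl G])
    then show "G holomorphic_on H m" using F by blast
  qed (use H in auto)
  also have "(\<Union>m. H m) = UNIV" using N by blast
  finally have "G holomorphic_on UNIV" .
  moreover have "G s = (s - 1) * (\<Sum>n. of_nat (Suc n) powr (-s))" if "Re s > 1" for s
    using G[of s 0] F_eq[OF that, of 0] that unfolding H_def by simp
  ultimately show ?thesis by blast
qed

text \<open>
  The Riemann zeta function is the analytic continuation of the Dirichlet series
  \<open>\<Sum> n\<ge>1. n powr (-s)\<close> to the complex plane without the pole \<open>1\<close>.  The value at the
  pole is set to \<open>0\<close> only to make the function unique.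
\<close>
definition is_zeta :: "(complex \<Rightarrow> complex) \<Rightarrow> bool" where
  "is_zeta f \<longleftrightarrow> f holomorphic_on (- {1}) \<and> f 1 = 0 \<and>
     (\<forall>s. Re s > 1 \<longrightarrow> (\<lambda>n. of_nat (Suc n) powr (-s)) sums f s)"

definition zeta :: "complex \<Rightarrow> complex" where
  "zeta = (THE f. is_zeta f)"

lemma is_zeta_unique:
  assumes "is_zeta f" "is_zeta g"
  shows "f = g"
proof
  fix s
  show "f s = g s"
  proof (cases "s = 1")
    case False
    show ?thesis
    proof (rule analytic_continuation_open[of "{s. Re s > 1}" "- {1}" f g])
      show "{s. Re s > 1} \<noteq> {}" by (auto intro!: exI[of _ 2])
      show "connected (- {1::complex})" by (intro connected_punctured_universe) simp
      show "f z = g z" if "z \<in> {s. Re s > 1}" for z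
        using assms that unfolding is_zeta_def by (blast intro: sums_unique2)
    qed (use assms False in \<open>auto simp: is_zeta_def open_halfspace_Re_gt\<close>)
  qed (use assms in \<open>simp add: is_zeta_def\<close>)
qed

lemma is_zeta_zeta: "is_zeta zeta"
proof -
  obtain F where F: "F holomorphic_on UNIV"
    and F_eq: "\<And>s. Re s > 1 \<Longrightarrow> F s = (s - 1) * (\<Sum>n. of_nat (Suc n) powr (-s))"
    using zeta_continuation by blast
  define f where "f = (\<lambda>s. F s / (s - 1))"
  have "is_zeta f" unfolding is_zeta_def
  proof (intro conjI allI impI)
    show "f holomorphic_on - {1}" unfolding f_def
      by (intro holomorphic_intros holomorphic_on_subset[OF F]) auto
    show "f 1 = 0" by (simp add: f_def)
    fix s :: complex assume s: "Re s > 1"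
    then have "s \<noteq> 1" by auto
    then have "f s = (\<Sum>n. of_nat (Suc n) powr (-s))" using F_eq[OF s] by (simp add: f_def)
    then show "(\<lambda>n. of_nat (Suc n) powr (-s)) sums f s"
      using zeta_series_summable[OF s] by (simp add: summable_sums del: of_nat_Suc)
  qed
  then show ?thesis unfolding zeta_def using is_zeta_unique by (intro theI[of is_zeta]) auto
qed

definition riemann_hypothesis :: bool where
  "riemann_hypothesis \<longleftrightarrow> (\<forall>s. zeta s = 0 \<and> 0 < Re s \<and> Re s < 1 \<longrightarrow> Re s = 1/2)"

definition zero_ordinate :: "real \<Rightarrow> bool" where
  "zero_ordinate t \<longleftrightarrow> zeta (Complex (1/2) t) = 0"

text \<open>\<open>next_ordinate \<gamma> \<gamma>'\<close>: \<open>\<gamma>'\<close> is the smallest ordinate of a zero on the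
  critical line that is larger than \<open>\<gamma>\<close>, i.e. \<open>\<gamma>' = \<gamma>\<^sup>+\<close>.\<close>
definition next_ordinate :: "real \<Rightarrow> real \<Rightarrow> bool" where
  "next_ordinate \<gamma> \<gamma>' \<longleftrightarrow>
     \<gamma> < \<gamma>' \<and> zero_ordinate \<gamma>' \<and> (\<forall>t. \<gamma> < t \<and> zero_ordinate t \<longrightarrow> \<gamma>' \<le> t)"

definition zero_box :: "real \<Rightarrow> real \<Rightarrow> real \<Rightarrow> complex set" where
  "zero_box v \<gamma> \<gamma>' =
     {s. 1/2 < Re s \<and> Re s < 1/2 + v\<^sup>2 / (4 * ln \<gamma>) \<and> \<gamma> \<le> Im s \<and> Im s \<le> \<gamma>'}"

end

theory Submission
  imports Defs
begin

text \<open>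
  Let \<open>\<rho>\<^sub>1, \<rho>\<^sub>2\<close> be the zeros of \<open>\<zeta>\<close> at the two left corners of the box and \<open>L = ln \<gamma>\<close>. On the critical
  line the functional equation gives \<open>Re \<zeta>'/\<zeta> = - L/2 + O(1) < 0\<close> between the corners. By Landau's
  lemma, \<open>\<zeta>'/\<zeta>(s)\<close> is the sum of the terms \<open>1/(s - \<rho>)\<close> over the zeros near \<open>1/2 + \<i>\<gamma>\<close> plus a function \<open>H\<close>
  with \<open>H = O(L)\<close> and \<open>H' = O(L)\<close>. The box has diameter \<open>O(1/L)\<close>, so \<open>Re H = - L/2 + O(1)\<close> in it, and
  under the Riemann hypothesis every \<open>Re 1/(s - \<rho>)\<close> is positive to the right of the line. On the other
  three sides \<open>\<rho>\<^sub>1\<close> and \<open>\<rho>\<^sub>2\<close> together contribute at least \<open>4L/5\<close>, so \<open>Re \<zeta>'/\<zeta> > 0\<close> there. The function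
  \<open>(s - \<alpha>)/((s - \<rho>\<^sub>1)(s - \<rho>\<^sub>2))\<close>, with \<open>\<alpha>\<close> in the box, has the same sign pattern and the same simple poles;
  hence the quotient of the two functions avoids the nonpositive real axis on the boundary, and the
  argument principle shows that \<open>\<zeta>'/\<zeta>\<close> has exactly one zero in the box, a simple one. Since the two corner
  zeros alone give the lower bound, \<open>c = 1\<close> works.
\<close>

section \<open>Symmetric Rouche argument on a rectangle\<close>

text \<open>The bound H = O(L) carries an unspecified constant, which could swamp the 4L/5 gained
  from the corners. The exact constant 1/2 is recovered on the critical line itself: there each 1/(s
  - \<rho>) is purely imaginary, so Re H = Re \<zeta>'/\<zeta>, and the functional equation gives
  this with error O(1). Moving from there to any point of the box costs only O(L) O(1/L) = O(1). The
  width v^2/(4L) makes the corner terms independent of v. On the right side some corner is at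
  vertical distance at most v/(2L); since v < 1 the width is at most v/(4L), so the squared distance
  to that corner is at most (5/16) v^2/L^2, and the factor v^2 cancels. Any factor above 1/2 in
  place of 4/5 would do, and one threshold for \<gamma> serves all v. The poles of \<zeta>'/\<zeta>
  at the corners lie on the contour. Multiplying by (s - \<open>\<rho>1\<close>)(s -
  \<open>\<rho>2\<close>) removes them and turns the comparison function into s - \<alpha>, so the
  argument principle is needed only for holomorphic functions.\<close>

text \<open>Since F(s)/(s - \<alpha>) stays off the cut of the principal logarithm, its
  \<open>Ln\<close> is a single-valued primitive of F'/F - 1/(s - \<alpha>) along the boundary. That
  integral vanishes, so F has as many zeros inside as s - \<alpha>, namely one.\<close>

lemma unique_zero_in_box:
  fixes F :: "complex \<Rightarrow> complex"
  assumes U: "open U" "cbox a b \<subseteq> U" and hol: "F holomorphic_on U" and \<alpha>: "\<alpha> \<in> box a b"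
    and q: "\<And>s. s \<in> cbox a b - box a b \<Longrightarrow> F s / (s - \<alpha>) \<notin> \<real>\<^sub>\<le>\<^sub>0"
  shows "\<exists>\<rho>\<in>box a b. {s \<in> cbox a b. F s = 0} = {\<rho>} \<and> zorder F \<rho> = 1"
proof -
  define p where "p = rectpath a b"
  have ab: "Re a < Re b" "Im a < Im b" using \<alpha> by (auto simp: in_box_complex_iff)
  have img: "path_image p = cbox a b - box a b"
    unfolding p_def using ab by (intro path_image_rectpath_cbox_minus_box) auto
  have vp: "valid_path p" and loop: "pathfinish p = pathstart p" by (auto simp: p_def)
  obtain e where e: "e > 0" "(\<Union>x\<in>cbox a b. cball x e) \<subseteq> U"
    using compact_subset_open_imp_cball_epsilon_subset[OF compact_cbox U] by blast
  define e' where "e' = e / 2"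
  define a' b' where "a' = a - Complex e' e'" and "b' = b + Complex e' e'"
  have e': "e' > 0" using e by (simp add: e'_def)
  have sub: "cbox a' b' \<subseteq> U"
  proof
    fix z assume z: "z \<in> cbox a' b'"
    \<comment> \<open>Clamping both coordinates gives the point of \<open>cbox a b\<close> nearest
      to z; the half margin \<open>e'\<close> in each coordinate adds up to at most e.\<close>
    define w where "w = Complex (max (Re a) (min (Re b) (Re z))) (max (Im a) (min (Im b) (Im z)))"
    have "w \<in> cbox a b" using ab by (auto simp: w_def in_cbox_complex_iff)
    moreover have "dist w z \<le> e"
    proof -
      have "norm (w - z) \<le> \<bar>Re (w - z)\<bar> + \<bar>Im (w - z)\<bar>" by (rule cmod_le)
      also have "\<dots> \<le> e' + e'" using z ab e'
        by (intro add_mono) (auto simp: w_def in_cbox_complex_iff a'_def b'_def)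
      finally show ?thesis by (simp add: e'_def dist_norm)
    qed
    ultimately show "z \<in> U" using e(2) mem_cball by blast
  qed
  define S where "S = box a' b'"
  have S: "open S" "connected S" by (auto simp: S_def intro: convex_connected)
  have abS: "cbox a b \<subseteq> S" using e' by (auto simp: S_def in_box_complex_iff in_cbox_complex_iff a'_def b'_def)
  have SU: "S \<subseteq> U" using sub box_subset_cbox unfolding S_def by blast
  have holS: "F holomorphic_on S" by (rule holomorphic_on_subset[OF hol SU])
  have Fp: "F s \<noteq> 0" if "s \<in> path_image p" for s using q[of s] that img by auto
  have ap: "a \<in> path_image p" using ab img by (auto simp: in_box_complex_iff in_cbox_complex_iff)
  \<comment> \<open>An intermediate box: its closure is compact inside S, which gives the finiteness
    of zeros in V that the argument principle requires.\<close>
  define a1 b1 where "a1 = a - Complex (e'/2) (e'/2)" and "b1 = b + Complex (e'/2) (e'/2)"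
  define V where "V = box a1 b1"
  have V: "open V" "connected V" by (auto simp: V_def intro: convex_connected)
  have V1S: "cbox a1 b1 \<subseteq> S" and abV: "cbox a b \<subseteq> V" using e'
    by (auto simp: S_def V_def in_box_complex_iff in_cbox_complex_iff a'_def b'_def a1_def b1_def)
  have V1: "V \<subseteq> cbox a1 b1" unfolding V_def by (rule box_subset_cbox)
  \<comment> \<open>The vacuous disjunct is the empty set of poles, kept to match the index set in
    the argument principle.\<close>
  define Z1 where "Z1 = {s \<in> V. F s = 0 \<or> s \<in> {}}"
  define Z where "Z = {s \<in> cbox a b. F s = 0}"
  have ZZ1: "Z \<subseteq> Z1" using abV by (auto simp: Z_def Z1_def)
  have finZ1: "finite Z1"
  proof (cases "F constant_on S")
    case True
    have "a \<in> S" using abS ap img by auto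
    then have "F s = F a" if "s \<in> S" for s using True that by (auto simp: constant_on_def)
    then have "Z1 = {}" using Fp[OF ap] V1 V1S by (auto simp: Z1_def)
    then show ?thesis by simp
  next
    case False
    then have "finite {s \<in> cbox a1 b1. F s = 0}"
      by (intro holomorphic_compact_finite_zeros[OF holS S compact_cbox V1S])
    then show ?thesis by (rule finite_subset[rotated]) (use V1 in \<open>auto simp: Z1_def\<close>)
  qed
  have finZ: "finite Z" using finite_subset[OF ZZ1 finZ1] .
  have Zbox: "Z \<subseteq> box a b" using Fp img by (auto simp: Z_def)
  have "((\<lambda>s. deriv F s * 1 / F s - 1 / (s - \<alpha>)) has_contour_integral 0) p"
  proof (rule Cauchy_theorem_primitive[where f = "\<lambda>s. Ln (F s / (s - \<alpha>))", OF _ vp order_refl loop])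
    fix s assume s: "s \<in> path_image p"
    then have sS: "s \<in> S" and s\<alpha>: "s \<noteq> \<alpha>" using img abS \<alpha> by auto
    have dF: "(F has_field_derivative deriv F s) (at s within path_image p)"
      using holomorphic_derivI[OF holS S(1) sS] .
    have "((\<lambda>s. F s / (s - \<alpha>)) has_field_derivative
        (deriv F s * (s - \<alpha>) - F s) / ((s - \<alpha>) * (s - \<alpha>))) (at s within path_image p)"
      using dF s\<alpha> by (auto intro!: derivative_eq_intros)
    from has_field_derivative_Ln[THEN DERIV_chain2, OF _ this, of]
    have "((\<lambda>s. Ln (F s / (s - \<alpha>))) has_field_derivative
       inverse (F s / (s - \<alpha>)) * ((deriv F s * (s - \<alpha>) - F s) / ((s - \<alpha>) * (s - \<alpha>)))) (at s within path_image p)"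
      using q[of s] s img by auto
    also have "inverse (F s / (s - \<alpha>)) * ((deriv F s * (s - \<alpha>) - F s) / ((s - \<alpha>) * (s - \<alpha>))) =
        deriv F s * 1 / F s - 1 / (s - \<alpha>)"
    proof -
      have "inverse (f / u) * ((D * u - f) / (u * u)) = D * 1 / f - 1 / u"
        if "u \<noteq> 0" "f \<noteq> 0" for f u D :: complex using that by (simp add: field_simps)
      then show ?thesis using s\<alpha> Fp[OF s] by simp
    qed
    finally show "((\<lambda>s. Ln (F s / (s - \<alpha>))) has_field_derivative
        deriv F s * 1 / F s - 1 / (s - \<alpha>)) (at s within path_image p)" .
  qed
  moreover have "((\<lambda>s. 1 / (s - \<alpha>)) has_contour_integral 2 * pi * \<i> * winding_number p \<alpha>) p"
    using has_contour_integral_winding_number[OF vp, of \<alpha>] \<alpha> img by auto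
  ultimately have "((\<lambda>s. deriv F s * 1 / F s) has_contour_integral 2 * pi * \<i>) p"
    using has_contour_integral_add winding_number_rectpath[OF \<alpha>] by (fastforce simp: p_def)
  then have "contour_integral p (\<lambda>s. deriv F s * 1 / F s) = 2 * pi * \<i>"
    by (rule contour_integral_unique)
  also have "contour_integral p (\<lambda>s. deriv F s * 1 / F s) =
      2 * pi * \<i> * (\<Sum>s\<in>Z1. winding_number p s * 1 * zorder F s)"
    unfolding Z1_def
  proof (rule argument_principle[OF V _ _ vp loop])
    show "F holomorphic_on V - {}" using holS V1 V1S by (auto intro: holomorphic_on_subset)
    show "path_image p \<subseteq> V - {s \<in> V. F s = 0 \<or> s \<in> {}}" using img abV Fp by auto
    show "\<forall>z. z \<notin> V \<longrightarrow> winding_number p z = 0"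
      using abV ab unfolding p_def by (auto intro!: winding_number_rectpath_outside)
    show "finite {s \<in> V. F s = 0 \<or> s \<in> {}}" using finZ1 unfolding Z1_def .
  qed auto
  also have "(\<Sum>s\<in>Z1. winding_number p s * 1 * zorder F s) = (\<Sum>s\<in>Z. winding_number p s * 1 * zorder F s)"
    using ab ZZ1 by (intro sum.mono_neutral_right[OF finZ1]) 
      (auto simp: Z_def Z1_def p_def intro!: winding_number_rectpath_outside)
  also have "\<dots> = of_int (\<Sum>s\<in>Z. zorder F s)"
    unfolding of_int_sum using Zbox winding_number_rectpath by (auto intro!: sum.cong simp: p_def)
  finally have "complex_of_int (\<Sum>s\<in>Z. zorder F s) = of_int 1" by simp
  then have one: "(\<Sum>s\<in>Z. zorder F s) = 1" unfolding of_int_eq_iff .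
  have pos: "zorder F s \<ge> 1" if "s \<in> Z" for s
  proof -
    have "\<exists>w\<in>S. F w \<noteq> 0" using Fp[OF ap] ap abS img by blast
    then have "zorder F s > 0"
      using zorder_exist_zero[OF holS S] that abS by (auto simp: Z_def split: if_splits)
    then show ?thesis by simp
  qed
  \<comment> \<open>The orders sum to 1 and each is at least 1, so there is one zero and it is
    simple.\<close>
  have "(\<Sum>s\<in>Z. (1::int)) \<le> (\<Sum>s\<in>Z. zorder F s)" by (intro sum_mono pos)
  then have "card Z \<le> 1" using one by simp
  moreover have "Z \<noteq> {}" using one by auto
  ultimately have "card Z = 1" using finZ by (simp add: le_Suc_eq)
  then obtain \<rho> where \<rho>: "Z = {\<rho>}" by (rule card_1_singletonE)
  show ?thesis
    using one Zbox \<rho> unfolding Z_def[symmetric] by auto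
qed

section \<open>Local factorization and the logarithmic derivative\<close>

text \<open>Induction on Z: the factors split off so far do not vanish at the new point a, so the
  cofactor g vanishes there, and its full order at a can be divided out. Earlier zeros stay outside
  the zero set of the new cofactor.\<close>

lemma holomorphic_factor_zeros:
  fixes f :: "complex \<Rightarrow> complex"
  assumes A: "open A" "connected A" and hol: "f holomorphic_on A" and nz: "\<exists>w\<in>A. f w \<noteq> 0"
    and Z: "finite Z" "Z \<subseteq> A" "\<And>z. z \<in> Z \<Longrightarrow> f z = 0"
  shows "\<exists>g m. g holomorphic_on A \<and> (\<forall>z\<in>Z. g z \<noteq> 0 \<and> (m z :: nat) \<ge> 1) \<and>
    (\<forall>z\<in>A. f z = g z * (\<Prod>\<rho>\<in>Z. (z - \<rho>) ^ m \<rho>))"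
  using Z
proof (induction Z rule: finite_induct)
  case empty
  then show ?case using hol by (intro exI[of _ f] exI) auto
next
  case (insert a Z)
  then obtain g m where g: "g holomorphic_on A" "\<And>z. z \<in> Z \<Longrightarrow> g z \<noteq> 0 \<and> (m z :: nat) \<ge> 1"
    and fg: "\<And>z. z \<in> A \<Longrightarrow> f z = g z * (\<Prod>\<rho>\<in>Z. (z - \<rho>) ^ m \<rho>)" by fastforce
  have aA: "a \<in> A" using insert by auto
  have ga: "g a = 0" using fg[OF aA] insert by auto
  have "\<exists>w\<in>A. g w \<noteq> 0" using nz fg by fastforce
  from zorder_exist_zero[OF g(1) A aA this] ga obtain r where
    n: "zorder g a > 0" and r: "r > 0" "cball a r \<subseteq> A" "zor_poly g a holomorphic_on cball a r"
    and gz: "\<And>w. w \<in> cball a r \<Longrightarrow> g w = zor_poly g a w * (w - a) ^ nat (zorder g a) \<and> zor_poly g a w \<noteq> 0"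
    by auto
  define n where "n = nat (zorder g a)"
  \<comment> \<open>The quotient by (z - a)^n, with its removable singularity at a filled in by the
    local factor of g.\<close>
  define h where "h = (\<lambda>z. if z = a then zor_poly g a a else g z / (z - a) ^ n)"
  have h_ball: "h w = zor_poly g a w" if "w \<in> ball a r" for w
    using gz[of w] that by (auto simp: h_def n_def)
  have "h holomorphic_on (A - {a}) \<union> ball a r"
  proof (rule holomorphic_on_Un)
    have "(\<lambda>z. g z / (z - a) ^ n) holomorphic_on A - {a}"
      by (intro holomorphic_intros holomorphic_on_subset[OF g(1)]) auto
    then show "h holomorphic_on A - {a}"
      by (rule holomorphic_transform) (auto simp: h_def)
    have "zor_poly g a holomorphic_on ball a r" using r(3) by (rule holomorphic_on_subset) auto
    then show "h holomorphic_on ball a r" by (rule holomorphic_transform) (use h_ball in auto)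
  qed (use A in auto)
  also have "(A - {a}) \<union> ball a r = A" using r by auto
  finally have hh: "h holomorphic_on A" .
  have gh: "g z = h z * (z - a) ^ n" for z
    using ga n by (auto simp: h_def n_def)
  show ?case
  proof (intro exI conjI ballI)
    show "h holomorphic_on A" by fact
    define m' where "m' = m(a := n)"
    fix z assume z: "z \<in> insert a Z"
    show "h z \<noteq> 0" 
    proof (cases "z = a")
      case True then show ?thesis using gz[of a] r by (simp add: h_def)
    next
      case False then show ?thesis using g(2)[of z] gh[of z] z by auto
    qed
    show "(m(a := n)) z \<ge> 1" using z g(2) n by (auto simp: n_def)
  next
    fix z assume z: "z \<in> A"
    have "(\<Prod>\<rho>\<in>Z. (z - \<rho>) ^ m \<rho>) = (\<Prod>\<rho>\<in>Z. (z - \<rho>) ^ (m(a := n)) \<rho>)"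
      using insert by (intro prod.cong) auto
    then show "f z = h z * (\<Prod>\<rho>\<in>insert a Z. (z - \<rho>) ^ (m(a := n)) \<rho>)"
      using fg[OF z] gh[of z] insert by simp
  qed
qed

text \<open>Borel-Caratheodory: the normalized logarithm h of g vanishes at the centre and has real
  part at most M. Schwarz's lemma bounds |h| on smaller discs, and Cauchy's inequality then bounds
  h' = g'/g.\<close>

lemma log_deriv_bound_nonvanishing:
  fixes g :: "complex \<Rightarrow> complex"
  assumes hol: "g holomorphic_on ball s0 R" and nz: "\<And>z. z \<in> ball s0 R \<Longrightarrow> g z \<noteq> 0"
    and bd: "\<And>z. z \<in> ball s0 R \<Longrightarrow> norm (g z) \<le> exp M * norm (g s0)"
    and M: "M > 0" and r: "0 < r" "r < R" and s: "s \<in> cball s0 r"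
  shows "norm (deriv g s / g s) \<le> 16 * M * R / (R - r)\<^sup>2"
proof -
  have s0: "s0 \<in> ball s0 R" using r by simp
  have "(\<lambda>z. g z / g s0) holomorphic_on ball s0 R" using nz[OF s0] by (intro holomorphic_intros hol) auto
  then obtain k where k: "k holomorphic_on ball s0 R" "\<And>z. z \<in> ball s0 R \<Longrightarrow> g z / g s0 = exp (k z)"
    using contractible_imp_holomorphic_log[of "\<lambda>z. g z / g s0" "ball s0 R"] nz s0
    by (metis convex_ball convex_imp_contractible divide_eq_0_iff)
  define h where "h = (\<lambda>z. k z - k s0)"
  have hh: "h holomorphic_on ball s0 R" unfolding h_def by (intro holomorphic_intros k)
  have "exp (k s0) = 1" using k(2)[OF s0] nz[OF s0] by simp
  then have gh: "g z = g s0 * exp (h z)" if "z \<in> ball s0 R" for z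
    using k(2)[OF that] nz[OF s0] by (simp add: h_def exp_diff field_simps)
  have Reh: "Re (h z) \<le> M" if "z \<in> ball s0 R" for z
  proof -
    have "norm (g s0) * exp (Re (h z)) \<le> norm (g s0) * exp M"
      using bd[OF that] gh[OF that] by (simp add: norm_mult mult_ac)
    then show ?thesis using nz[OF s0] by simp
  qed
  define T where "T = (\<lambda>w. s0 + of_real R * w)"
  have T: "T w \<in> ball s0 R" if "norm w < 1" for w
    using that r by (simp add: T_def dist_norm norm_mult)
  \<comment> \<open>The map u / (4M - u) sends Re u < 2M into the unit disc. With 4M rather than 2M,
    the non-strict bound Re h \<le> M still gives the strict inequality that Schwarz's lemma asks
    for.\<close>
  define \<phi> where "\<phi> = (\<lambda>w. h (T w) / (of_real (4 * M) - h (T w)))"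
  have ne: "of_real (4 * M) - h (T w) \<noteq> 0" if "norm w < 1" for w
    using Reh[OF T[OF that]] M by (auto simp: complex_eq_iff)
  have hT: "(\<lambda>w. h (T w)) holomorphic_on ball 0 1"
    by (rule holomorphic_on_compose_gen[OF _ hh, unfolded o_def])
       (use T in \<open>auto simp: T_def intro!: holomorphic_intros\<close>)
  have \<phi>: "norm (\<phi> w) \<le> norm w" if "norm w < 1" for w
  proof (rule Schwarz_Lemma(1)[OF _ _ _ that])
    show "\<phi> holomorphic_on ball 0 1" unfolding \<phi>_def
      by (intro holomorphic_intros hT) (use ne in auto)
    show "\<phi> 0 = 0" by (simp add: \<phi>_def T_def h_def)
    fix z :: complex assume z: "norm z < 1"
    define u where "u = h (T z)"
    have u: "Re u \<le> M" using Reh[OF T[OF z]] by (simp add: u_def)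
    have "(norm u)\<^sup>2 < (norm (of_real (4 * M) - u))\<^sup>2"
      unfolding cmod_power2 using u M by (simp add: power2_eq_square algebra_simps)
    then have "norm u < norm (of_real (4 * M) - u)" by (rule power2_less_imp_less) auto
    then show "norm (\<phi> z) < 1" unfolding \<phi>_def u_def[symmetric] norm_divide
      using ne[OF z] by (simp add: u_def divide_less_eq)
  qed
  have hbd: "norm (h (T w)) \<le> 4 * M * norm w / (1 - norm w)" if w: "norm w < 1" for w
  proof -
    define u where "u = h (T w)"
    have "norm u = norm (\<phi> w) * norm (of_real (4 * M) - u)"
      using ne[OF w] by (simp add: \<phi>_def u_def norm_divide)
    also have "\<dots> \<le> norm w * (4 * M + norm u)"
      using M norm_triangle_ineq4[of "of_real (4*M)" u] by (intro mult_mono \<phi> w) auto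
    finally have "norm u * (1 - norm w) \<le> 4 * M * norm w" by (simp add: algebra_simps)
    then show ?thesis using w by (simp add: u_def field_simps)
  qed
  \<comment> \<open>Half the distance from the disc of radius r to the larger circle, so that the
    Cauchy disc around s stays within radius (R + r)/2 of \<open>s0\<close>.\<close>
  define e where "e = (R - r) / 2"
  have e: "e > 0" using r by (simp add: e_def)
  have h_le: "norm (h z) \<le> 8 * M * R / (R - r)" if "z \<in> cball s e" for z
  proof -
    define w where "w = (z - s0) / of_real R"
    have z: "z = T w" using r by (simp add: T_def w_def)
    have "norm (z - s0) \<le> norm (z - s) + norm (s - s0)" by (metis dist_norm dist_triangle)
    also have "\<dots> \<le> e + r" using that s by (auto simp: dist_norm norm_minus_commute)
    finally have "norm (z - s0) \<le> (R + r) / 2" by (simp add: e_def field_simps)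
    then have w: "norm w \<le> (R + r) / (2 * R)" using r by (simp add: w_def norm_divide field_simps)
    also have w1: "(R + r) / (2 * R) < 1" using r by (simp add: field_simps)
    finally have w': "norm w < 1" .
    have "norm (h z) \<le> 4 * M * norm w / (1 - norm w)" unfolding z by (rule hbd[OF w'])
    also have "\<dots> \<le> 4 * M * 1 / (1 - (R + r) / (2 * R))"
      using w w' w1 M by (intro frac_le mult_left_mono mult_nonneg_nonneg) auto
    also have "\<dots> = 8 * M * R / (R - r)" using r by (simp add: field_simps)
    finally show ?thesis .
  qed
  have sub: "cball s e \<subseteq> ball s0 R"
  proof
    fix z assume "z \<in> cball s e"
    moreover have "dist s0 z \<le> dist s0 s + dist s z" by (rule dist_triangle)
    ultimately show "z \<in> ball s0 R" using s r by (auto simp: e_def field_simps)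
  qed
  have "norm ((deriv ^^ 1) h s) \<le> fact 1 * (8 * M * R / (R - r)) / e ^ 1"
  proof (rule Cauchy_inequality)
    show "h holomorphic_on ball s e" using hh by (rule holomorphic_on_subset) (use sub in auto)
    show "continuous_on (cball s e) h"
      using holomorphic_on_imp_continuous_on[OF holomorphic_on_subset[OF hh sub]] .
    show "norm (h x) \<le> 8 * M * R / (R - r)" if "norm (s - x) = e" for x
      using that by (intro h_le) (simp add: dist_norm)
  qed (use e in auto)
  also have "\<dots> = 16 * M * R / (R - r)\<^sup>2" using r by (simp add: e_def power2_eq_square field_simps)
  finally have "norm (deriv h s) \<le> 16 * M * R / (R - r)\<^sup>2" by simp
  moreover have "deriv g s / g s = deriv h s"
  proof -
    have sb: "s \<in> ball s0 R" using s r by auto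
    have dh: "(h has_field_derivative deriv h s) (at s)"
      using hh sb by (intro holomorphic_derivI) auto
    have "((\<lambda>z. g s0 * exp (h z)) has_field_derivative g s0 * (exp (h s) * deriv h s)) (at s)"
      by (auto intro!: derivative_eq_intros dh)
    then have "(g has_field_derivative g s0 * (exp (h s) * deriv h s)) (at s)"
      by (rule has_field_derivative_transform_within_open[of _ _ _ "ball s0 R"]) (use sb gh in auto)
    then show ?thesis using gh[OF sb] nz[OF s0] by (simp add: DERIV_imp_deriv)
  qed
  ultimately show ?thesis by simp
qed

text \<open>Each zero \<rho> in the disc of radius r satisfies |z - \<rho>| \<ge> 2r on the circle
  of radius 3r but |s0 - \<rho>| \<le> r. Dividing out n zeros thus gains a factor 2^n in the bound
  for g, which the maximum principle carries to the centre. There it forces 2^n \<le> exp M, which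
  counts the zeros; the same bound makes the zero-free factor g eligible for
  Borel-Caratheodory.\<close>

lemma landau_factorization:
  fixes f :: "complex \<Rightarrow> complex"
  assumes hol: "f holomorphic_on ball s0 R" and R: "3 * r < R" and r: "0 < r1" "r1 < r"
    and M: "M > 0" and f0: "f s0 \<noteq> 0"
    and bd: "\<And>z. z \<in> cball s0 (3 * r) \<Longrightarrow> norm (f z) \<le> exp M * norm (f s0)"
  shows "\<exists>g m. g holomorphic_on ball s0 R \<and> finite {z \<in> cball s0 r. f z = 0} \<and>
     (\<forall>z\<in>cball s0 r. g z \<noteq> 0) \<and>
     (\<forall>\<rho>\<in>{z \<in> cball s0 r. f z = 0}. (m \<rho> :: nat) \<ge> 1) \<and>
     (\<forall>z\<in>ball s0 R. f z = g z * (\<Prod>\<rho>\<in>{z \<in> cball s0 r. f z = 0}. (z - \<rho>) ^ m \<rho>)) \<and>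
     real (\<Sum>\<rho>\<in>{z \<in> cball s0 r. f z = 0}. m \<rho>) * ln 2 \<le> M \<and>
     (\<forall>s\<in>cball s0 r1. norm (deriv g s / g s) \<le> 16 * M * r / (r - r1)\<^sup>2)"
proof -
  define Z where "Z = {z \<in> cball s0 r. f z = 0}"
  define A where "A = ball s0 R"
  have A: "open A" "connected A" by (auto simp: A_def)
  have s0A: "s0 \<in> A" using r R by (simp add: A_def)
  have KA: "cball s0 r \<subseteq> A" and K3A: "cball s0 (3 * r) \<subseteq> A" using r R by (auto simp: A_def)
  have finZ: "finite Z"
  proof (cases "f constant_on A")
    case True
    then have "f z = f s0" if "z \<in> A" for z using that s0A by (auto simp: constant_on_def)
    then have "Z = {}" using f0 KA by (auto simp: Z_def)
    then show ?thesis by simp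
  next
    case False
    then show ?thesis unfolding Z_def
      using holomorphic_compact_finite_zeros[OF hol[folded A_def] A compact_cball KA] by blast
  qed
  have "\<exists>g m. g holomorphic_on A \<and> (\<forall>z\<in>Z. g z \<noteq> 0 \<and> (m z :: nat) \<ge> 1) \<and>
    (\<forall>z\<in>A. f z = g z * (\<Prod>\<rho>\<in>Z. (z - \<rho>) ^ m \<rho>))"
    by (rule holomorphic_factor_zeros[OF A]) (use hol f0 s0A KA finZ in \<open>auto simp: A_def Z_def\<close>)
  then obtain g m where g: "g holomorphic_on A" "\<And>z. z \<in> Z \<Longrightarrow> g z \<noteq> 0" "\<And>z. z \<in> Z \<Longrightarrow> (m z :: nat) \<ge> 1"
    and fg: "\<And>z. z \<in> A \<Longrightarrow> f z = g z * (\<Prod>\<rho>\<in>Z. (z - \<rho>) ^ m \<rho>)" by blast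
  define n where "n = (\<Sum>\<rho>\<in>Z. m \<rho>)"
  have gnz: "g z \<noteq> 0" if "z \<in> cball s0 r" for z
    using g(2)[of z] fg[of z] that KA by (cases "z \<in> Z") (auto simp: Z_def)
  have f0_le: "norm (f s0) \<le> norm (g s0) * r ^ n"
  proof -
    have "norm (f s0) = norm (g s0) * (\<Prod>\<rho>\<in>Z. norm (s0 - \<rho>) ^ m \<rho>)"
      by (simp add: fg[OF s0A] norm_mult norm_power flip: prod_norm)
    also have "\<dots> \<le> norm (g s0) * (\<Prod>\<rho>\<in>Z. r ^ m \<rho>)"
      by (intro mult_left_mono prod_mono conjI power_mono) (auto simp: Z_def dist_norm)
    finally show ?thesis by (simp add: n_def power_sum)
  qed
  have sph: "norm (g z) \<le> exp M * norm (g s0) / 2 ^ n" if z: "dist s0 z = 3 * r" for z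
  proof -
    have zA: "z \<in> A" using z K3A by auto
    have "norm (g z) * (2 * r) ^ n = norm (g z) * (\<Prod>\<rho>\<in>Z. (2 * r) ^ m \<rho>)"
      by (simp add: n_def power_sum)
    also have "\<dots> \<le> norm (g z) * (\<Prod>\<rho>\<in>Z. norm (z - \<rho>) ^ m \<rho>)"
    proof (intro mult_left_mono prod_mono conjI power_mono)
      fix \<rho> assume "\<rho> \<in> Z"
      then have "dist s0 \<rho> \<le> r" by (simp add: Z_def)
      moreover have "dist s0 z \<le> dist s0 \<rho> + dist \<rho> z" by (rule dist_triangle)
      ultimately show "2 * r \<le> norm (z - \<rho>)" using z by (simp add: dist_norm norm_minus_commute)
    qed (use r in auto)
    also have "\<dots> = norm (f z)" by (simp add: fg[OF zA] norm_mult norm_power flip: prod_norm)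
    also have "\<dots> \<le> exp M * norm (f s0)" using z by (intro bd) auto
    also have "\<dots> \<le> exp M * (norm (g s0) * r ^ n)" using f0_le by simp
    finally have "norm (g z) * (2 ^ n) * r ^ n \<le> exp M * norm (g s0) * r ^ n"
      by (simp add: power_mult_distrib mult_ac)
    then have "norm (g z) * (2 ^ n) \<le> exp M * norm (g s0)" using r by simp
    then show ?thesis by (simp add: field_simps)
  qed
  have all: "norm (g z) \<le> exp M * norm (g s0) / 2 ^ n" if z: "z \<in> cball s0 (3 * r)" for z
  proof (rule maximum_modulus_frontier[of g "cball s0 (3 * r)"])
    show "g holomorphic_on interior (cball s0 (3 * r))"
      using g(1) by (rule holomorphic_on_subset) (use K3A interior_subset in blast)
    show "continuous_on (closure (cball s0 (3 * r))) g"
      using holomorphic_on_imp_continuous_on[OF holomorphic_on_subset[OF g(1) K3A]] by simp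
    show "norm (g z) \<le> exp M * norm (g s0) / 2 ^ n" if "z \<in> frontier (cball s0 (3 * r))" for z
      using that r by (intro sph) (simp add: frontier_cball sphere_def)
  qed (use z in auto)
  have count: "real n * ln 2 \<le> M"
  proof -
    have "norm (g s0) \<le> exp M * norm (g s0) / 2 ^ n" using r by (intro all) auto
    moreover have "g s0 \<noteq> 0" using r by (intro gnz) auto
    ultimately have "2 ^ n \<le> exp M" by (simp add: field_simps)
    then have "ln (2 ^ n) \<le> ln (exp M)" by (subst ln_le_cancel_iff) auto
    then show ?thesis by (simp add: ln_realpow)
  qed
  have ld: "norm (deriv g s / g s) \<le> 16 * M * r / (r - r1)\<^sup>2" if s: "s \<in> cball s0 r1" for s
  proof (rule log_deriv_bound_nonvanishing[OF _ _ _ M r s])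
    show "g holomorphic_on ball s0 r" using g(1) by (rule holomorphic_on_subset) (use KA in auto)
    show "norm (g z) \<le> exp M * norm (g s0)" if "z \<in> ball s0 r" for z
    proof -
      have "norm (g z) \<le> exp M * norm (g s0) / 2 ^ n" using that r by (intro all) auto
      also have "\<dots> \<le> exp M * norm (g s0) / 1" by (intro divide_left_mono) auto
      finally show ?thesis by simp
    qed
  qed (use gnz in auto)
  show ?thesis unfolding Z_def[symmetric] A_def[symmetric]
    using g gnz finZ fg count ld unfolding n_def by (intro exI[of _ g] exI[of _ m]) auto
qed

section \<open>Polynomial growth of the zeta function\<close>

text \<open>The entire function (s - 1) \<zeta>(s). Growth is derived from a recurrence in the
  shifts s + j, and working with this function keeps the pole at 1 out of it.\<close>

definition entire_zeta :: "complex \<Rightarrow> complex" where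
  "entire_zeta = (SOME F. F holomorphic_on UNIV \<and>
     (\<forall>s. Re s > 1 \<longrightarrow> F s = (s - 1) * (\<Sum>n. of_nat (Suc n) powr (-s))))"

lemma entire_zeta_holomorphic: "entire_zeta holomorphic_on S"
  and entire_zeta_series: "Re s > 1 \<Longrightarrow> entire_zeta s = (s - 1) * (\<Sum>n. of_nat (Suc n) powr (-s))"
  using someI_ex[OF zeta_continuation, folded entire_zeta_def] holomorphic_on_subset by blast+

lemma entire_zeta_eq:
  assumes "s \<noteq> 1"
  shows "entire_zeta s = (s - 1) * zeta s"
proof (rule analytic_continuation_open[of "{s. Re s > 1}" "- {1}" entire_zeta "\<lambda>s. (s - 1) * zeta s"])
  show "{s. Re s > 1} \<noteq> {}" by (auto intro!: exI[of _ 2])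
  show "connected (- {1::complex})" by (intro connected_punctured_universe) simp
  show "(\<lambda>s. (s - 1) * zeta s) holomorphic_on - {1}"
    using is_zeta_zeta by (auto simp: is_zeta_def intro!: holomorphic_intros)
  show "entire_zeta z = (z - 1) * zeta z" if "z \<in> {s. Re s > 1}" for z
    using that is_zeta_zeta by (auto simp: entire_zeta_series is_zeta_def sums_iff simp del: of_nat_Suc)
qed (use assms in \<open>auto simp: open_halfspace_Re_gt entire_zeta_holomorphic\<close>)

text \<open>The identity known for Re s > 1 persists by analytic continuation. All shifts on the
  right have a strictly larger real part, so growth estimates can be pushed to the left one unit at
  a time.\<close>

lemma entire_zeta_recurrence:
  assumes "Re s > - real m"
  shows "entire_zeta s = 1 + (\<Sum>n. zeta_rem (Suc m) n s)
           - (\<Sum>j<m. ((1 - s) gchoose Suc j) / of_nat (j + 2) * entire_zeta (s + of_nat (Suc j)))"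
proof -
  define G where "G = (\<lambda>s. 1 + (\<Sum>n. zeta_rem (Suc m) n s)
     - (\<Sum>j<m. ((1 - s) gchoose Suc j) / of_nat (j + 2) * entire_zeta (s + of_nat (Suc j))))"
  have sh: "(\<lambda>s. entire_zeta (s + of_nat (Suc j))) holomorphic_on S" for j S
    by (rule holomorphic_on_compose_gen[OF _ entire_zeta_holomorphic[of UNIV], unfolded o_def])
       (auto intro!: holomorphic_intros)
  have "entire_zeta s = G s"
  proof (rule analytic_continuation_open[of "{s. Re s > 1}" "{s. Re s > 1 - real (Suc m)}" entire_zeta G])
    show "{s. Re s > 1} \<noteq> {}" by (auto intro!: exI[of _ 2])
    show "connected {s. Re s > 1 - real (Suc m)}"
      by (intro convex_connected convex_halfspace_Re_gt)
    show "G holomorphic_on {s. Re s > 1 - real (Suc m)}"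
      unfolding G_def gchoose_fact_prod[symmetric]
      by (intro holomorphic_intros zeta_rem_sum_holomorphic sh) auto
    show "entire_zeta z = G z" if "z \<in> {s. Re s > 1}" for z
      using that zeta_series_recurrence[of z m] unfolding G_def
      by (simp add: entire_zeta_series del: of_nat_Suc) (simp add: algebra_simps)
  qed (use assms in \<open>auto simp: open_halfspace_Re_gt entire_zeta_holomorphic\<close>)
  then show ?thesis by (simp add: G_def)
qed

section \<open>Closure properties of polynomially bounded functions\<close>

text \<open>The base |s| + 2 exceeds 1, so exponents may be raised freely; together with C \<ge> 0
  this lets two bounds be merged into one.\<close>

definition poly_bounded :: "complex set \<Rightarrow> (complex \<Rightarrow> complex) \<Rightarrow> bool" where
  "poly_bounded S f \<longleftrightarrow> (\<exists>C A. C \<ge> 0 \<and> (\<forall>s\<in>S. norm (f s) \<le> C * (norm s + 2) ^ A))"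

lemma poly_boundedI:
  assumes "\<And>s. s \<in> S \<Longrightarrow> norm (f s) \<le> C * (norm s + 2) ^ A"
  shows "poly_bounded S f"
  unfolding poly_bounded_def
proof (intro exI[of _ "\<bar>C\<bar>"] exI[of _ A] conjI ballI)
  fix s assume "s \<in> S"
  then have "norm (f s) \<le> C * (norm s + 2) ^ A" by (rule assms)
  also have "\<dots> \<le> \<bar>C\<bar> * (norm s + 2) ^ A" by (intro mult_right_mono) auto
  finally show "norm (f s) \<le> \<bar>C\<bar> * (norm s + 2) ^ A" .
qed auto

lemma poly_bounded_const: "poly_bounded S (\<lambda>_. c)"
  by (rule poly_boundedI[of _ _ "norm c" 0]) simp

lemma poly_bounded_add:
  assumes "poly_bounded S f" "poly_bounded S g"
  shows "poly_bounded S (\<lambda>s. f s + g s)"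
proof -
  obtain C A where f: "C \<ge> 0" "\<And>s. s \<in> S \<Longrightarrow> norm (f s) \<le> C * (norm s + 2) ^ A"
    using assms(1) by (auto simp: poly_bounded_def)
  obtain D B where g: "D \<ge> 0" "\<And>s. s \<in> S \<Longrightarrow> norm (g s) \<le> D * (norm s + 2) ^ B"
    using assms(2) by (auto simp: poly_bounded_def)
  show ?thesis
  proof (rule poly_boundedI[of _ _ "C + D" "A + B"])
    fix s assume s: "s \<in> S"
    have "norm (f s + g s) \<le> C * (norm s + 2) ^ A + D * (norm s + 2) ^ B"
      using norm_triangle_ineq[of "f s" "g s"] f(2)[OF s] g(2)[OF s] by linarith
    also have "\<dots> \<le> C * (norm s + 2) ^ (A + B) + D * (norm s + 2) ^ (A + B)"
      using f(1) g(1) by (intro add_mono mult_left_mono power_increasing) auto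
    finally show "norm (f s + g s) \<le> (C + D) * (norm s + 2) ^ (A + B)" by (simp add: algebra_simps)
  qed
qed

lemma poly_bounded_mult:
  assumes "poly_bounded S f" "poly_bounded S g"
  shows "poly_bounded S (\<lambda>s. f s * g s)"
proof -
  obtain C A where f: "C \<ge> 0" "\<And>s. s \<in> S \<Longrightarrow> norm (f s) \<le> C * (norm s + 2) ^ A"
    using assms(1) by (auto simp: poly_bounded_def)
  obtain D B where g: "D \<ge> 0" "\<And>s. s \<in> S \<Longrightarrow> norm (g s) \<le> D * (norm s + 2) ^ B"
    using assms(2) by (auto simp: poly_bounded_def)
  show ?thesis
  proof (rule poly_boundedI[of _ _ "C * D" "A + B"])
    fix s assume s: "s \<in> S"
    have "norm (f s * g s) \<le> (C * (norm s + 2) ^ A) * (D * (norm s + 2) ^ B)"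
      unfolding norm_mult using f g s by (intro mult_mono) auto
    then show "norm (f s * g s) \<le> C * D * (norm s + 2) ^ (A + B)" by (simp add: power_add mult_ac)
  qed
qed

lemma poly_bounded_sum:
  assumes "finite I" "\<And>i. i \<in> I \<Longrightarrow> poly_bounded S (f i)"
  shows "poly_bounded S (\<lambda>s. \<Sum>i\<in>I. f i s)"
  using assms by (induction I) (auto intro: poly_bounded_const poly_bounded_add)

lemma poly_bounded_prod:
  assumes "finite I" "\<And>i. i \<in> I \<Longrightarrow> poly_bounded S (f i)"
  shows "poly_bounded S (\<lambda>s. \<Prod>i\<in>I. f i s)"
  using assms by (induction I) (auto intro: poly_bounded_const poly_bounded_mult)

lemma poly_bounded_uminus: "poly_bounded S f \<Longrightarrow> poly_bounded S (\<lambda>s. - f s)"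
  by (simp add: poly_bounded_def)

lemma poly_bounded_ident: "poly_bounded S (\<lambda>s. s)"
  by (rule poly_boundedI[of _ _ 1 1]) simp

lemma poly_bounded_shift:
  assumes "poly_bounded S f" "\<And>s. s \<in> T \<Longrightarrow> s + c \<in> S"
  shows "poly_bounded T (\<lambda>s. f (s + c))"
proof -
  obtain C A where f: "C \<ge> 0" "\<And>s. s \<in> S \<Longrightarrow> norm (f s) \<le> C * (norm s + 2) ^ A"
    using assms(1) by (auto simp: poly_bounded_def)
  show ?thesis
  proof (rule poly_boundedI[of _ _ "C * (1 + norm c) ^ A" A])
    fix s assume s: "s \<in> T"
    have "norm (s + c) + 2 \<le> norm s + norm c + 2" using norm_triangle_ineq[of s c] by simp
    also have "\<dots> \<le> (1 + norm c) * (norm s + 2)" by (simp add: algebra_simps)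
    finally have "(norm (s + c) + 2) ^ A \<le> ((1 + norm c) * (norm s + 2)) ^ A"
      by (intro power_mono) auto
    then have "C * (norm (s + c) + 2) ^ A \<le> C * ((1 + norm c) * (norm s + 2)) ^ A"
      using f(1) by (rule mult_left_mono)
    with f(2)[OF assms(2)[OF s]]
    show "norm (f (s + c)) \<le> C * (1 + norm c) ^ A * (norm s + 2) ^ A"
      by (simp add: power_mult_distrib mult_ac)
  qed
qed

lemma poly_bounded_Un:
  assumes "poly_bounded S f" "poly_bounded T f"
  shows "poly_bounded (S \<union> T) f"
proof -
  obtain C A where f: "C \<ge> 0" "\<And>s. s \<in> S \<Longrightarrow> norm (f s) \<le> C * (norm s + 2) ^ A"
    using assms(1) by (auto simp: poly_bounded_def)
  obtain D B where g: "D \<ge> 0" "\<And>s. s \<in> T \<Longrightarrow> norm (f s) \<le> D * (norm s + 2) ^ B"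
    using assms(2) by (auto simp: poly_bounded_def)
  show ?thesis
  proof (rule poly_boundedI[of _ _ "C + D" "A + B"])
    fix s assume "s \<in> S \<union> T"
    moreover have "C * (norm s + 2) ^ A \<le> (C + D) * (norm s + 2) ^ (A + B)"
      "D * (norm s + 2) ^ B \<le> (C + D) * (norm s + 2) ^ (A + B)"
      using f(1) g(1) by (intro mult_mono power_increasing; simp)+
    ultimately show "norm (f s) \<le> (C + D) * (norm s + 2) ^ (A + B)"
      using f(2)[of s] g(2)[of s] by auto
  qed
qed

text \<open>The left edge makes the exponent - Re s - m at most -3/2, so one convergent series
  dominates throughout the strip; the right edge bounds the power of 2. What remains depends on s
  only through a polynomial in |s|.\<close>

lemma poly_bounded_zeta_rem_sum:
  "poly_bounded {s. 3/2 - real m \<le> Re s \<and> Re s \<le> 3/2} (\<lambda>s. \<Sum>n. zeta_rem m n s)"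
proof -
  define K where "K = (\<Sum>n. real (Suc n) powr (-3/2))"
  have summ: "summable (\<lambda>n. real (Suc n) powr (-3/2))" by (rule summable_Suc_powr) simp
  have K: "K \<ge> 0" unfolding K_def by (intro suminf_nonneg summ) auto
  define Q where "Q = (\<lambda>s::complex. \<Prod>i<Suc m. norm s + 1 + real i)"
  have Q: "Q s \<ge> 0" for s unfolding Q_def by (intro prod_nonneg) auto
  have *: "norm (\<Sum>n. zeta_rem m n s) \<le> norm (complex_of_real (2 powr (real m + 3/2) * K) * 
      (\<Prod>i<Suc m. complex_of_real (norm s) + (1 + of_nat i)))"
    if s: "3/2 - real m \<le> Re s" "Re s \<le> 3/2" for s
  proof -
    have bd: "norm (zeta_rem m n s) \<le> Q s * 2 powr (real m + 3/2) * real (Suc n) powr (-3/2)" for n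
    proof -
      have "norm (zeta_rem m n s) \<le> Q s * 2 powr (\<bar>Re s + real m\<bar>) * real (Suc n) powr (- Re s - real m)"
        unfolding Q_def by (rule norm_zeta_rem_le)
      also have "\<dots> \<le> Q s * 2 powr (real m + 3/2) * real (Suc n) powr (-3/2)"
        using s Q by (intro mult_mono powr_mono mult_nonneg_nonneg) auto
      finally show ?thesis .
    qed
    have "norm (\<Sum>n. zeta_rem m n s) \<le> (\<Sum>n. Q s * 2 powr (real m + 3/2) * real (Suc n) powr (-3/2))"
      by (rule norm_suminf_le[OF bd]) (intro summable_mult summ)
    also have "\<dots> = Q s * 2 powr (real m + 3/2) * K" unfolding K_def by (rule suminf_mult[OF summ])
    also have "Q s = norm (\<Prod>i<Suc m. complex_of_real (norm s) + (1 + of_nat i))"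
    proof -
      have "(\<Prod>i<Suc m. complex_of_real (norm s) + (1 + of_nat i)) = of_real (Q s)"
        unfolding Q_def of_real_prod by (intro prod.cong) auto
      then show ?thesis using Q by simp
    qed
    finally show ?thesis using K by (simp add: norm_mult mult_ac)
  qed
  have n: "poly_bounded S (\<lambda>s. complex_of_real (norm s))" for S
    by (rule poly_boundedI[of _ _ 1 1]) simp
  have "poly_bounded {s. 3/2 - real m \<le> Re s \<and> Re s \<le> 3/2} 
     (\<lambda>s. complex_of_real (2 powr (real m + 3/2) * K) * (\<Prod>i<Suc m. complex_of_real (norm s) + (1 + of_nat i)))"
    by (intro poly_bounded_mult poly_bounded_const poly_bounded_prod poly_bounded_add n) auto
  then obtain C A where CA: "\<And>s. s \<in> {s. 3/2 - real m \<le> Re s \<and> Re s \<le> 3/2} \<Longrightarrow>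
     norm (complex_of_real (2 powr (real m + 3/2) * K) *
       (\<Prod>i<Suc m. complex_of_real (norm s) + (1 + of_nat i))) \<le> C * (norm s + 2) ^ A"
    unfolding poly_bounded_def by blast
  show ?thesis
    by (rule poly_boundedI[of _ _ C A], rule order_trans[OF * CA]) auto
qed

lemma poly_bounded_gchoose: "poly_bounded S (\<lambda>s. (1 - s) gchoose k)"
  unfolding gchoose_fact_prod[symmetric] divide_inverse diff_conv_add_uminus
  by (intro poly_bounded_mult poly_bounded_prod poly_bounded_add poly_bounded_const
        poly_bounded_uminus poly_bounded_ident) auto

text \<open>The base case is absolute convergence for Re s \<ge> 3/2. Each induction step adds a
  strip through the recurrence, whose shifted values already lie in the half-plane that has been
  treated.\<close>

lemma poly_bounded_entire_zeta: "poly_bounded {s. Re s \<ge> 3/2 - real m} entire_zeta"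
proof (induction m)
  case 0
  define K where "K = (\<Sum>n. real (Suc n) powr (-3/2))"
  have summ: "summable (\<lambda>n. real (Suc n) powr (-3/2))" by (rule summable_Suc_powr) simp
  have K: "K \<ge> 0" unfolding K_def by (intro suminf_nonneg summ) auto
  show ?case
  proof (rule poly_boundedI[of _ _ K 1])
    fix s :: complex assume "s \<in> {s. 3/2 - real 0 \<le> Re s}"
    then have s: "Re s \<ge> 3/2" by simp
    have "norm (\<Sum>n. of_nat (Suc n) powr (-s)) \<le> K" unfolding K_def
    proof (rule norm_suminf_le[OF _ summ])
      show "norm (of_nat (Suc n) powr (-s)) \<le> real (Suc n) powr (-3/2)" for n
        unfolding norm_Suc_powr using s by (intro powr_mono) auto
    qed
    then have "norm (entire_zeta s) \<le> norm (s - 1) * K"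
      using s by (simp add: entire_zeta_series norm_mult mult_left_mono del: of_nat_Suc)
    also have "\<dots> \<le> (norm s + 2) * K"
      using K norm_triangle_ineq4[of s 1] by (intro mult_right_mono) auto
    finally show "norm (entire_zeta s) \<le> K * (norm s + 2) ^ 1" by (simp add: mult_ac)
  qed
next
  case (Suc m)
  define T where "T = {s. 3/2 - real (Suc m) \<le> Re s \<and> Re s \<le> 3/2}"
  have "poly_bounded T (\<lambda>s. 1 + (\<Sum>n. zeta_rem (Suc m) n s)
     + - (\<Sum>j<m. ((1 - s) gchoose Suc j) * inverse (of_nat (j + 2)) * entire_zeta (s + of_nat (Suc j))))"
    unfolding T_def
    by (intro poly_bounded_add poly_bounded_const poly_bounded_zeta_rem_sum poly_bounded_uminus
          poly_bounded_sum poly_bounded_mult poly_bounded_gchoose poly_bounded_shift[OF Suc]) auto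
  also have "?this \<longleftrightarrow> poly_bounded T entire_zeta"
  proof -
    have "1 + (\<Sum>n. zeta_rem (Suc m) n s) + - (\<Sum>j<m. ((1 - s) gchoose Suc j) * 
        inverse (of_nat (j + 2)) * entire_zeta (s + of_nat (Suc j))) = entire_zeta s" if "s \<in> T" for s
    proof -
      have "- real m < Re s" using that by (simp add: T_def)
      from entire_zeta_recurrence[OF this] show ?thesis
        by (simp only: divide_inverse diff_conv_add_uminus)
    qed
    then show ?thesis unfolding poly_bounded_def by (simp cong: ball_cong del: of_nat_Suc)
  qed
  finally have "poly_bounded (T \<union> {s. Re s \<ge> 3/2 - real m}) entire_zeta"
    using Suc by (intro poly_bounded_Un)
  also have "T \<union> {s. Re s \<ge> 3/2 - real m} = {s. Re s \<ge> 3/2 - real (Suc m)}"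
    by (auto simp: T_def)
  finally show ?case .
qed

section \<open>Growth of \<zeta> relative to its value at the centre 2 + i \<gamma>\<close>

lemma norm_zeta_ge_quarter:
  assumes "Re s = 2"
  shows "norm (zeta s) \<ge> 1/4"
proof -
  have "(\<lambda>n. of_nat (Suc n) powr (-s)) sums zeta s"
    using is_zeta_zeta assms by (auto simp: is_zeta_def)
  from sums_split_initial_segment[OF this, of 1]
  have 1: "(\<lambda>n. of_nat (Suc (Suc n)) powr (-s)) sums (zeta s - 1)" by simp
  have "(\<lambda>n. 1 / real ((n + 1)\<^sup>2)) sums (pi\<^sup>2 / 6)" using inverse_squares_sums by simp
  from sums_split_initial_segment[OF this, of 1]
  have 2: "(\<lambda>n. 1 / real ((n + 2)\<^sup>2)) sums (pi\<^sup>2 / 6 - 1)" by simp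
  have "norm (zeta s - 1) \<le> pi\<^sup>2 / 6 - 1"
    unfolding sums_unique[OF 1] sums_unique[OF 2]
  proof (rule norm_suminf_le)
    show "norm (of_nat (Suc (Suc n)) powr (-s)) \<le> 1 / real ((n + 2)\<^sup>2)" for n
    proof -
      have "real (Suc (Suc n)) powr Re (-s) = inverse (real (n + 2) powr 2)"
        using assms by (simp add: powr_minus)
      then show ?thesis unfolding norm_Suc_powr by (simp add: powr_numeral divide_inverse)
    qed
  qed (use 2 in \<open>simp add: sums_iff\<close>)
  also have "pi\<^sup>2 \<le> 3.2\<^sup>2" using pi_approx by (intro power_mono) auto
  finally have "norm (zeta s - 1) \<le> 3/4" by (simp add: power2_eq_square)
  moreover have "norm (1::complex) \<le> norm (zeta s) + norm (zeta s - 1)"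
    by (metis norm_triangle_sub norm_minus_commute)
  ultimately show ?thesis by simp
qed

text \<open>The input for Landau's lemma with r = 2, hence the radius 6. The condition \<gamma>
  \<ge> 20 keeps the disc away from the pole at 1.\<close>

lemma zeta_log_growth:
  "\<exists>A>0. \<forall>\<gamma>\<ge>20. \<forall>s\<in>cball (Complex 2 \<gamma>) 6. norm (zeta s) \<le> exp (A * ln \<gamma>) * norm (zeta (Complex 2 \<gamma>))"
proof -
  \<comment> \<open>The disc reaches left to real part -4, and m = 6 covers Re s \<ge> -9/2.\<close>
  obtain C A where CA: "C \<ge> 0" "\<And>s. Re s \<ge> -9/2 \<Longrightarrow> norm (entire_zeta s) \<le> C * (norm s + 2) ^ A"
    using poly_bounded_entire_zeta[of 6] by (auto simp: poly_bounded_def)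
  \<comment> \<open>On the disc |s| + 2 \<le> \<gamma>^2, hence the exponent 2A. As ln \<gamma>
    \<ge> 1, the logarithmic summand absorbs the constant C + 1 and the lower bound 1/4 for the
    value at the centre.\<close>
  define B where "B = real A * 2 + ln (4 * (C + 1)) + 1"
  have B: "B > 0" unfolding B_def using CA(1) by (intro add_nonneg_pos add_nonneg_nonneg) auto
  show ?thesis
  proof (intro exI[of _ B] conjI allI impI ballI)
    fix \<gamma> :: real and s assume g: "\<gamma> \<ge> 20" and s: "s \<in> cball (Complex 2 \<gamma>) 6"
    have d: "norm (Complex 2 \<gamma> - s) \<le> 6" using s by (simp add: dist_norm)
    have re: "Re s \<ge> -4" using abs_Re_le_cmod[of "Complex 2 \<gamma> - s"] d by simp
    have im: "Im s \<ge> 1" using abs_Im_le_cmod[of "Complex 2 \<gamma> - s"] d g by simp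
    have ns: "norm s + 2 \<le> \<gamma> * \<gamma>"
    proof -
      have "norm s \<le> norm (Complex 2 \<gamma>) + 6" using norm_triangle_sub[of s "Complex 2 \<gamma>"] d
        by (simp add: norm_minus_commute)
      also have "norm (Complex 2 \<gamma>) \<le> 2 + \<gamma>" using cmod_le[of "Complex 2 \<gamma>"] g by simp
      finally have "norm s + 2 \<le> \<gamma> + 10" by simp
      also have "\<dots> \<le> 2 * \<gamma>" using g by simp
      also have "\<dots> \<le> \<gamma> * \<gamma>" using g by (intro mult_right_mono) auto
      finally show ?thesis .
    qed
    have s1: "norm (s - 1) \<ge> 1" using abs_Im_le_cmod[of "s - 1"] im by simp
    then have "s \<noteq> 1" by auto
    then have "norm (zeta s) \<le> norm (s - 1) * norm (zeta s)" "entire_zeta s = (s - 1) * zeta s"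
      using s1 by (auto simp: mult_left_le_one_le mult_le_cancel_right1 entire_zeta_eq)
    then have "norm (zeta s) \<le> norm (entire_zeta s)" by (simp add: norm_mult)
    also have "\<dots> \<le> C * (norm s + 2) ^ A" using re by (intro CA(2)) simp
    also have "\<dots> \<le> (C + 1) * (\<gamma> * \<gamma>) ^ A" using CA(1) ns by (intro mult_mono power_mono) auto
    also have "\<dots> = exp (ln (C + 1) + real A * 2 * ln \<gamma>)"
    proof -
      have "(\<gamma> * \<gamma>) ^ A = exp (real A * 2 * ln \<gamma>)"
      proof -
        have "\<gamma> * \<gamma> = exp (2 * ln \<gamma>)" using g by (simp add: exp_double power2_eq_square)
        then show ?thesis by (simp only: exp_of_nat_mult mult.assoc)
      qed
      then show ?thesis using CA(1) by (simp add: exp_add)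
    qed
    also have "\<dots> \<le> exp (B * ln \<gamma> + ln (1/4))"
    proof -
      have l: "ln \<gamma> \<ge> 1" using g exp_le by (subst ln_ge_iff) auto
      have "ln (4 * (C + 1)) \<le> ln (4 * (C + 1)) * ln \<gamma>"
        using CA(1) l by (simp add: mult_le_cancel_left1)
      then have "ln (4 * (C + 1)) + real A * 2 * ln \<gamma> \<le> B * ln \<gamma>"
        using l by (simp add: B_def algebra_simps)
      moreover have "ln (4 * (C + 1)) = ln 4 + ln (C + 1)" using CA(1) by (intro ln_mult_pos) auto
      ultimately show ?thesis by (simp add: ln_div)
    qed
    also have "\<dots> = exp (B * ln \<gamma>) * (1/4)" by (subst exp_add) simp
    also have "\<dots> \<le> exp (B * ln \<gamma>) * norm (zeta (Complex 2 \<gamma>))"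
      by (intro mult_left_mono norm_zeta_ge_quarter) auto
    finally show "norm (zeta s) \<le> exp (B * ln \<gamma>) * norm (zeta (Complex 2 \<gamma>))" .
  qed (use B in auto)
qed

section \<open>The functional equation\<close>

text \<open>Substitute y = u x^p in Euler's integral. The case p = 1 gives Laplace transforms of
  powers and p = 2 the Gaussian moments.\<close>

lemma nn_integral_Gamma_powr:
  fixes p a u :: real
  assumes "p > 0" "a > 0" "u > 0"
  shows "(\<integral>\<^sup>+x. ennreal (x powr (p * a - 1) * exp (- (u * x powr p))) * indicator {0<..} x \<partial>lborel)
    = ennreal (Gamma a / (p * u powr a))"
proof -
  define f where "f = (\<lambda>y::real. y powr (a - 1) / exp y)"
  define g where "g = (\<lambda>x::real. u * x powr p)"
  define g' where "g' = (\<lambda>x::real. u * (p * x powr (p - 1)))"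
  have "(f has_integral Gamma a) {0..}" unfolding f_def by (rule Gamma_integral_real) fact
  moreover have "negligible {x \<in> {0..} - {0<..}. f x \<noteq> 0}" "negligible {x \<in> {0<..} - {0..}. f x \<noteq> 0}"
    by (rule negligible_subset[OF negligible_sing[of 0]]; auto)+
  ultimately have f: "(f has_integral Gamma a) {0<..}" using has_integral_spike_set_eq by blast
  have img: "g ` {0<..} = {0<..}"
  proof (intro equalityI subsetI)
    fix y :: real assume y: "y \<in> {0<..}"
    then have "y = g ((y / u) powr (1 / p))" using assms by (simp add: g_def powr_powr)
    then show "y \<in> g ` {0<..}" using y assms by (intro image_eqI[of _ _ "(y / u) powr (1 / p)"]) auto
  qed (use assms in \<open>auto simp: g_def\<close>)
  have inj: "inj_on g {0<..}"
  proof (rule inj_onI)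
    fix x y assume xy: "x \<in> {0<..}" "y \<in> {0<..}" "g x = g y"
    then have "(x powr p) powr (1/p) = (y powr p) powr (1/p)" using assms by (simp add: g_def)
    then show "x = y" using xy assms by (simp add: powr_powr)
  qed
  have "f absolutely_integrable_on (g ` {0<..}) \<and> integral (g ` {0<..}) f = Gamma a"
    unfolding img using f by (auto intro!: nonnegative_absolutely_integrable_1 simp: f_def)
  then have "(\<lambda>x. \<bar>g' x\<bar> * f (g x)) absolutely_integrable_on {0<..} \<and>
       integral {0<..} (\<lambda>x. \<bar>g' x\<bar> * f (g x)) = Gamma a"
    by (subst has_absolute_integral_change_of_variables_1'[OF _ _ inj])
       (use assms in \<open>auto simp: g_def g'_def intro!: derivative_eq_intros\<close>)
  then have I: "((\<lambda>x. \<bar>g' x\<bar> * f (g x)) has_integral Gamma a) {0<..}"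
    using set_lebesgue_integral_eq_integral(1) by (auto simp: has_integral_iff)
  have eq: "\<bar>g' x\<bar> * f (g x) = p * u powr a * (x powr (p * a - 1) * exp (- (u * x powr p)))"
    if "x > 0" for x
  proof -
    have "\<bar>g' x\<bar> * f (g x) = p * (u * u powr (a - 1)) * (x powr (p - 1) * x powr (p * (a - 1))) / exp (u * x powr p)"
      using that assms by (simp add: f_def g_def g'_def powr_mult powr_powr)
    also have "u * u powr (a - 1) = u powr a" using assms by (simp add: powr_mult_base)
    also have "x powr (p - 1) * x powr (p * (a - 1)) = x powr (p * a - 1)"
      by (simp add: algebra_simps flip: powr_add)
    finally show ?thesis by (simp add: exp_minus divide_inverse)
  qed
  have "((\<lambda>x. p * u powr a * (x powr (p * a - 1) * exp (- (u * x powr p)))) has_integral Gamma a) {0<..}"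
    using eq by (intro has_integral_eq[OF _ I]) auto
  from has_integral_mult_right[OF this, of "1 / (p * u powr a)"]
  have "((\<lambda>x. x powr (p * a - 1) * exp (- (u * x powr p))) has_integral Gamma a / (p * u powr a)) {0<..}"
    using assms by (simp add: field_simps)
  then show ?thesis by (intro nn_integral_has_integral_lebesgue') auto
qed

text \<open>Write 1/(x^2 + a^2) as the integral of exp(-u (x^2 + a^2)) over u > 0 and swap the
  integrals: x contributes a Gaussian moment and u another Gamma integral. The two Gamma values are
  left as a product, the form in which they later enter the functional equation.\<close>

lemma nn_integral_powr_over_square:
  fixes \<sigma> a :: real
  assumes "-1 < \<sigma>" "\<sigma> < 1" "a > 0"
  shows "(\<integral>\<^sup>+x. ennreal (x powr \<sigma> / (x\<^sup>2 + a\<^sup>2)) * indicator {0<..} x \<partial>lborel) =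
    ennreal (Gamma ((1 + \<sigma>) / 2) * Gamma ((1 - \<sigma>) / 2) * a powr (\<sigma> - 1) / 2)"
proof -
  have "(\<integral>\<^sup>+x. ennreal (x powr \<sigma> / (x\<^sup>2 + a\<^sup>2)) * indicator {0<..} x \<partial>lborel) =
    (\<integral>\<^sup>+x. (\<integral>\<^sup>+u. ennreal (x powr \<sigma> * exp (- (u * (x\<^sup>2 + a\<^sup>2)))) * indicator {0<..} x * indicator {0<..} u \<partial>lborel) \<partial>lborel)"
  proof (rule nn_integral_cong)
    fix x :: real
    show "ennreal (x powr \<sigma> / (x\<^sup>2 + a\<^sup>2)) * indicator {0<..} x =
      (\<integral>\<^sup>+u. ennreal (x powr \<sigma> * exp (- (u * (x\<^sup>2 + a\<^sup>2)))) * indicator {0<..} x * indicator {0<..} u \<partial>lborel)"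
    proof (cases "x > 0")
      case True
      have pos: "x\<^sup>2 + a\<^sup>2 > 0" using True by (simp add: add_pos_nonneg)
      have "(\<integral>\<^sup>+u. ennreal (exp (- (u * (x\<^sup>2 + a\<^sup>2)))) * indicator {0<..} u \<partial>lborel) =
        (\<integral>\<^sup>+u. ennreal (u powr (1 * 1 - 1) * exp (- ((x\<^sup>2 + a\<^sup>2) * u powr 1))) * indicator {0<..} u \<partial>lborel)"
        by (intro nn_integral_cong) (auto simp: indicator_def mult.commute)
      also have "\<dots> = ennreal (1 / (x\<^sup>2 + a\<^sup>2))"
        using pos by (subst nn_integral_Gamma_powr) auto
      finally have 1: "(\<integral>\<^sup>+u. ennreal (exp (- (u * (x\<^sup>2 + a\<^sup>2)))) * indicator {0<..} u \<partial>lborel) = ennreal (1 / (x\<^sup>2 + a\<^sup>2))" .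
      have "(\<integral>\<^sup>+u. ennreal (x powr \<sigma> * exp (- (u * (x\<^sup>2 + a\<^sup>2)))) * indicator {0<..} x * indicator {0<..} u \<partial>lborel)
        = (\<integral>\<^sup>+u. ennreal (x powr \<sigma>) * (ennreal (exp (- (u * (x\<^sup>2 + a\<^sup>2)))) * indicator {0<..} u) \<partial>lborel)"
        using True by (intro nn_integral_cong) (auto simp: ennreal_mult mult_ac)
      also have "\<dots> = ennreal (x powr \<sigma>) * ennreal (1 / (x\<^sup>2 + a\<^sup>2))"
        by (subst nn_integral_cmult) (auto simp: 1)
      also have "\<dots> = ennreal (x powr \<sigma> / (x\<^sup>2 + a\<^sup>2)) * indicator {0<..} x"
        using True pos by (simp flip: ennreal_mult)
      finally show ?thesis ..
    qed auto
  qed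
  also have "\<dots> = (\<integral>\<^sup>+u. (\<integral>\<^sup>+x. ennreal (x powr \<sigma> * exp (- (u * (x\<^sup>2 + a\<^sup>2)))) * indicator {0<..} x * indicator {0<..} u \<partial>lborel) \<partial>lborel)"
    by (rule lborel_pair.Fubini'[symmetric]) measurable
  also have "\<dots> = (\<integral>\<^sup>+u. ennreal (Gamma ((1 + \<sigma>) / 2) / 2) * (ennreal (u powr (1 * ((1 - \<sigma>) / 2) - 1) * exp (- (a\<^sup>2 * u powr 1))) * indicator {0<..} u) \<partial>lborel)"
  proof (rule nn_integral_cong)
    fix u :: real
    show "(\<integral>\<^sup>+x. ennreal (x powr \<sigma> * exp (- (u * (x\<^sup>2 + a\<^sup>2)))) * indicator {0<..} x * indicator {0<..} u \<partial>lborel) =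
      ennreal (Gamma ((1 + \<sigma>) / 2) / 2) * (ennreal (u powr (1 * ((1 - \<sigma>) / 2) - 1) * exp (- (a\<^sup>2 * u powr 1))) * indicator {0<..} u)"
    proof (cases "u > 0")
      case True
      have half: "2 * ((1 + \<sigma>) / 2) - 1 = \<sigma>" by (simp add: field_simps)
      have "(\<integral>\<^sup>+x. ennreal (x powr \<sigma> * exp (- (u * (x\<^sup>2 + a\<^sup>2)))) * indicator {0<..} x * indicator {0<..} u \<partial>lborel) =
        (\<integral>\<^sup>+x. ennreal (exp (- (a\<^sup>2 * u))) * (ennreal (x powr (2 * ((1 + \<sigma>) / 2) - 1) * exp (- (u * x powr 2))) * indicator {0<..} x) \<partial>lborel)"
        unfolding half using True by (intro nn_integral_cong)
          (auto simp: indicator_def powr_numeral distrib_left exp_add exp_diff exp_minus divide_inverse mult_ac simp flip: ennreal_mult)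
      also have "\<dots> = ennreal (exp (- (a\<^sup>2 * u))) * ennreal (Gamma ((1 + \<sigma>) / 2) / (2 * u powr ((1 + \<sigma>) / 2)))"
        using True assms by (subst nn_integral_cmult, measurable) (subst nn_integral_Gamma_powr, auto)
      also have "\<dots> = ennreal (Gamma ((1 + \<sigma>) / 2) / 2) * (ennreal (u powr (1 * ((1 - \<sigma>) / 2) - 1) * exp (- (a\<^sup>2 * u powr 1))) * indicator {0<..} u)"
      proof -
        have "u powr (1 * ((1 - \<sigma>) / 2) - 1) = 1 / u powr ((1 + \<sigma>) / 2)"
        proof -
          have "1 * ((1 - \<sigma>) / 2) - 1 = - ((1 + \<sigma>) / 2)" by (simp add: field_simps)
          then show ?thesis by (simp only: powr_minus_divide)
        qed
        moreover have "Gamma ((1 + \<sigma>) / 2) > 0" using assms by (intro Gamma_real_pos) auto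
        ultimately show ?thesis using True by (simp add: mult_ac flip: ennreal_mult)
      qed
      finally show ?thesis .
    qed auto
  qed
  also have "\<dots> = ennreal (Gamma ((1 + \<sigma>) / 2) / 2) * ennreal (Gamma ((1 - \<sigma>) / 2) / (1 * a\<^sup>2 powr ((1 - \<sigma>) / 2)))"
    using assms by (subst nn_integral_cmult, measurable) (subst nn_integral_Gamma_powr, auto)
  also have "\<dots> = ennreal (Gamma ((1 + \<sigma>) / 2) * Gamma ((1 - \<sigma>) / 2) * a powr (\<sigma> - 1) / 2)"
  proof -
    have "a\<^sup>2 powr ((1 - \<sigma>) / 2) = a powr (1 - \<sigma>)"
    proof -
      have "a\<^sup>2 powr ((1 - \<sigma>) / 2) = a powr (2 * ((1 - \<sigma>) / 2))"
        using assms by (simp only: powr_powr powr_numeral[symmetric])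
      also have "2 * ((1 - \<sigma>) / 2) = 1 - \<sigma>" by (simp add: field_simps)
      finally show ?thesis .
    qed
    then have "a\<^sup>2 powr ((1 - \<sigma>) / 2) = inverse (a powr (\<sigma> - 1))" by (simp flip: powr_minus)
    then have "Gamma ((1 + \<sigma>) / 2) / 2 * (Gamma ((1 - \<sigma>) / 2) / (1 * a\<^sup>2 powr ((1 - \<sigma>) / 2))) =
        Gamma ((1 + \<sigma>) / 2) * Gamma ((1 - \<sigma>) / 2) * a powr (\<sigma> - 1) / 2"
      using assms by (simp add: field_simps)
    moreover have "Gamma ((1 + \<sigma>) / 2) > 0" "Gamma ((1 - \<sigma>) / 2) > 0"
      using assms by (auto intro!: Gamma_real_pos)
    ultimately show ?thesis by (subst ennreal_mult[symmetric]) auto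
  qed
  finally show ?thesis .
qed

section \<open>Remainders of the trapezoid rule\<close>

text \<open>u (1 - u)/2 is the Peano kernel of the trapezoid rule, and integrating by parts twice
  leaves the quadrature error. Continuity is asked only of u (1 - u) f1, because for a power of u
  the derivative f1 may blow up at 0.\<close>

lemma nn_integral_trapezoid:
  fixes G f f1 f2 :: "real \<Rightarrow> real"
  assumes cont: "continuous_on {0..1} f" "continuous_on {0..1} G" "continuous_on {0..1} (\<lambda>u. u * (1 - u) * f1 u)"
    and deriv: "\<And>u. u \<in> {0<..<1} \<Longrightarrow> (G has_real_derivative f u) (at u)"
      "\<And>u. u \<in> {0<..<1} \<Longrightarrow> (f has_real_derivative f1 u) (at u)"
      "\<And>u. u \<in> {0<..<1} \<Longrightarrow> (f1 has_real_derivative f2 u) (at u)"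
    and nonneg: "\<And>u. u \<in> {0..1} \<Longrightarrow> f2 u \<ge> 0"
  shows "(\<integral>\<^sup>+u. ennreal (u * (1 - u) / 2 * f2 u) * indicator {0..1} u \<partial>lborel) =
    ennreal ((f 0 + f 1) / 2 - (G 1 - G 0))" (is ?integral)
    and "(f 0 + f 1) / 2 - (G 1 - G 0) \<ge> 0" (is ?nonneg)
proof -
  \<comment> \<open>The antiderivative obtained from the two integrations by parts; its first term
    vanishes at both ends.\<close>
  define W where "W = (\<lambda>u. u * (1 - u) * f1 u / 2 - (1 - 2 * u) / 2 * f u - G u)"
  have "((\<lambda>u. u * (1 - u) / 2 * f2 u) has_integral (W 1 - W 0)) {0..1}"
  proof (rule fundamental_theorem_of_calculus_interior)
    show "continuous_on {0..1} W" unfolding W_def by (intro continuous_intros cont) auto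
    fix u :: real assume u: "u \<in> {0<..<1}"
    have "(W has_real_derivative u * (1 - u) / 2 * f2 u) (at u)"
      unfolding W_def by (auto intro!: derivative_eq_intros deriv[OF u]) (simp add: field_simps)
    then show "(W has_vector_derivative u * (1 - u) / 2 * f2 u) (at u)"
      by (simp add: has_real_derivative_iff_has_vector_derivative)
  qed auto
  also have "W 1 - W 0 = (f 0 + f 1) / 2 - (G 1 - G 0)" by (simp add: W_def field_simps)
  finally have I: "((\<lambda>u. u * (1 - u) / 2 * f2 u) has_integral (f 0 + f 1) / 2 - (G 1 - G 0)) {0..1}" .
  from nn_integral_has_integral_lebesgue'[OF _ I] show ?integral using nonneg by auto
  from has_integral_nonneg[OF I] show ?nonneg using nonneg by auto
qed

text \<open>
  The functional equation is proved for real \<open>-1 < \<sigma> < 0\<close> and then continued. There \<open>\<zeta>(\<sigma>)\<close> is the sum of the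
  trapezoid errors of \<open>u\<^bsup>-\<sigma>\<^esup>\<close>, and \<open>\<Gamma>(\<sigma>)\<close> times the \<open>n\<close>-th error is the integral of \<open>x\<^bsup>\<sigma>-1\<^esup>\<close> against the
  trapezoid error of \<open>exp (-u x)\<close>. These kernels add up to \<open>coth (x/2)/2 - 1/x\<close>, whose partial fractions
  give \<open>\<zeta>(1 - \<sigma>)\<close>. All terms are nonnegative, so every interchange is Tonelli's theorem.
\<close>
definition trapezoid_error :: "real \<Rightarrow> nat \<Rightarrow> real" where
  "trapezoid_error \<sigma> n = (real n powr (- \<sigma>) + real (Suc n) powr (- \<sigma>)) / 2 -
     (real (Suc n) powr (1 - \<sigma>) - real n powr (1 - \<sigma>)) / (1 - \<sigma>)"

definition trapezoid_kernel :: "nat \<Rightarrow> real \<Rightarrow> real" where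
  "trapezoid_kernel n x = (exp (- (real n * x)) + exp (- (real (Suc n) * x))) / 2 -
     (exp (- (real n * x)) - exp (- (real (Suc n) * x))) / x"

lemma trapezoid_error_integral:
  fixes \<sigma> :: real
  assumes \<sigma>: "-1 < \<sigma>" "\<sigma> < 0"
  shows "(\<integral>\<^sup>+u. ennreal (u * (1 - u) / 2 * (real n + u) powr (- \<sigma> - 2)) * indicator {0..1} u \<partial>lborel) =
    ennreal (trapezoid_error \<sigma> n / (\<sigma> * (\<sigma> + 1)))"
    and "trapezoid_error \<sigma> n / (\<sigma> * (\<sigma> + 1)) \<ge> 0"
proof -
  \<comment> \<open>Dividing u^(-\<sigma>) by c normalizes its second derivative to u^(-\<sigma>-2).
    Here c < 0, so it is the quotient of the error by c that is nonnegative.\<close>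
  define c where "c = \<sigma> * (\<sigma> + 1)"
  have c: "c \<noteq> 0" using \<sigma> by (simp add: c_def)
  define f where "f = (\<lambda>u. (real n + u) powr (- \<sigma>) / c)"
  define G where "G = (\<lambda>u. (real n + u) powr (1 - \<sigma>) / ((1 - \<sigma>) * c))"
  define f1 where "f1 = (\<lambda>u. (- \<sigma> / c) * (real n + u) powr (- \<sigma> - 1))"
  have pos: "real n + u > 0" if "u \<in> {0<..<1}" for u using that by auto
  have I: "(\<integral>\<^sup>+u. ennreal (u * (1 - u) / 2 * (real n + u) powr (- \<sigma> - 2)) * indicator {0..1} u \<partial>lborel) =
    ennreal ((f 0 + f 1) / 2 - (G 1 - G 0))" "(f 0 + f 1) / 2 - (G 1 - G 0) \<ge> 0"
  proof -
    have cf: "continuous_on {0..1} f" and cG: "continuous_on {0..1} G" unfolding f_def G_def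
      using \<sigma> c by (auto intro!: continuous_on_divide continuous_on_powr' continuous_on_add continuous_on_const continuous_on_id)
    have cf1: "continuous_on {0..1} (\<lambda>u. u * (1 - u) * f1 u)"
    \<comment> \<open>Only for n = 0 is f1 singular at the left end; there the factor u turns
      u^(-\<sigma>-1) back into the continuous u^(-\<sigma>).\<close>
    proof (cases "n = 0")
      case True
      have "continuous_on {0..1} (\<lambda>u. (1 - u) * (- \<sigma>) * f u)" by (intro continuous_intros cf)
      then show ?thesis
      proof (rule continuous_on_eq)
        fix u :: real assume "u \<in> {0..1}"
        then have "u * u powr (- \<sigma> - 1) = u powr (-\<sigma>)"
          by (cases "u = 0") (auto simp: powr_mult_base)
        then show "(1 - u) * (- \<sigma>) * f u = u * (1 - u) * f1 u"
          by (simp add: f_def f1_def True)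
      qed
    next
      case False
      then show ?thesis unfolding f1_def
        by (intro continuous_on_mult continuous_on_powr' continuous_on_add continuous_on_diff
             continuous_on_const continuous_on_id) auto
    qed
    have d: "((\<lambda>u. (real n + u) powr r) has_real_derivative r * (real n + u) powr (r - 1)) (at u)"
      if "u \<in> {0<..<1}" for r u
      using pos[OF that] by (auto intro!: derivative_eq_intros)
    have e: "- \<sigma> - 1 - 1 = - \<sigma> - 2" "1 - \<sigma> - 1 = - \<sigma>" by auto
    have dG: "(G has_real_derivative f u) (at u)" and df: "(f has_real_derivative f1 u) (at u)"
      if "u \<in> {0<..<1}" for u
      using DERIV_cdivide[OF d[OF that, of "1 - \<sigma>"], of "(1 - \<sigma>) * c"] DERIV_cdivide[OF d[OF that, of "- \<sigma>"], of c] c \<sigma>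
      unfolding f_def f1_def G_def e by auto
    have "(- \<sigma> / c) * (- \<sigma> - 1) = 1" using c \<sigma> by (simp add: divide_eq_eq) (simp add: c_def algebra_simps)
    then have df1: "(f1 has_real_derivative (real n + u) powr (- \<sigma> - 2)) (at u)" if "u \<in> {0<..<1}" for u
      using DERIV_cmult[OF d[OF that, of "- \<sigma> - 1"], of "- \<sigma> / c"]
      unfolding f1_def e mult.assoc[symmetric] by simp
    show "(\<integral>\<^sup>+u. ennreal (u * (1 - u) / 2 * (real n + u) powr (- \<sigma> - 2)) * indicator {0..1} u \<partial>lborel) =
      ennreal ((f 0 + f 1) / 2 - (G 1 - G 0))" "(f 0 + f 1) / 2 - (G 1 - G 0) \<ge> 0"
      by (rule nn_integral_trapezoid[OF cf cG cf1 dG df df1]; simp)+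
  qed
  moreover have "(f 0 + f 1) / 2 - (G 1 - G 0) = trapezoid_error \<sigma> n / c"
    using c \<sigma> by (simp add: f_def G_def trapezoid_error_def diff_divide_distrib add_divide_distrib add.commute)
  ultimately show "(\<integral>\<^sup>+u. ennreal (u * (1 - u) / 2 * (real n + u) powr (- \<sigma> - 2)) * indicator {0..1} u \<partial>lborel) =
      ennreal (trapezoid_error \<sigma> n / (\<sigma> * (\<sigma> + 1)))" "trapezoid_error \<sigma> n / (\<sigma> * (\<sigma> + 1)) \<ge> 0"
    by (simp_all add: c_def)
qed

lemma trapezoid_kernel_integral:
  assumes x: "x > 0"
  shows "(\<integral>\<^sup>+u. ennreal (u * (1 - u) / 2 * (x\<^sup>2 * exp (- ((real n + u) * x)))) * indicator {0..1} u \<partial>lborel) =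
    ennreal (trapezoid_kernel n x)"
    and "trapezoid_kernel n x \<ge> 0"
proof -
  define e where "e = (\<lambda>u. exp (- ((real n + u) * x)))"
  have de: "(e has_real_derivative - x * e u) (at u)" for u
    unfolding e_def by (auto intro!: derivative_eq_intros)
  have ce: "continuous_on {0..1} e" unfolding e_def by (intro continuous_intros)
  have "(\<integral>\<^sup>+u. ennreal (u * (1 - u) / 2 * (x\<^sup>2 * e u)) * indicator {0..1} u \<partial>lborel) =
     ennreal ((e 0 + e 1) / 2 - (- e 1 / x - - e 0 / x))" "(e 0 + e 1) / 2 - (- e 1 / x - - e 0 / x) \<ge> 0"
    by (rule nn_integral_trapezoid[where ?f1.0 = "\<lambda>u. - x * e u" and ?f2.0 = "\<lambda>u. x\<^sup>2 * e u"];
       use x in \<open>auto intro!: continuous_intros ce derivative_eq_intros de simp: power2_eq_square e_def\<close>)+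
  moreover have "(e 0 + e 1) / 2 - (- e 1 / x - - e 0 / x) = trapezoid_kernel n x"
    by (simp add: e_def trapezoid_kernel_def algebra_simps diff_divide_distrib)
  ultimately show "(\<integral>\<^sup>+u. ennreal (u * (1 - u) / 2 * (x\<^sup>2 * exp (- ((real n + u) * x)))) * indicator {0..1} u \<partial>lborel) =
    ennreal (trapezoid_kernel n x)" "trapezoid_kernel n x \<ge> 0" by (simp_all only: e_def)
qed

section \<open>Two expansions of coth(x/2)/2 - 1/x\<close>

text \<open>The n-th kernel is exp(-nx) times the zeroth one, so the sum is geometric.\<close>

lemma trapezoid_kernel_sums:
  assumes "x > 0"
  shows "(\<lambda>n. trapezoid_kernel n x) sums (1/2 + 1 / (exp x - 1) - 1 / x)"
proof -
  define q where "q = exp (- x)"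
  have q: "0 < q" "q < 1" using assms by (auto simp: q_def)
  have qn: "q ^ n = exp (- (real n * x))" for n
    using exp_of_nat_mult[of n "- x"] by (simp add: q_def)
  have "trapezoid_kernel n x = q ^ n * ((1 + q) / 2 - (1 - q) / x)" for n
    unfolding trapezoid_kernel_def qn[symmetric] power_Suc
    by (simp add: algebra_simps add_divide_distrib diff_divide_distrib)
  moreover have "(\<lambda>n. q ^ n * ((1 + q) / 2 - (1 - q) / x)) sums (1 / (1 - q) * ((1 + q) / 2 - (1 - q) / x))"
    using q by (intro sums_mult2 geometric_sums) auto
  moreover have "1 / (1 - q) * ((1 + q) / 2 - (1 - q) / x) = 1/2 + q / (1 - q) - 1 / x"
    using q assms by (simp add: field_simps)
  moreover have "q / (1 - q) = 1 / (exp x - 1)" using assms by (simp add: q_def exp_minus field_simps)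
  ultimately show ?thesis by simp
qed

text \<open>Logarithmic differentiation of the reflection formula for Gamma expresses cot(\<pi> z)
  through a difference of digamma values, and the limit formula for digamma turns that difference
  into a series. At purely imaginary z it is the expansion of coth.\<close>

lemma coth_partial_fractions:
  fixes x :: real
  assumes x: "x > 0"
  shows "(\<lambda>k. 2 * x / (x\<^sup>2 + (2 * pi * real (Suc k))\<^sup>2)) sums (1/2 + 1 / (exp x - 1) - 1 / x)"
proof -
  define y where "y = x / (2 * pi)"
  have y: "y > 0" using x by (simp add: y_def)
  \<comment> \<open>With x = 2 \<pi> y one has \<pi> z = i x/2, so the cotangent becomes -i
    coth(x/2).\<close>
  define z where "z = \<i> * complex_of_real y"
  have zim: "Im (z + of_real r) \<noteq> 0" "Im (of_real r - z) \<noteq> 0" for r using y by (auto simp: z_def)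
  have nint: "w \<notin> \<int>" if "Im w \<noteq> 0" for w using that by (auto elim!: Ints_cases)
  have z0: "z \<noteq> 0" "1 - z \<noteq> 0" "z \<notin> \<int>" "1 - z \<notin> \<int>" using zim[of 0] zim(2)[of 1] nint by auto
  then have zG: "z \<notin> \<int>\<^sub>\<le>\<^sub>0" "1 - z \<notin> \<int>\<^sub>\<le>\<^sub>0" by auto
  have sin0: "sin (of_real pi * z) \<noteq> 0"
  proof
    assume "sin (of_real pi * z) = 0"
    then have "Im (of_real pi * z) = 0" by (auto simp: sin_eq_0)
    then show False using y by (simp add: z_def)
  qed
  have D1: "((\<lambda>w. Gamma w * Gamma (1 - w)) has_field_derivative
     Gamma z * Gamma (1 - z) * (Digamma z - Digamma (1 - z))) (at z)"
    using zG by (auto intro!: derivative_eq_intros simp: algebra_simps)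
  have D2: "((\<lambda>w. of_real pi / sin (of_real pi * w)) has_field_derivative
     - (of_real pi * (of_real pi * cos (of_real pi * z))) / (sin (of_real pi * z))\<^sup>2) (at z)"
    using sin0 by (auto intro!: derivative_eq_intros simp: power2_eq_square)
  have "Gamma z * Gamma (1 - z) * (Digamma z - Digamma (1 - z)) =
      - (of_real pi * (of_real pi * cos (of_real pi * z))) / (sin (of_real pi * z))\<^sup>2"
    using DERIV_unique[OF D1] D2 unfolding Gamma_reflection_complex by blast
  then have "(of_real pi / sin (of_real pi * z)) * (Digamma z - Digamma (1 - z)) =
     (of_real pi / sin (of_real pi * z)) * (- of_real pi * cot (of_real pi * z))"
    unfolding Gamma_reflection_complex by (simp add: cot_def power2_eq_square)
  then have psi: "Digamma z - Digamma (1 - z) = - of_real pi * cot (of_real pi * z)"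
    using sin0 by (subst (asm) mult_cancel_left) auto
  have psi1: "Digamma (1 + z) = Digamma z + 1 / z" using Digamma_plus1[OF z0(1)] by (simp add: add.commute)
  have z1: "1 + z \<noteq> 0" using y by (auto simp: z_def complex_eq_iff)
  \<comment> \<open>The divergent terms ln m cancel in the difference, leaving a convergent series
    of differences of reciprocals.\<close>
  have "(\<lambda>m. (of_real (ln (real m)) - (\<Sum>n<m. inverse (1 + z + of_nat n))) -
      (of_real (ln (real m)) - (\<Sum>n<m. inverse (1 - z + of_nat n)))) \<longlonglongrightarrow> Digamma (1 + z) - Digamma (1 - z)"
    by (intro tendsto_diff Digamma_LIMSEQ z1 z0)
  then have "(\<lambda>n. inverse (1 - z + of_nat n) - inverse (1 + z + of_nat n)) sums (Digamma (1 + z) - Digamma (1 - z))"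
    by (simp add: sums_def sum_subtractf)
  then have S: "(\<lambda>n. Im (inverse (1 - z + of_nat n) - inverse (1 + z + of_nat n)) / (2 * pi)) sums
     (Im (1 / z - of_real pi * cot (of_real pi * z)) / (2 * pi))"
  proof -
    assume *: "(\<lambda>n. inverse (1 - z + of_nat n) - inverse (1 + z + of_nat n)) sums (Digamma (1 + z) - Digamma (1 - z))"
    have "Digamma (1 + z) - Digamma (1 - z) = (Digamma z - Digamma (1 - z)) + 1 / z" unfolding psi1 by simp
    also have "\<dots> = 1 / z - of_real pi * cot (of_real pi * z)" unfolding psi by simp
    finally show ?thesis using * by (intro sums_divide sums_Im) simp
  qed
  have t: "Im (inverse (1 - z + of_nat n) - inverse (1 + z + of_nat n)) / (2 * pi) = 2 * x / (x\<^sup>2 + (2 * pi * real (Suc n))\<^sup>2)" for n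
  proof -
    define k where "k = 1 + real n"
    have pos: "k\<^sup>2 + y\<^sup>2 > 0" using y by (simp add: add_nonneg_pos)
    have "Im (inverse (1 - z + of_nat n) - inverse (1 + z + of_nat n)) = 2 * y / (k\<^sup>2 + y\<^sup>2)"
      by (simp add: z_def k_def add_divide_distrib)
    also have "\<dots> / (2 * pi) = 2 * x / (x\<^sup>2 + (2 * pi * k)\<^sup>2)"
    proof -
      have "x = 2 * pi * y" by (simp add: y_def)
      then have "x\<^sup>2 + (2 * pi * k)\<^sup>2 = 4 * pi\<^sup>2 * (k\<^sup>2 + y\<^sup>2)" "2 * x = 4 * pi * y"
        by (simp_all add: power_mult_distrib algebra_simps)
      moreover have "2 * y / Q / (2 * pi) = 4 * pi * y / (4 * pi\<^sup>2 * Q)" if "Q > 0" for Q :: real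
        using that by (simp add: field_simps power2_eq_square)
      ultimately show ?thesis using pos by metis
    qed
    finally show ?thesis by (simp add: k_def add.commute)
  qed
  have v: "Im (1 / z - of_real pi * cot (of_real pi * z)) / (2 * pi) = 1/2 + 1 / (exp x - 1) - 1 / x"
  proof -
    define E where "E = exp (x / 2)"
    have E: "E > 1" using x by (simp add: E_def)
    have piz: "of_real pi * z = \<i> * complex_of_real (x / 2)" by (simp add: z_def y_def)
    have "\<i> * (of_real pi * z) = - complex_of_real (x/2)" "- (\<i> * (of_real pi * z)) = complex_of_real (x/2)"
      unfolding piz by (simp_all flip: mult.assoc)
    then have ex: "exp (\<i> * (of_real pi * z)) = of_real (inverse E)" "exp (- (\<i> * (of_real pi * z))) = of_real E"
      by (simp_all only: E_def exp_minus exp_of_real of_real_minus[symmetric])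
    have "cot (of_real pi * z) = - \<i> * of_real ((E + inverse E) / (E - inverse E))"
    proof -
      have "E \<noteq> inverse E" using E inverse_less_1_iff[of E] by auto
      then have ne: "complex_of_real (E - inverse E) \<noteq> 0" unfolding of_real_eq_0_iff by simp
      have "cot (of_real pi * z) = ((of_real (inverse E) + of_real E) / 2) / ((of_real (inverse E) - of_real E) / (2 * \<i>))"
        unfolding cot_def sin_exp_eq cos_exp_eq ex by (rule refl)
      also have "\<dots> = - \<i> * (of_real (E + inverse E) / of_real (E - inverse E))"
      proof -
        have 1: "complex_of_real (inverse E) - of_real E = - of_real (E - inverse E)"
          "complex_of_real (inverse E) + of_real E = of_real (E + inverse E)" by simp_all
        have 2: "(P / 2) / (- Q / (2 * \<i>)) = - \<i> * (P / Q)" if "Q \<noteq> 0" for P Q :: complex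
          using that by (simp add: field_simps)
        show ?thesis unfolding 1 by (rule 2[OF ne])
      qed
      finally show ?thesis by simp
    qed
    moreover have "(E + inverse E) / (E - inverse E) = 1 + 2 / (E * E - 1)"
    proof -
      have "1 < E * E" using E by (simp add: less_1_mult)
      then show ?thesis using E by (simp add: field_simps)
    qed
    moreover have "E * E = exp x" by (simp add: E_def flip: exp_add)
    moreover have "Im (1 / z) = - 2 * pi / x" using x by (simp add: z_def y_def Im_divide power2_eq_square field_simps)
    ultimately have "Im (1 / z - of_real pi * cot (of_real pi * z)) = pi * (1 + 2 / (exp x - 1)) - 2 * pi / x"
      by simp
    then show ?thesis using x by (simp add: field_simps)
  qed
  show ?thesis using S unfolding t v .
qed

section \<open>The functional equation: real segment, then continuation\<close>

lemma zeta_rem_summable: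
  assumes "Re s > 1 - real m"
  shows "summable (\<lambda>n. zeta_rem m n s)"
  by (rule summable_comparison_test'[OF summable_mult[OF summable_Suc_powr[of "- Re s - real m"]]
        norm_zeta_rem_le])
     (use assms in auto)

text \<open>Combining the recurrence at s with the one at s + 1, the latter weighted by (1 - s)/2,
  cancels the second-order binomial terms. What is left of the remainders is a multiple of the
  trapezoid error of u^(-\<sigma>).\<close>

lemma zeta_trapezoid_sums:
  fixes \<sigma> :: real
  assumes \<sigma>: "-1 < \<sigma>" "\<sigma> < 0"
  shows "(\<lambda>n. complex_of_real (trapezoid_error \<sigma> n)) sums zeta (of_real \<sigma>)"
proof -
  define s where "s = complex_of_real \<sigma>"
  have s1: "s \<noteq> 1" "1 - s \<noteq> 0" using \<sigma> by (auto simp: s_def complex_eq_iff)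
  have R2: "(\<lambda>n. zeta_rem 2 n s) sums (\<Sum>n. zeta_rem 2 n s)"
    by (intro summable_sums zeta_rem_summable) (use \<sigma> in \<open>auto simp: s_def\<close>)
  have R1: "(\<lambda>n. zeta_rem 1 n (s + 1)) sums (\<Sum>n. zeta_rem 1 n (s + 1))"
    by (intro summable_sums zeta_rem_summable) (use \<sigma> in \<open>auto simp: s_def\<close>)
  have "entire_zeta s = 1 + (\<Sum>n. zeta_rem (Suc 1) n s) -
     (\<Sum>j<1. ((1 - s) gchoose Suc j) / of_nat (j + 2) * entire_zeta (s + of_nat (Suc j)))"
    by (rule entire_zeta_recurrence) (use \<sigma> in \<open>auto simp: s_def\<close>)
  also have "entire_zeta (s + 1) = 1 + (\<Sum>n. zeta_rem (Suc 0) n (s + 1)) -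
     (\<Sum>j<0. ((1 - (s + 1)) gchoose Suc j) / of_nat (j + 2) * entire_zeta (s + 1 + of_nat (Suc j)))"
    by (rule entire_zeta_recurrence) (use \<sigma> in \<open>auto simp: s_def\<close>)
  then have "(\<Sum>j<1. ((1 - s) gchoose Suc j) / of_nat (j + 2) * entire_zeta (s + of_nat (Suc j))) =
     (1 - s) / 2 * (1 + (\<Sum>n. zeta_rem 1 n (s + 1)))" by simp
  finally have E: "entire_zeta s = 1 + (\<Sum>n. zeta_rem 2 n s) - (1 - s) / 2 * (1 + (\<Sum>n. zeta_rem 1 n (s + 1)))"
    by (simp add: numeral_2_eq_2)
  have "(\<lambda>n. - (zeta_rem 2 n s - (1 - s) / 2 * zeta_rem 1 n (s + 1)) / (1 - s)) sums
      (- ((\<Sum>n. zeta_rem 2 n s) - (1 - s) / 2 * (\<Sum>n. zeta_rem 1 n (s + 1))) / (1 - s))"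
    by (intro sums_divide sums_minus sums_diff sums_mult R1 R2)
  also have "- ((\<Sum>n. zeta_rem 2 n s) - (1 - s) / 2 * (\<Sum>n. zeta_rem 1 n (s + 1))) / (1 - s) =
      - (entire_zeta s - 1 + (1 - s) / 2) / (1 - s)"
    unfolding E by (simp add: algebra_simps)
  also have "\<dots> = zeta s - (1/2 - 1 / (1 - s))"
    using s1 by (simp add: entire_zeta_eq field_simps)
  also have "(\<lambda>n. - (zeta_rem 2 n s - (1 - s) / 2 * zeta_rem 1 n (s + 1)) / (1 - s)) =
      (\<lambda>n. complex_of_real (trapezoid_error \<sigma> (Suc n)))"
  proof
    fix n
    define A B C where "A = real (Suc n)" and "B = real (Suc (Suc n))" and "C = 1 - \<sigma>"
    have pw: "of_nat (Suc n) powr complex_of_real r = of_real (A powr r)"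
      "of_nat (Suc (Suc n)) powr complex_of_real r = of_real (B powr r)" for r
      using powr_of_real[of "real (Suc n)" r] powr_of_real[of "real (Suc (Suc n))" r]
      by (simp_all add: A_def B_def)
    have g2: "(complex_of_real (1 - \<sigma>) gchoose 2) = of_real ((1 - \<sigma>) * (- \<sigma>) / 2)"
      by (simp add: numeral_2_eq_2 gbinomial_prod_rev)
    have e: "1 - s = of_real (1 - \<sigma>)" "complex_of_real (1 - \<sigma>) - of_nat 1 = of_real (- \<sigma>)"
      "complex_of_real (1 - \<sigma>) - of_nat 2 = of_real (- \<sigma> - 1)"
      "1 - (s + 1) = of_real (- \<sigma>)" "complex_of_real (- \<sigma>) - of_nat 1 = of_real (- \<sigma> - 1)"
      by (auto simp: s_def)
    have sum2: "(\<Sum>k\<le>2. f k) = f 0 + f 1 + f 2" "(\<Sum>k\<le>1. f k) = f 0 + f 1" for f :: "nat \<Rightarrow> complex"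
      by (simp_all add: numeral_2_eq_2)
    have z2: "zeta_rem 2 n s = of_real (B powr (1 - \<sigma>) - (A powr (1 - \<sigma>) + (1 - \<sigma>) * A powr (- \<sigma>) + (1 - \<sigma>) * (- \<sigma>) / 2 * A powr (- \<sigma> - 1)))"
      unfolding zeta_rem_def sum2 e g2 gbinomial_0 gbinomial_1 of_nat_0 diff_zero pw by simp
    have z1: "zeta_rem 1 n (s + 1) = of_real (B powr (- \<sigma>) - (A powr (- \<sigma>) + (- \<sigma>) * A powr (- \<sigma> - 1)))"
      unfolding zeta_rem_def sum2 e gbinomial_0 gbinomial_1 of_nat_0 diff_zero pw by simp
    have "- (zeta_rem 2 n s - (1 - s) / 2 * zeta_rem 1 n (s + 1)) / (1 - s) = 
       of_real (- ((B powr (1 - \<sigma>) - (A powr (1 - \<sigma>) + (1 - \<sigma>) * A powr (- \<sigma>) + (1 - \<sigma>) * (- \<sigma>) / 2 * A powr (- \<sigma> - 1)))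
          - (1 - \<sigma>) / 2 * (B powr (- \<sigma>) - (A powr (- \<sigma>) + (- \<sigma>) * A powr (- \<sigma> - 1)))) / (1 - \<sigma>))"
      unfolding z1 z2 e(1) by simp
    also have "- ((B powr (1 - \<sigma>) - (A powr (1 - \<sigma>) + (1 - \<sigma>) * A powr (- \<sigma>) + (1 - \<sigma>) * (- \<sigma>) / 2 * A powr (- \<sigma> - 1)))
          - (1 - \<sigma>) / 2 * (B powr (- \<sigma>) - (A powr (- \<sigma>) + (- \<sigma>) * A powr (- \<sigma> - 1)))) / (1 - \<sigma>) =
       trapezoid_error \<sigma> (Suc n)"
    proof -
      have "- ((b1 - (a1 + C * a0 + C * (- \<sigma>) / 2 * a2)) - C / 2 * (b0 - (a0 + (- \<sigma>) * a2))) / C = (a0 + b0) / 2 - (b1 - a1) / C"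
        for a0 a1 a2 b0 b1 using \<sigma> by (simp add: C_def field_simps)
      then show ?thesis unfolding trapezoid_error_def C_def A_def B_def by blast
    qed
    finally show "- (zeta_rem 2 n s - (1 - s) / 2 * zeta_rem 1 n (s + 1)) / (1 - s) =
      complex_of_real (trapezoid_error \<sigma> (Suc n))" .
  qed
  \<comment> \<open>The remainders begin at the interval [1, 2]; this is the error on [0, 1], where
    u^(-\<sigma>) vanishes at 0 because \<sigma> < 0.\<close>
  also have "1/2 - 1 / (1 - s) = complex_of_real (trapezoid_error \<sigma> 0)"
    using \<sigma> by (simp add: trapezoid_error_def s_def)
  finally show ?thesis by (subst (asm) sums_Suc_iff) (simp add: s_def)
qed

text \<open>By the reflection formula the product of the two Gamma values is \<pi> / cos(\<pi>
  \<sigma>/2), which gives Riemann's equation in its usual form.\<close>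

lemma zeta_functional_equation_real:
  fixes \<sigma> :: real
  assumes \<sigma>: "-1 < \<sigma>" "\<sigma> < 0"
  shows "Gamma (of_real \<sigma>) * zeta (of_real \<sigma>) =
    of_real (2 * pi) powr (of_real \<sigma> - 1) * (Gamma ((1 + of_real \<sigma>) / 2) * Gamma ((1 - of_real \<sigma>) / 2)) * zeta (1 - of_real \<sigma>)"
proof -
  define c where "c = \<sigma> * (\<sigma> + 1)"
  define GG where "GG = Gamma ((1 + \<sigma>) / 2) * Gamma ((1 - \<sigma>) / 2)"
  have GG: "GG > 0" unfolding GG_def using \<sigma> by (intro mult_pos_pos Gamma_real_pos) auto
  have G2: "Gamma (\<sigma> + 2) > 0" using \<sigma> by (intro Gamma_real_pos) auto
  \<comment> \<open>This is Gamma(\<sigma>) times the error, since Gamma(\<sigma> + 2) = c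
    Gamma(\<sigma>). The form is chosen for signs: Gamma(\<sigma>) and c are negative here,
    Gamma(\<sigma> + 2) is positive.\<close>
  define t where "t = (\<lambda>n. Gamma (\<sigma> + 2) * (trapezoid_error \<sigma> n / c))"
  have t0: "t n \<ge> 0" for n unfolding t_def c_def
    using trapezoid_error_integral(2)[OF \<sigma>, of n] G2 by (intro mult_nonneg_nonneg) auto
  have I1: "(\<integral>\<^sup>+x. ennreal (x powr (\<sigma> - 1) * trapezoid_kernel n x) * indicator {0<..} x \<partial>lborel) = ennreal (t n)" for n
  proof -
    have "(\<integral>\<^sup>+x. ennreal (x powr (\<sigma> - 1) * trapezoid_kernel n x) * indicator {0<..} x \<partial>lborel) =
      (\<integral>\<^sup>+x. (\<integral>\<^sup>+u. ennreal (x powr (\<sigma> - 1) * (u * (1 - u) / 2 * (x\<^sup>2 * exp (- ((real n + u) * x))))) *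
         indicator {0..1} u * indicator {0<..} x \<partial>lborel) \<partial>lborel)"
    proof (rule nn_integral_cong)
      fix x :: real
      show "ennreal (x powr (\<sigma> - 1) * trapezoid_kernel n x) * indicator {0<..} x =
        (\<integral>\<^sup>+u. ennreal (x powr (\<sigma> - 1) * (u * (1 - u) / 2 * (x\<^sup>2 * exp (- ((real n + u) * x))))) *
         indicator {0..1} u * indicator {0<..} x \<partial>lborel)"
      proof (cases "x > 0")
        case True
        have "(\<integral>\<^sup>+u. ennreal (x powr (\<sigma> - 1) * (u * (1 - u) / 2 * (x\<^sup>2 * exp (- ((real n + u) * x))))) *
            indicator {0..1} u * indicator {0<..} x \<partial>lborel) =
          (\<integral>\<^sup>+u. ennreal (x powr (\<sigma> - 1)) * (ennreal (u * (1 - u) / 2 * (x\<^sup>2 * exp (- ((real n + u) * x)))) *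
            indicator {0..1} u) \<partial>lborel)"
        proof (rule nn_integral_cong)
          fix u :: real
          show "ennreal (x powr (\<sigma> - 1) * (u * (1 - u) / 2 * (x\<^sup>2 * exp (- ((real n + u) * x))))) *
              indicator {0..1} u * indicator {0<..} x =
            ennreal (x powr (\<sigma> - 1)) * (ennreal (u * (1 - u) / 2 * (x\<^sup>2 * exp (- ((real n + u) * x)))) * indicator {0..1} u)"
          proof (cases "u \<in> {0..1}")
            case u: True
            then have "u * (1 - u) / 2 * (x\<^sup>2 * exp (- ((real n + u) * x))) \<ge> 0" by auto
            then show ?thesis using u True by (subst ennreal_mult) auto
          qed auto
        qed
        also have "\<dots> = ennreal (x powr (\<sigma> - 1)) * ennreal (trapezoid_kernel n x)"
          by (subst nn_integral_cmult, measurable) (simp only: trapezoid_kernel_integral(1)[OF True])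
        also have "\<dots> = ennreal (x powr (\<sigma> - 1) * trapezoid_kernel n x) * indicator {0<..} x"
          using True trapezoid_kernel_integral(2)[OF True] by (simp add: ennreal_mult)
        finally show ?thesis ..
      qed auto
    qed
    also have "\<dots> = (\<integral>\<^sup>+u. (\<integral>\<^sup>+x. ennreal (x powr (\<sigma> - 1) * (u * (1 - u) / 2 * (x\<^sup>2 * exp (- ((real n + u) * x))))) *
         indicator {0..1} u * indicator {0<..} x \<partial>lborel) \<partial>lborel)"
      by (rule lborel_pair.Fubini'[symmetric]) measurable
    also have "\<dots> = (\<integral>\<^sup>+u. ennreal (Gamma (\<sigma> + 2)) * (ennreal (u * (1 - u) / 2 * (real n + u) powr (- \<sigma> - 2)) * indicator {0..1} u) \<partial>lborel)"
    proof (rule nn_integral_cong)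
      fix u :: real
      show "(\<integral>\<^sup>+x. ennreal (x powr (\<sigma> - 1) * (u * (1 - u) / 2 * (x\<^sup>2 * exp (- ((real n + u) * x))))) *
         indicator {0..1} u * indicator {0<..} x \<partial>lborel) =
         ennreal (Gamma (\<sigma> + 2)) * (ennreal (u * (1 - u) / 2 * (real n + u) powr (- \<sigma> - 2)) * indicator {0..1} u)"
      proof (cases "0 < u \<and> u \<le> 1")
        case True
        then have nu: "real n + u > 0" by auto
        have "(\<integral>\<^sup>+x. ennreal (x powr (\<sigma> - 1) * (u * (1 - u) / 2 * (x\<^sup>2 * exp (- ((real n + u) * x))))) *
           indicator {0..1} u * indicator {0<..} x \<partial>lborel) =
          (\<integral>\<^sup>+x. ennreal (u * (1 - u) / 2) * (ennreal (x powr (1 * (\<sigma> + 2) - 1) * exp (- ((real n + u) * x powr 1))) * indicator {0<..} x) \<partial>lborel)"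
        proof (rule nn_integral_cong)
          fix x :: real
          show "ennreal (x powr (\<sigma> - 1) * (u * (1 - u) / 2 * (x\<^sup>2 * exp (- ((real n + u) * x))))) *
             indicator {0..1} u * indicator {0<..} x =
             ennreal (u * (1 - u) / 2) * (ennreal (x powr (1 * (\<sigma> + 2) - 1) * exp (- ((real n + u) * x powr 1))) * indicator {0<..} x)"
          proof (cases "x > 0")
            case x: True
            have "x powr (1 * (\<sigma> + 2) - 1) = x powr ((\<sigma> - 1) + 2)" by (simp add: algebra_simps)
            also have "\<dots> = x powr (\<sigma> - 1) * x\<^sup>2" unfolding powr_add using x by (simp add: powr_numeral)
            finally have "x powr (\<sigma> - 1) * (u * (1 - u) / 2 * (x\<^sup>2 * exp (- ((real n + u) * x)))) =
               u * (1 - u) / 2 * (x powr (1 * (\<sigma> + 2) - 1) * exp (- ((real n + u) * x powr 1)))"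
              using x by simp
            then show ?thesis using True x by (simp only:) (subst ennreal_mult, auto)
          qed auto
        qed
        also have "\<dots> = ennreal (u * (1 - u) / 2) * ennreal (Gamma (\<sigma> + 2) / (1 * (real n + u) powr (\<sigma> + 2)))"
          using nu \<sigma> by (subst nn_integral_cmult, measurable) (subst nn_integral_Gamma_powr, auto)
        also have "\<dots> = ennreal (Gamma (\<sigma> + 2)) * (ennreal (u * (1 - u) / 2 * (real n + u) powr (- \<sigma> - 2)) * indicator {0..1} u)"
        proof -
          have "(real n + u) powr (- \<sigma> - 2) = inverse ((real n + u) powr (\<sigma> + 2))"
            by (simp flip: powr_minus)
          moreover have "a * (G / (1 * P)) = G * (a * inverse P)" for a G P :: real
            by (simp add: divide_inverse mult_ac)
          ultimately have "u * (1 - u) / 2 * (Gamma (\<sigma> + 2) / (1 * (real n + u) powr (\<sigma> + 2))) =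
             Gamma (\<sigma> + 2) * (u * (1 - u) / 2 * (real n + u) powr (- \<sigma> - 2))" by (simp only:)
          moreover have "ennreal (u * (1 - u) / 2) * ennreal (Gamma (\<sigma> + 2) / (1 * (real n + u) powr (\<sigma> + 2))) =
              ennreal (u * (1 - u) / 2 * (Gamma (\<sigma> + 2) / (1 * (real n + u) powr (\<sigma> + 2))))"
            using True G2 by (intro ennreal_mult[symmetric]) auto
          moreover have "ennreal (Gamma (\<sigma> + 2)) * ennreal (u * (1 - u) / 2 * (real n + u) powr (- \<sigma> - 2)) =
              ennreal (Gamma (\<sigma> + 2) * (u * (1 - u) / 2 * (real n + u) powr (- \<sigma> - 2)))"
            using True G2 by (intro ennreal_mult[symmetric] mult_nonneg_nonneg) auto
          moreover have "indicator {0..1} u = (1 :: ennreal)" using True by simp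
          ultimately show ?thesis by (simp only: mult_1_right)
        qed
        finally show ?thesis .
      qed (auto simp: indicator_def)
    qed
    also have "\<dots> = ennreal (Gamma (\<sigma> + 2)) * ennreal (trapezoid_error \<sigma> n / c)"
      by (subst nn_integral_cmult, measurable) (simp only: trapezoid_error_integral(1)[OF \<sigma>] c_def)
    also have "\<dots> = ennreal (t n)"
      unfolding t_def c_def
      by (intro ennreal_mult[symmetric] trapezoid_error_integral(2)[OF \<sigma>]) (use G2 in auto)
    finally show ?thesis .
  qed
  define Hx where "Hx = (\<lambda>x. 1/2 + 1 / (exp x - 1) - 1 / x :: real)"
  define w where "w = (\<lambda>k. GG * (2 * pi * real (Suc k)) powr (\<sigma> - 1))"
  have w0: "w k \<ge> 0" for k unfolding w_def using GG by simp
  have I2: "(\<integral>\<^sup>+x. ennreal (x powr (\<sigma> - 1) * (2 * x / (x\<^sup>2 + (2 * pi * real (Suc k))\<^sup>2))) * indicator {0<..} x \<partial>lborel) = ennreal (w k)" for k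
  proof -
    define a where "a = 2 * pi * real (Suc k)"
    have a: "a > 0" by (simp add: a_def)
    have "(\<integral>\<^sup>+x. ennreal (x powr (\<sigma> - 1) * (2 * x / (x\<^sup>2 + a\<^sup>2))) * indicator {0<..} x \<partial>lborel) =
       (\<integral>\<^sup>+x. ennreal 2 * (ennreal (x powr \<sigma> / (x\<^sup>2 + a\<^sup>2)) * indicator {0<..} x) \<partial>lborel)"
    proof (rule nn_integral_cong)
      fix x :: real
      show "ennreal (x powr (\<sigma> - 1) * (2 * x / (x\<^sup>2 + a\<^sup>2))) * indicator {0<..} x =
        ennreal 2 * (ennreal (x powr \<sigma> / (x\<^sup>2 + a\<^sup>2)) * indicator {0<..} x)"
      proof (cases "x > 0")
        case True
        have "x powr \<sigma> = x * x powr (\<sigma> - 1)" using True by (simp add: powr_mult_base)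
        then have "x powr (\<sigma> - 1) * (2 * x / (x\<^sup>2 + a\<^sup>2)) = 2 * (x powr \<sigma> / (x\<^sup>2 + a\<^sup>2))" by simp
        then show ?thesis using True by (simp only:) (subst ennreal_mult, auto)
      qed auto
    qed
    also have "\<dots> = ennreal 2 * ennreal (GG * a powr (\<sigma> - 1) / 2)"
      using \<sigma> a by (subst nn_integral_cmult, measurable) (subst nn_integral_powr_over_square, auto simp: GG_def)
    also have "\<dots> = ennreal (w k)"
      using GG by (subst ennreal_mult[symmetric]) (auto simp: w_def a_def)
    finally show ?thesis by (simp add: a_def)
  qed
  have "(\<Sum>n. ennreal (t n)) = (\<integral>\<^sup>+x. (\<Sum>n. ennreal (x powr (\<sigma> - 1) * trapezoid_kernel n x) * indicator {0<..} x) \<partial>lborel)"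
    unfolding I1[symmetric]
    by (rule nn_integral_suminf[symmetric]) (simp add: trapezoid_kernel_def)
  also have "\<dots> = (\<integral>\<^sup>+x. ennreal (x powr (\<sigma> - 1) * Hx x) * indicator {0<..} x \<partial>lborel)"
  proof (rule nn_integral_cong)
    fix x :: real
    show "(\<Sum>n. ennreal (x powr (\<sigma> - 1) * trapezoid_kernel n x) * indicator {0<..} x) =
      ennreal (x powr (\<sigma> - 1) * Hx x) * indicator {0<..} x"
    proof (cases "x > 0")
      case True
      have "(\<Sum>n. ennreal (x powr (\<sigma> - 1) * trapezoid_kernel n x)) = ennreal (x powr (\<sigma> - 1) * Hx x)"
        unfolding Hx_def
        by (intro suminf_ennreal_eq sums_mult trapezoid_kernel_sums True mult_nonneg_nonneg
              trapezoid_kernel_integral(2)) auto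
      then show ?thesis using True by simp
    qed auto
  qed
  also have "\<dots> = (\<integral>\<^sup>+x. (\<Sum>k. ennreal (x powr (\<sigma> - 1) * (2 * x / (x\<^sup>2 + (2 * pi * real (Suc k))\<^sup>2))) * indicator {0<..} x) \<partial>lborel)"
  proof (rule nn_integral_cong)
    fix x :: real
    show "ennreal (x powr (\<sigma> - 1) * Hx x) * indicator {0<..} x =
      (\<Sum>k. ennreal (x powr (\<sigma> - 1) * (2 * x / (x\<^sup>2 + (2 * pi * real (Suc k))\<^sup>2))) * indicator {0<..} x)"
    proof (cases "x > 0")
      case True
      have "(\<Sum>k. ennreal (x powr (\<sigma> - 1) * (2 * x / (x\<^sup>2 + (2 * pi * real (Suc k))\<^sup>2)))) = ennreal (x powr (\<sigma> - 1) * Hx x)"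
        unfolding Hx_def
        by (intro suminf_ennreal_eq sums_mult coth_partial_fractions True mult_nonneg_nonneg divide_nonneg_nonneg)
           (use True in auto)
      then show ?thesis using True by (simp del: of_nat_Suc)
    qed auto
  qed
  also have "\<dots> = (\<Sum>k. ennreal (w k))"
    unfolding I2[symmetric] by (rule nn_integral_suminf) simp
  finally have sums_eq: "(\<Sum>n. ennreal (t n)) = (\<Sum>k. ennreal (w k))" .
  have tz: "(\<lambda>n. complex_of_real (t n)) sums (of_real (Gamma (\<sigma> + 2) / c) * zeta (of_real \<sigma>))"
    using sums_mult[OF zeta_trapezoid_sums[OF \<sigma>], of "of_real (Gamma (\<sigma> + 2) / c)"]
    by (simp add: t_def mult_ac)
  have wz: "(\<lambda>n. complex_of_real (w n)) sums (of_real (2 * pi) powr (of_real \<sigma> - 1) * of_real GG * zeta (1 - of_real \<sigma>))"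
  proof -
    have "(\<lambda>n. of_nat (Suc n) powr (- (1 - of_real \<sigma>))) sums zeta (1 - of_real \<sigma>)"
    proof -
      have "Re (1 - of_real \<sigma>) > 1" using \<sigma> by simp
      then show ?thesis using is_zeta_zeta unfolding is_zeta_def by blast
    qed
    from sums_mult[OF this, of "complex_of_real (2 * pi) powr (of_real \<sigma> - 1) * of_real GG"]
    have "(\<lambda>n. of_real (2 * pi) powr (of_real \<sigma> - 1) * of_real GG * of_nat (Suc n) powr (- (1 - of_real \<sigma>)))
       sums (of_real (2 * pi) powr (of_real \<sigma> - 1) * of_real GG * zeta (1 - of_real \<sigma>))" .
    moreover have "of_real (2 * pi) powr (of_real \<sigma> - 1) * of_real GG * of_nat (Suc n) powr (- (1 - of_real \<sigma>)) = complex_of_real (w n)" for n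
    proof -
      have 1: "complex_of_real (2 * pi) powr (of_real \<sigma> - 1) = of_real ((2 * pi) powr (\<sigma> - 1))"
        using powr_of_real[of "2 * pi" "\<sigma> - 1"] by simp
      have 2: "complex_of_nat (Suc n) powr (- (1 - of_real \<sigma>)) = of_real (real (Suc n) powr (\<sigma> - 1))"
        using powr_of_real[of "real (Suc n)" "\<sigma> - 1"] by simp
      show ?thesis unfolding 1 2 w_def by (simp add: powr_mult del: of_nat_Suc)
    qed
    ultimately show ?thesis by simp
  qed
  \<comment> \<open>Convergence is read off from the two series for \<zeta>; with nonnegative terms,
    the equality of extended sums then becomes one of real sums.\<close>
  have st: "summable t" and sw: "summable w"
    using tz wz by (auto simp: sums_iff summable_of_real_iff)
  have "ennreal (suminf t) = ennreal (suminf w)"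
    using sums_eq suminf_ennreal2[OF t0 st] suminf_ennreal2[OF w0 sw] by simp
  then have "suminf t = suminf w"
    using suminf_nonneg[OF st t0] suminf_nonneg[OF sw w0] by simp
  moreover have "of_real (suminf t) = of_real (Gamma (\<sigma> + 2) / c) * zeta (of_real \<sigma>)"
    using tz st sums_unique2 sums_of_real summable_sums by blast
  moreover have "of_real (suminf w) = of_real (2 * pi) powr (of_real \<sigma> - 1) * of_real GG * zeta (1 - of_real \<sigma>)"
    using wz sw sums_unique2 sums_of_real summable_sums by blast
  moreover have "complex_of_real (Gamma (\<sigma> + 2) / c) = Gamma (of_real \<sigma>)"
  proof -
    have "\<sigma> \<notin> \<int>\<^sub>\<le>\<^sub>0" "\<sigma> + 1 \<notin> \<int>\<^sub>\<le>\<^sub>0" using \<sigma> by (auto elim!: nonpos_Ints_cases)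
    then have "Gamma (\<sigma> + 2) = (\<sigma> + 1) * (\<sigma> * Gamma \<sigma>)"
      using Gamma_plus1[of "\<sigma> + 1"] Gamma_plus1[of \<sigma>] by (simp add: add.assoc)
    moreover have "c \<noteq> 0" using \<sigma> by (simp add: c_def)
    ultimately have "Gamma (\<sigma> + 2) / c = Gamma \<sigma>" by (simp add: c_def field_simps)
    then show ?thesis by (simp add: Gamma_complex_of_real)
  qed
  moreover have "complex_of_real GG = Gamma ((1 + of_real \<sigma>) / 2) * Gamma ((1 - of_real \<sigma>) / 2)"
    using Gamma_complex_of_real[of "(1 + \<sigma>) / 2"] Gamma_complex_of_real[of "(1 - \<sigma>) / 2"] by (simp add: GG_def)
  ultimately show ?thesis by metis
qed

text \<open>Continuation over the union of the upper half-plane with the strip -1 < Re s < 0. This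
  set is open and connected, contains the real segment where the equation is known, and avoids all
  poles of both sides.\<close>

lemma zeta_functional_equation:
  assumes "Im s > 0"
  shows "Gamma s * zeta s =
    of_real (2 * pi) powr (s - 1) * (Gamma ((1 + s) / 2) * Gamma ((1 - s) / 2)) * zeta (1 - s)"
proof -
  define f where "f = (\<lambda>s. Gamma s * zeta s - 
    of_real (2 * pi) powr (s - 1) * (Gamma ((1 + s) / 2) * Gamma ((1 - s) / 2)) * zeta (1 - s))"
  define S where "S = {s. Im s > 0} \<union> ({s. Re s > -1} \<inter> {s. Re s < 0})"
  define U where "U = complex_of_real ` {-1<..<0}"
  have S: "open S" "connected S" unfolding S_def
  proof -
    show "open ({s. Im s > 0} \<union> ({s. Re s > -1} \<inter> {s. Re s < 0}))"
      by (intro open_Un open_Int open_halfspace_Im_gt open_halfspace_Re_gt open_halfspace_Re_lt)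
    have "Complex (-1/2) 1 \<in> {s. Im s > 0} \<inter> ({s. Re s > -1} \<inter> {s. Re s < 0})" by simp
    then show "connected ({s. Im s > 0} \<union> ({s. Re s > -1} \<inter> {s. Re s < 0}))"
      by (intro connected_Un convex_connected convex_Int convex_halfspace_Im_gt convex_halfspace_Re_gt
            convex_halfspace_Re_lt) blast
  qed
  have nint: "s \<notin> \<int>\<^sub>\<le>\<^sub>0" "(1 + s) / 2 \<notin> \<int>\<^sub>\<le>\<^sub>0" "(1 - s) / 2 \<notin> \<int>\<^sub>\<le>\<^sub>0" "s \<noteq> 1" "1 - s \<noteq> 1" if "s \<in> S" for s
  proof -
    have *: "w \<notin> \<int>\<^sub>\<le>\<^sub>0" if "Im w \<noteq> 0 \<or> Re w > -1 \<and> Re w \<noteq> 0" for w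
    proof
      assume "w \<in> \<int>\<^sub>\<le>\<^sub>0"
      then obtain n where "w = of_int n" "n \<le> 0" by (auto elim!: nonpos_Ints_cases)
      then show False using that by auto
    qed
    show "s \<notin> \<int>\<^sub>\<le>\<^sub>0" "(1 + s) / 2 \<notin> \<int>\<^sub>\<le>\<^sub>0" "(1 - s) / 2 \<notin> \<int>\<^sub>\<le>\<^sub>0"
      by (rule *; use that in \<open>auto simp: S_def\<close>)+
    show "s \<noteq> 1" "1 - s \<noteq> 1" using that by (auto simp: S_def)
  qed
  have z: "zeta holomorphic_on - {1}" using is_zeta_zeta by (simp add: is_zeta_def)
  have z': "(\<lambda>s. zeta (1 - s)) holomorphic_on S"
    by (rule holomorphic_on_compose_gen[OF _ z, unfolded o_def]) (use nint in \<open>auto intro!: holomorphic_intros\<close>)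
  have "f holomorphic_on S" unfolding f_def
    using nint by (intro holomorphic_intros z' holomorphic_on_subset[OF z]) (auto intro!: holomorphic_intros)
  moreover have "complex_of_real (-1/2) islimpt U"
  proof -
    have *: "(-1/2 :: real) islimpt {-1<..<0}" by (rule interior_limit_point) auto
    show ?thesis unfolding U_def islimpt_approachable
    proof (intro allI impI)
      fix e :: real assume "e > 0"
      from *[unfolded islimpt_approachable, rule_format, OF this]
      obtain x :: real where x: "x \<in> {-1<..<0}" "x \<noteq> -1/2" "dist x (-1/2) < e" by (elim bexE conjE)
      have "complex_of_real x \<noteq> complex_of_real (-1/2)" using x(2) unfolding of_real_eq_iff .
      moreover have "dist (complex_of_real x) (complex_of_real (-1/2)) < e" using x(3) unfolding dist_of_real .
      ultimately show "\<exists>x'\<in>complex_of_real ` {-1<..<0}. x' \<noteq> complex_of_real (-1/2) \<and> dist x' (complex_of_real (-1/2)) < e"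
        using x(1) by blast
    qed
  qed
  moreover have "f z = 0" if "z \<in> U" for z
    using that zeta_functional_equation_real unfolding U_def f_def by auto
  moreover have "U \<subseteq> S" "complex_of_real (-1/2) \<in> S" "s \<in> S"
    using assms by (auto simp: U_def S_def)
  ultimately have "f s = 0" using S analytic_continuation[of f S U "complex_of_real (-1/2)" s] by blast
  then show ?thesis by (simp add: f_def)
qed

lemma zeta_cnj: "zeta (cnj s) = cnj (zeta s)"
proof -
  have "is_zeta (\<lambda>s. cnj (zeta (cnj s)))"
    unfolding is_zeta_def
  proof (intro conjI allI impI)
    have z: "zeta holomorphic_on - {1}" using is_zeta_zeta by (simp add: is_zeta_def)
    have img: "cnj ` (- {1}) = - {1}"
    proof (intro equalityI subsetI)
      fix x :: complex assume "x \<in> - {1}"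
      then show "x \<in> cnj ` (- {1})" by (intro image_eqI[of _ _ "cnj x"]) auto
    qed auto
    have "(cnj \<circ> zeta \<circ> cnj) holomorphic_on - {1}"
      using z img open_Compl[of "{1::complex}"] holomorphic_on_compose_cnj_cnj[of zeta "- {1}"] by simp
    then show "(\<lambda>s. cnj (zeta (cnj s))) holomorphic_on - {1}" by (simp add: o_def)
    show "cnj (zeta (cnj 1)) = 0" using is_zeta_zeta by (simp add: is_zeta_def)
    fix s :: complex assume "Re s > 1"
    then have "(\<lambda>n. of_nat (Suc n) powr (- cnj s)) sums zeta (cnj s)"
    proof -
      assume "Re s > 1"
      then have "Re (cnj s) > 1" by simp
      then show ?thesis using is_zeta_zeta unfolding is_zeta_def by blast
    qed
    then have "(\<lambda>n. cnj (of_nat (Suc n) powr (- cnj s))) sums cnj (zeta (cnj s))"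
      by (simp only: sums_cnj)
    also have "(\<lambda>n. cnj (of_nat (Suc n) powr (- cnj s))) = (\<lambda>n. of_nat (Suc n) powr (- s))"
      by (rule ext) (subst cnj_powr, auto simp del: of_nat_Suc)
    finally show "(\<lambda>n. of_nat (Suc n) powr (- s)) sums cnj (zeta (cnj s))" .
  qed
  from is_zeta_unique[OF this is_zeta_zeta] show ?thesis by (metis complex_cnj_cnj)
qed

section \<open>The logarithmic derivative on the critical line\<close>

text \<open>In the limit formula for digamma, compare Re 1/(z + n) with the telescoping difference
  ln |z + n + 1| - ln |z + n|. With w = 1/(z + n) the discrepancy is the real part of Ln(1 + w) - w,
  of size O(|w|^2), and its sum is bounded uniformly in z. The condition on Im z ensures |w| \<le>
  1/2.\<close>

lemma Re_Digamma_estimate: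
  "\<exists>C. \<forall>z. Re z > 0 \<and> \<bar>Im z\<bar> \<ge> 2 \<longrightarrow> \<bar>Re (Digamma z) - ln (norm z)\<bar> \<le> C"
proof -
  define K where "K = (\<Sum>n. 4 / (real (Suc n))\<^sup>2)"
  have sK: "summable (\<lambda>n. 4 / (real (Suc n))\<^sup>2)"
  proof -
    have "real (Suc n) powr (-2) = 1 / (real (Suc n))\<^sup>2" for n
      by (simp add: powr_minus powr_numeral divide_inverse del: of_nat_Suc)
    with summable_mult[OF summable_Suc_powr[of "-2"], of 4] show ?thesis by (simp del: of_nat_Suc)
  qed
  show ?thesis
  proof (intro exI[of _ K] allI impI)
    fix z :: complex assume z: "Re z > 0 \<and> \<bar>Im z\<bar> \<ge> 2"
    define e where "e = (\<lambda>n. ln (norm (z + of_nat (Suc n))) - ln (norm (z + of_nat n)) - Re (inverse (z + of_nat n)))"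
    have nz: "norm (z + of_nat n) \<ge> 2" for n using abs_Im_le_cmod[of "z + of_nat n"] z by simp
    have e_le: "\<bar>e n\<bar> \<le> 4 / (real (Suc n))\<^sup>2" for n
    proof -
      define u where "u = z + of_nat n"
      define w where "w = inverse u"
      have u: "norm u \<ge> 2" "u \<noteq> 0" using nz[of n] by (auto simp: u_def)
      have w1: "norm w \<le> 1/2" using u le_imp_inverse_le[of 2 "norm u"] by (simp add: w_def norm_inverse)
      have w: "norm w \<le> 1/2" "1 + w \<noteq> 0"
      proof -
        show "1 + w \<noteq> 0"
        proof
          assume "1 + w = 0"
          then have "w = -1" by (metis add_eq_0_iff)
          then show False using w1 by simp
        qed
      qed fact
      have "z + of_nat (Suc n) = u * (1 + w)" proof -
        have "u * (1 + w) = u + 1" using u by (simp add: w_def distrib_left)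
        then show ?thesis by (simp add: u_def)
      qed
      then have "e n = ln (norm (1 + w)) - Re w"
        using u w unfolding e_def u_def[symmetric] by (simp add: norm_mult ln_mult w_def)
      also have "ln (norm (1 + w)) = Re (Ln (1 + w))" using w by simp
      also have "Re (Ln (1 + w)) - Re w = Re (Ln (1 + w) - w)" by simp
      finally have "\<bar>e n\<bar> \<le> norm (Ln (1 + w) - w)" using abs_Re_le_cmod by metis
      also have "\<dots> \<le> norm w ^ 2 / (1 - norm w)" by (rule Ln_approx_linear) (use w in linarith)
      also have "\<dots> \<le> norm w ^ 2 / (1/2)" using w by (intro divide_left_mono) auto
      also have "\<dots> = 2 / (norm u)\<^sup>2" 
      proof -
        have "norm w = 1 / norm u" by (simp add: w_def norm_inverse norm_divide inverse_eq_divide)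
        then show ?thesis by (simp add: power_divide)
      qed
      also have "\<dots> \<le> 4 / (real (Suc n))\<^sup>2"
      proof -
        have "2 ^ 2 \<le> (Im u)\<^sup>2" using z abs_le_square_iff[of 2 "Im u"] by (simp add: u_def)
        moreover have "real n ^ 2 \<le> (Re u)\<^sup>2" using z by (intro power_mono) (auto simp: u_def)
        ultimately have "real n ^ 2 + 2 ^ 2 \<le> Re u ^ 2 + Im u ^ 2" by linarith
        then have "real n ^ 2 + 4 \<le> (norm u)\<^sup>2" by (simp add: cmod_power2)
        moreover have "(real (Suc n))\<^sup>2 \<le> 2 * (real n ^ 2 + 4)"
          using zero_le_power2[of "real n - 1"] by (simp add: power2_eq_square algebra_simps)
        ultimately have "(real (Suc n))\<^sup>2 \<le> 2 * (norm u)\<^sup>2" by (simp del: of_nat_Suc)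
        then show ?thesis using u by (simp add: field_simps)
      qed
      finally show ?thesis .
    qed
    have tele: "ln (real m) - (\<Sum>n<m. Re (inverse (z + of_nat n))) =
       (ln (real m) - ln (norm (z + of_nat m))) + (ln (norm z) + (\<Sum>n<m. e n))" for m
    proof -
      have "(\<Sum>n<m. ln (norm (z + of_nat (Suc n))) - ln (norm (z + of_nat n))) = ln (norm (z + of_nat m)) - ln (norm z)"
        using sum_lessThan_telescope[of "\<lambda>n. ln (norm (z + of_nat n))" m] by simp
      then show ?thesis unfolding e_def sum_subtractf by linarith
    qed
    have "z \<noteq> 0" using z by auto
    from tendsto_Re[OF Digamma_LIMSEQ[OF this]]
    have L1: "(\<lambda>m. ln (real m) - (\<Sum>n<m. Re (inverse (z + of_nat n)))) \<longlonglongrightarrow> Re (Digamma z)"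
      by (simp add: Re_sum)
    have L2: "(\<lambda>m. ln (real m) - ln (norm (z + of_nat m))) \<longlonglongrightarrow> 0"
    proof -
      have "(\<lambda>m. - ln (norm (z * inverse (of_nat m) + 1))) \<longlonglongrightarrow> - ln (norm (z * 0 + 1))"
        by (intro tendsto_intros lim_inverse_n) auto
      then have "(\<lambda>m. - ln (norm (z * inverse (of_nat m) + 1))) \<longlonglongrightarrow> 0" by simp
      then show ?thesis
      proof (rule Lim_transform_eventually)
        show "\<forall>\<^sub>F m in sequentially. - ln (norm (z * inverse (of_nat m) + 1)) = ln (real m) - ln (norm (z + of_nat m))"
          using eventually_gt_at_top[of 0]
        proof eventually_elim
          case (elim m)
          have "z * inverse (of_nat m) + 1 = (z + of_nat m) / of_nat m" using elim by (simp add: field_simps)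
          then have "norm (z * inverse (of_nat m) + 1) = norm (z + of_nat m) / real m" by (simp add: norm_divide)
          moreover have "z + of_nat m \<noteq> 0" using nz[of m] by auto
          ultimately show ?case using elim by (simp add: ln_div)
        qed
      qed
    qed
    from tendsto_diff[OF L1 L2] have L3: "(\<lambda>m. \<bar>(\<Sum>n<m. e n)\<bar>) \<longlonglongrightarrow> \<bar>Re (Digamma z) - 0 - ln (norm z)\<bar>"
      unfolding tele by (intro tendsto_rabs) (use tendsto_diff[OF _ tendsto_const[of "ln (norm z)"]] in fastforce)
    show "\<bar>Re (Digamma z) - ln (norm z)\<bar> \<le> K"
    proof (rule LIMSEQ_le_const2[OF L3[simplified]])
      have "\<bar>(\<Sum>n<m. e n)\<bar> \<le> K" for m
      proof -
        have "\<bar>(\<Sum>n<m. e n)\<bar> \<le> (\<Sum>n<m. 4 / (real (Suc n))\<^sup>2)"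
          by (rule order_trans[OF sum_abs sum_mono]) (rule e_le)
        also have "\<dots> \<le> K" unfolding K_def by (rule sum_le_suminf[OF sK]) auto
        finally show ?thesis .
      qed
      then show "\<exists>N. \<forall>n\<ge>N. \<bar>(\<Sum>i<n. e i)\<bar> \<le> K" by blast
    qed
  qed
qed

lemma zeta_has_field_derivative:
  assumes "s \<noteq> 1"
  shows "(zeta has_field_derivative deriv zeta s) (at s)"
  using is_zeta_zeta assms by (intro holomorphic_derivI[of zeta "- {1}"]) (auto simp: is_zeta_def)

lemma deriv_zeta_cnj:
  assumes "s \<noteq> 1"
  shows "deriv zeta (cnj s) = cnj (deriv zeta s)"
proof -
  have "((cnj \<circ> zeta \<circ> cnj) has_field_derivative cnj (deriv zeta (cnj (cnj s)))) (at (cnj s))"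
    by (rule has_field_derivative_cnj_cnj) (simp add: zeta_has_field_derivative assms)
  moreover have "cnj \<circ> zeta \<circ> cnj = zeta" by (simp add: fun_eq_iff zeta_cnj)
  ultimately show ?thesis by (simp add: DERIV_imp_deriv)
qed

lemma zeta_log_deriv_functional_equation:
  assumes s: "Im s > 0" and nz: "zeta s \<noteq> 0" "zeta (1 - s) \<noteq> 0"
  shows "Digamma s + deriv zeta s / zeta s =
    of_real (ln (2 * pi)) + Digamma ((1 + s) / 2) / 2 - Digamma ((1 - s) / 2) / 2 - deriv zeta (1 - s) / zeta (1 - s)"
proof -
  define F where "F = (\<lambda>s. of_real (2 * pi) powr (s - 1) * (Gamma ((1 + s) / 2) * Gamma ((1 - s) / 2)) * zeta (1 - s))"
  define R where "R = of_real (ln (2 * pi)) + Digamma ((1 + s) / 2) / 2 - Digamma ((1 - s) / 2) / 2 - deriv zeta (1 - s) / zeta (1 - s)"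
  have nint: "w \<notin> \<int>\<^sub>\<le>\<^sub>0" if "Im w \<noteq> 0" for w using that by (auto elim!: nonpos_Ints_cases)
  have n: "s \<notin> \<int>\<^sub>\<le>\<^sub>0" "(1 + s) / 2 \<notin> \<int>\<^sub>\<le>\<^sub>0" "(1 - s) / 2 \<notin> \<int>\<^sub>\<le>\<^sub>0" "s \<noteq> 1" "1 - s \<noteq> 1"
    using s by (auto intro!: nint)
  have D1: "((\<lambda>s. Gamma s * zeta s) has_field_derivative Gamma s * zeta s * (Digamma s + deriv zeta s / zeta s)) (at s)"
    using n nz by (auto intro!: derivative_eq_intros zeta_has_field_derivative simp: field_simps)
  have P: "((\<lambda>s. complex_of_real (2 * pi) powr (s - 1)) has_field_derivative of_real (2 * pi) powr (s - 1) * of_real (ln (2 * pi))) (at s)"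
  proof -
    have "Ln (complex_of_real (2 * pi)) = of_real (ln (2 * pi))" by (rule Ln_of_real) simp
    moreover have "((\<lambda>s. complex_of_real (2 * pi) powr (s - 1)) has_field_derivative
        Ln (of_real (2 * pi)) * of_real (2 * pi) powr (s - 1) * 1) (at s)"
      by (rule DERIV_chain2[OF has_field_derivative_powr_right]) (auto intro!: derivative_eq_intros)
    ultimately show ?thesis by (simp add: mult_ac)
  qed
  have G1: "((\<lambda>s. Gamma ((1 + s) / 2)) has_field_derivative Gamma ((1 + s) / 2) * (Digamma ((1 + s) / 2) / 2)) (at s)"
    using n by (auto intro!: derivative_eq_intros)
  have G2: "((\<lambda>s. Gamma ((1 - s) / 2)) has_field_derivative Gamma ((1 - s) / 2) * (- Digamma ((1 - s) / 2) / 2)) (at s)"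
    using n by (auto intro!: derivative_eq_intros)
  have Z: "((\<lambda>s. zeta (1 - s)) has_field_derivative zeta (1 - s) * (- deriv zeta (1 - s) / zeta (1 - s))) (at s)"
  proof -
    have "((\<lambda>s. 1 - s) has_field_derivative -1) (at s)" by (auto intro!: derivative_eq_intros)
    from DERIV_chain2[OF zeta_has_field_derivative[OF n(5)] this] show ?thesis using nz by simp
  qed
  have "(F has_field_derivative F s * R) (at s)"
    unfolding F_def
    by (rule DERIV_cong[OF DERIV_mult[OF DERIV_mult[OF P DERIV_mult[OF G1 G2]] Z]])
       (simp add: R_def algebra_simps)
  then have D2: "((\<lambda>s. Gamma s * zeta s) has_field_derivative F s * R) (at s)"
    by (rule has_field_derivative_transform_within_open[of _ _ _ "{s. Im s > 0}"])
       (use s in \<open>auto simp: F_def zeta_functional_equation open_halfspace_Im_gt\<close>)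
  have "Gamma s * zeta s * (Digamma s + deriv zeta s / zeta s) = Gamma s * zeta s * R"
    using DERIV_unique[OF D1 D2] zeta_functional_equation[OF s] by (simp add: F_def)
  moreover have "Gamma s * zeta s \<noteq> 0" using n nz by (simp add: Gamma_eq_zero_iff)
  ultimately show ?thesis by (simp add: R_def)
qed

text \<open>The term at 1 - s is the conjugate of the one at s, so the functional equation yields
  twice the real part. The digamma values at a and b both have real part ln(t/2) + O(1) and cancel,
  and - Re Digamma(s) = - ln t + O(1) remains. For t \<ge> 4 the imaginary parts are large enough
  for the digamma estimate.\<close>

lemma Re_zeta_log_deriv_critical_line:
  "\<exists>C. \<forall>t\<ge>4. zeta (Complex (1/2) t) \<noteq> 0 \<longrightarrow>
     \<bar>Re (deriv zeta (Complex (1/2) t) / zeta (Complex (1/2) t)) + ln t / 2\<bar> \<le> C"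
proof -
  obtain C where C: "\<And>z. Re z > 0 \<Longrightarrow> \<bar>Im z\<bar> \<ge> 2 \<Longrightarrow> \<bar>Re (Digamma z) - ln (norm z)\<bar> \<le> C"
    using Re_Digamma_estimate by blast
  show ?thesis
  proof (intro exI[of _ "C + \<bar>ln (2 * pi)\<bar> + 2"] allI impI)
    fix t :: real assume t: "t \<ge> 4" and nz: "zeta (Complex (1/2) t) \<noteq> 0"
    define s where "s = Complex (1/2) t"
    have s1: "1 - s = cnj s" by (simp add: s_def complex_eq_iff)
    have s: "Im s > 0" "s \<noteq> 1" using t by (auto simp: s_def complex_eq_iff)
    define a b where "a = (1 + s) / 2" and "b = (1 - s) / 2"
    have eq: "Digamma s + deriv zeta s / zeta s =
      of_real (ln (2 * pi)) + Digamma a / 2 - Digamma b / 2 - cnj (deriv zeta s / zeta s)"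
    proof -
      have nz': "zeta (1 - s) \<noteq> 0" unfolding s1 using nz by (simp add: zeta_cnj s_def)
      have q: "deriv zeta (1 - s) / zeta (1 - s) = cnj (deriv zeta s / zeta s)"
        unfolding s1 using s by (simp add: zeta_cnj deriv_zeta_cnj)
      show ?thesis
        using zeta_log_deriv_functional_equation[OF s(1) nz[folded s_def] nz'] unfolding q a_def b_def .
    qed
    have "Re (Digamma s) + 2 * Re (deriv zeta s / zeta s) = ln (2 * pi) + Re (Digamma a) / 2 - Re (Digamma b) / 2"
      using arg_cong[OF eq, of Re] by (simp del: complex_cnj_divide)
    moreover have "\<bar>Re (Digamma s) - ln (norm s)\<bar> \<le> C" "\<bar>Re (Digamma a) - ln (norm a)\<bar> \<le> C" "\<bar>Re (Digamma b) - ln (norm b)\<bar> \<le> C"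
      using t by (intro C; simp add: s_def a_def b_def)+
    moreover have "\<bar>ln (norm s) - ln t\<bar> \<le> 1" "\<bar>ln (norm a) - ln (t/2)\<bar> \<le> 1" "\<bar>ln (norm b) - ln (t/2)\<bar> \<le> 1"
    proof -
      have *: "\<bar>ln (norm z) - ln y\<bar> \<le> 1" if "y > 0" "\<bar>Im z\<bar> = y" "\<bar>Re z\<bar> \<le> y" for z y
      proof -
        have "y \<le> norm z" using abs_Im_le_cmod[of z] that by simp
        moreover have "norm z \<le> 2 * y" using cmod_le[of z] that by simp
        ultimately have "ln y \<le> ln (norm z)" "ln (norm z) \<le> ln (2 * y)" using that by (auto intro!: ln_mono)
        moreover have "ln (2 * y) = ln 2 + ln y" using that by (simp add: ln_mult)
        moreover have "ln (2::real) \<le> 1" using ln_2_less_1 by simp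
        ultimately show ?thesis by linarith
      qed
      show "\<bar>ln (norm s) - ln t\<bar> \<le> 1" "\<bar>ln (norm a) - ln (t/2)\<bar> \<le> 1" "\<bar>ln (norm b) - ln (t/2)\<bar> \<le> 1"
        using t by (intro *; simp add: s_def a_def b_def)+
    qed
    ultimately show "\<bar>Re (deriv zeta (Complex (1/2) t) / zeta (Complex (1/2) t)) + ln t / 2\<bar> \<le> C + \<bar>ln (2 * pi)\<bar> + 2"
      unfolding s_def[symmetric] abs_le_iff by linarith
  qed
qed

section \<open>Zeros of the derivative between two close zeros\<close>

lemma has_field_derivative_prod_power:
  fixes s :: "'a :: real_normed_field"
  assumes "finite Z" "s \<notin> Z"
  shows "((\<lambda>z. \<Prod>\<rho>\<in>Z. (z - \<rho>) ^ m \<rho>) has_field_derivative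
    (\<Prod>\<rho>\<in>Z. (s - \<rho>) ^ m \<rho>) * (\<Sum>\<rho>\<in>Z. of_nat (m \<rho>) / (s - \<rho>))) (at s)"
  using assms
proof (induction Z rule: finite_induct)
  case (insert a Z)
  have "((\<lambda>z. (z - a) ^ m a) has_field_derivative (s - a) ^ m a * (of_nat (m a) / (s - a))) (at s)"
  proof (cases "m a")
    case (Suc k)
    have "((\<lambda>z. z - a) has_field_derivative 1) (at s)" by (auto intro!: derivative_eq_intros)
    from DERIV_power[OF this, of "Suc k"] show ?thesis
      using insert Suc by (auto elim!: DERIV_cong simp del: of_nat_Suc)
  qed auto
  from DERIV_mult[OF this insert.IH] show ?case
    using insert by (auto elim!: DERIV_cong simp: algebra_simps)
qed auto

text \<open>Landau's lemma is centred at 2 + i \<gamma>, where \<zeta> is bounded below, although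
  the zeros of interest are near 1/2 + i \<gamma>: the ball of radius 1/4 there reaches distance 3/2
  + 1/4 = 7/4 < 2 from the centre.\<close>

lemma zeta_local_log_deriv:
  "\<exists>K>0. \<forall>\<gamma>\<ge>20. \<exists>H m. H holomorphic_on ball (Complex (1/2) \<gamma>) (1/8) \<and>
     finite {z \<in> ball (Complex (1/2) \<gamma>) (1/4). zeta z = 0} \<and>
     (\<forall>\<rho>\<in>{z \<in> ball (Complex (1/2) \<gamma>) (1/4). zeta z = 0}. (m \<rho> :: nat) \<ge> 1) \<and>
     (\<forall>s\<in>ball (Complex (1/2) \<gamma>) (1/8). norm (H s) \<le> K * ln \<gamma> \<and> (zeta s \<noteq> 0 \<longrightarrow>
        deriv zeta s / zeta s = H s + (\<Sum>\<rho>\<in>{z \<in> ball (Complex (1/2) \<gamma>) (1/4). zeta z = 0}. of_nat (m \<rho>) / (s - \<rho>))))"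
proof -
  obtain A where A: "A > 0" "\<And>\<gamma> s. \<gamma> \<ge> 20 \<Longrightarrow> s \<in> cball (Complex 2 \<gamma>) 6 \<Longrightarrow>
      norm (zeta s) \<le> exp (A * ln \<gamma>) * norm (zeta (Complex 2 \<gamma>))"
    using zeta_log_growth by blast
  show ?thesis
  \<comment> \<open>512 comes from the zero-free factor, 16 * 2 / (2 - 7/4)^2, and 16 from the
    distant zeros: total multiplicity at most 2M, each term at most 8.\<close>
  proof (intro exI[of _ "528 * A"] conjI allI impI)
    fix \<gamma> :: real assume g: "\<gamma> \<ge> 20"
    define a s0 where "a = Complex (1/2) \<gamma>" and "s0 = Complex 2 \<gamma>"
    define M where "M = A * ln \<gamma>"
    have M: "M > 0" using A g by (simp add: M_def)
    define Z0 where "Z0 = {z \<in> cball s0 2. zeta z = 0}"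
    \<comment> \<open>Any radius above 3 * 2 and at most 20 would keep Landau's disc inside and the
      pole outside.\<close>
    have "1 \<notin> ball s0 19"
      using abs_Im_le_cmod[of "s0 - 1"] g by (auto simp: dist_norm s0_def)
    then have hz: "zeta holomorphic_on ball s0 19"
      using is_zeta_zeta by (auto simp: is_zeta_def elim: holomorphic_on_subset)
    have z0: "zeta s0 \<noteq> 0" using norm_zeta_ge_quarter[of s0] by (auto simp: s0_def)
    have "\<exists>h m. h holomorphic_on ball s0 19 \<and> finite Z0 \<and> (\<forall>z\<in>cball s0 2. h z \<noteq> 0) \<and>
       (\<forall>\<rho>\<in>Z0. (m \<rho> :: nat) \<ge> 1) \<and> (\<forall>z\<in>ball s0 19. zeta z = h z * (\<Prod>\<rho>\<in>Z0. (z - \<rho>) ^ m \<rho>)) \<and>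
       real (\<Sum>\<rho>\<in>Z0. m \<rho>) * ln 2 \<le> M \<and>
       (\<forall>s\<in>cball s0 (7/4). norm (deriv h s / h s) \<le> 16 * M * 2 / (2 - 7/4)\<^sup>2)"
      unfolding Z0_def
      by (rule landau_factorization[OF hz _ _ _ M z0]) (use A(2)[OF g] in \<open>auto simp: s0_def M_def\<close>)
    then obtain h m where h: "h holomorphic_on ball s0 19" and finZ0: "finite Z0"
      and hnz: "\<And>z. z \<in> cball s0 2 \<Longrightarrow> h z \<noteq> 0"
      and m1: "\<And>\<rho>. \<rho> \<in> Z0 \<Longrightarrow> (m \<rho> :: nat) \<ge> 1"
      and fac: "\<And>z. z \<in> ball s0 19 \<Longrightarrow> zeta z = h z * (\<Prod>\<rho>\<in>Z0. (z - \<rho>) ^ m \<rho>)"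
      and cnt: "real (\<Sum>\<rho>\<in>Z0. m \<rho>) * ln 2 \<le> M"
      and ld: "\<And>s. s \<in> cball s0 (7/4) \<Longrightarrow> norm (deriv h s / h s) \<le> 16 * M * 2 / (2 - 7/4)\<^sup>2"
      by blast
    define Z where "Z = {z \<in> ball a (1/4). zeta z = 0}"
    have dist: "dist s0 a = 3/2" by (simp add: dist_norm s0_def a_def complex_diff norm_complex_def cmod_def)
    have ball1: "ball a (1/4) \<subseteq> cball s0 (7/4)"
    proof
      fix z assume "z \<in> ball a (1/4)"
      then show "z \<in> cball s0 (7/4)" using dist_triangle[of s0 z a] dist by auto
    qed
    have ZZ0: "Z \<subseteq> Z0" using ball1 by (auto simp: Z_def Z0_def)
    \<comment> \<open>Zeros of the large disc at distance at least 1/4 from a are counted into H; on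
      the ball of radius 1/8 they stay 1/8 away.\<close>
    define H where "H = (\<lambda>s. deriv h s / h s + (\<Sum>\<rho>\<in>Z0 - Z. of_nat (m \<rho>) / (s - \<rho>)))"
    have far: "norm (s - \<rho>) \<ge> 1/8" if "s \<in> ball a (1/8)" "\<rho> \<in> Z0 - Z" for s \<rho>
      using that dist_triangle[of a \<rho> s] by (auto simp: Z0_def Z_def dist_norm)
    have ball2: "ball a (1/8) \<subseteq> cball s0 (7/4)" "ball a (1/8) \<subseteq> ball s0 19" "ball a (1/8) \<subseteq> cball s0 2"
    proof -
      show *: "ball a (1/8) \<subseteq> cball s0 (7/4)" using ball1 subset_ball[of "1/8" "1/4" a] by auto
      show "ball a (1/8) \<subseteq> ball s0 19" "ball a (1/8) \<subseteq> cball s0 2" by (rule order_trans[OF *]; force)+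
    qed
    show "\<exists>H m. H holomorphic_on ball (Complex (1/2) \<gamma>) (1/8) \<and>
     finite {z \<in> ball (Complex (1/2) \<gamma>) (1/4). zeta z = 0} \<and>
     (\<forall>\<rho>\<in>{z \<in> ball (Complex (1/2) \<gamma>) (1/4). zeta z = 0}. (m \<rho> :: nat) \<ge> 1) \<and>
     (\<forall>s\<in>ball (Complex (1/2) \<gamma>) (1/8). norm (H s) \<le> 528 * A * ln \<gamma> \<and> (zeta s \<noteq> 0 \<longrightarrow>
        deriv zeta s / zeta s = H s + (\<Sum>\<rho>\<in>{z \<in> ball (Complex (1/2) \<gamma>) (1/4). zeta z = 0}. of_nat (m \<rho>) / (s - \<rho>))))"
      unfolding a_def[symmetric] Z_def[symmetric]
    proof (intro exI[of _ H] exI[of _ m] conjI ballI impI)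
      show "finite Z" using finite_subset[OF ZZ0 finZ0] .
      show "m \<rho> \<ge> 1" if "\<rho> \<in> Z" for \<rho> using that ZZ0 m1 by auto
      have "deriv h holomorphic_on ball s0 19" by (intro holomorphic_deriv h) auto
      then show "H holomorphic_on ball a (1/8)" unfolding H_def
        using far hnz ball2 by (intro holomorphic_intros holomorphic_on_subset[OF h]) 
          (auto elim: holomorphic_on_subset, force)
      fix s assume s: "s \<in> ball a (1/8)"
      show "norm (H s) \<le> 528 * A * ln \<gamma>"
      proof -
        have "norm (\<Sum>\<rho>\<in>Z0 - Z. of_nat (m \<rho>) / (s - \<rho>)) \<le> (\<Sum>\<rho>\<in>Z0 - Z. real (m \<rho>) * 8)"
        proof (rule sum_norm_le)
          fix \<rho> assume "\<rho> \<in> Z0 - Z"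
          from far[OF s this] have "real (m \<rho>) / norm (s - \<rho>) \<le> real (m \<rho>) / (1/8)"
            by (intro divide_left_mono) auto
          then show "norm (of_nat (m \<rho>) / (s - \<rho>)) \<le> real (m \<rho>) * 8" by (simp add: norm_divide)
        qed
        also have "\<dots> \<le> (\<Sum>\<rho>\<in>Z0. real (m \<rho>) * 8)" using finZ0 by (intro sum_mono2) auto
        also have "\<dots> = 8 * real (\<Sum>\<rho>\<in>Z0. m \<rho>)" by (simp add: sum_distrib_left mult.commute)
        also have "\<dots> \<le> 16 * M"
        proof -
          have "real (\<Sum>\<rho>\<in>Z0. m \<rho>) * (1/2) \<le> real (\<Sum>\<rho>\<in>Z0. m \<rho>) * ln 2"
            using ln2_ge_two_thirds by (intro mult_left_mono) (auto intro!: sum_nonneg)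
          then show ?thesis using cnt by linarith
        qed
        finally have "norm (\<Sum>\<rho>\<in>Z0 - Z. of_nat (m \<rho>) / (s - \<rho>)) \<le> 16 * M" .
        moreover have "norm (deriv h s / h s) \<le> 512 * M"
          using ld[of s] s ball2 by (auto simp: power2_eq_square)
        ultimately have "norm (H s) \<le> 528 * M"
          unfolding H_def by (intro norm_triangle_le) linarith
        then show ?thesis by (simp add: M_def)
      qed
      assume nz: "zeta s \<noteq> 0"
      have sb: "s \<in> ball s0 19" using s ball2 by auto
      have sZ: "s \<notin> Z0" using nz by (auto simp: Z0_def)
      have dh: "(h has_field_derivative deriv h s) (at s)" by (rule holomorphic_derivI[OF h _ sb]) simp
      define P where "P = (\<lambda>z. \<Prod>\<rho>\<in>Z0. (z - \<rho>) ^ m \<rho>)"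
      define S where "S = (\<Sum>\<rho>\<in>Z0. of_nat (m \<rho>) / (s - \<rho>))"
      have "((\<lambda>z. h z * P z) has_field_derivative deriv h s * P s + P s * S * h s) (at s)"
        unfolding P_def S_def by (rule DERIV_mult[OF dh has_field_derivative_prod_power[OF finZ0 sZ]])
      then have "(zeta has_field_derivative deriv h s * P s + P s * S * h s) (at s)"
        by (rule has_field_derivative_transform_within_open[of _ _ _ "ball s0 19"]) (use sb fac in \<open>auto simp: P_def\<close>)
      then have "deriv zeta s = deriv h s * P s + P s * S * h s" by (rule DERIV_imp_deriv)
      moreover have "zeta s = h s * P s" using fac[OF sb] by (simp add: P_def)
      moreover have "h s \<noteq> 0" "P s \<noteq> 0" using nz \<open>zeta s = h s * P s\<close> by auto
      ultimately have "deriv zeta s / zeta s = deriv h s / h s + S" by (simp add: field_simps)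
      also have "S = (\<Sum>\<rho>\<in>Z0 - Z. of_nat (m \<rho>) / (s - \<rho>)) + (\<Sum>\<rho>\<in>Z. of_nat (m \<rho>) / (s - \<rho>))"
        unfolding S_def by (rule sum.subset_diff[OF ZZ0 finZ0])
      finally show "deriv zeta s / zeta s = H s + (\<Sum>\<rho>\<in>Z. of_nat (m \<rho>) / (s - \<rho>))"
        by (simp add: H_def)
    qed
  qed (use A in auto)
qed

section \<open>Signs of real parts on the sides of the rectangle\<close>

lemma quotient_not_nonpos_Reals:
  assumes "Re w * Re g > 0"
  shows "w / g \<notin> \<real>\<^sub>\<le>\<^sub>0"
proof
  assume "w / g \<in> \<real>\<^sub>\<le>\<^sub>0"
  then obtain r where r: "w / g = of_real r" "r \<le> 0" by (elim nonpos_Reals_cases)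
  have "g \<noteq> 0" using assms by auto
  then have "w = of_real r * g" using r(1) by (simp add: field_simps)
  then have "Re w * Re g = r * (Re g)\<^sup>2" by (simp add: power2_eq_square)
  also have "\<dots> \<le> 0" using r(2) by (simp add: mult_nonpos_nonneg)
  finally show False using assms by simp
qed

lemma Re_inverse_linear:
  "Re (1 / (s - Complex b c)) = (Re s - b) / ((Re s - b)\<^sup>2 + (Im s - c)\<^sup>2)"
  by (simp add: Re_divide)

text \<open>
  The comparison function \<open>(z - x0) / (z\<^sup>2 + d\<^sup>2)\<close> has the two poles \<open>\<plusminus>\<i>d\<close> and one zero inside the
  rectangle, and its real part has the same sign as that of \<open>\<zeta>'/\<zeta>\<close> on each side of the rectangle.
\<close>
lemma Re_comparison_pos:
  assumes x: "0 < x" "x \<le> X" and y: "\<bar>y\<bar> \<le> d" and edge: "x = X \<or> \<bar>y\<bar> = d"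
    and x0: "0 < x0" "x0 < X" "x0 < d"
  shows "Re ((Complex x y - of_real x0) / ((Complex x y - Complex 0 (-d)) * (Complex x y - Complex 0 d))) > 0"
proof -
  \<comment> \<open>This is the real part of (z - x0) times the conjugate of z^2 + d^2, which has
    the sign of the quotient.\<close>
  have p: "x * (x\<^sup>2 + y\<^sup>2 + d\<^sup>2) - x0 * (x\<^sup>2 - y\<^sup>2 + d\<^sup>2) > 0"
  proof (cases "x = X")
    case True
    have "x0 * (x\<^sup>2 - y\<^sup>2 + d\<^sup>2) \<le> x0 * (x\<^sup>2 + y\<^sup>2 + d\<^sup>2)"
      using x0 by (intro mult_left_mono) auto
    also have "\<dots> < x * (x\<^sup>2 + y\<^sup>2 + d\<^sup>2)"
      using x0 x True by (intro mult_strict_right_mono add_pos_nonneg add_pos_pos) auto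
    finally show ?thesis by simp
  next
    case False
    then have y2: "y\<^sup>2 = d\<^sup>2" using edge by (metis power2_abs)
    \<comment> \<open>On the horizontal sides x0 < d and 2 d x \<le> d^2 + x^2 suffice.\<close>
    have "x0 * x < x\<^sup>2 + 2 * d\<^sup>2"
    proof -
      have "2 * (x0 * x) \<le> 2 * (d * x)" using x0 x by simp
      also have "2 * (d * x) \<le> d\<^sup>2 + x\<^sup>2" using sum_squares_bound[of d x] by simp
      finally have *: "2 * (x0 * x) \<le> d\<^sup>2 + x\<^sup>2" by simp
      have "u < E + 2 * D" if "2 * u \<le> D + E" "D > 0" "E > 0" for u D E :: real
        using that by linarith
      from this[OF *] show ?thesis using x x0 by simp
    qed
    then have "x * (x\<^sup>2 + 2 * d\<^sup>2 - x0 * x) > 0" using x by simp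
    then show ?thesis unfolding y2 by (simp add: power2_eq_square algebra_simps)
  qed
  define w where "w = (Complex x y - Complex 0 (-d)) * (Complex x y - Complex 0 d)"
  have w: "Re w = x\<^sup>2 - y\<^sup>2 + d\<^sup>2" "Im w = 2 * x * y"
    by (auto simp: w_def power2_eq_square algebra_simps)
  have "w \<noteq> 0" using x unfolding w_def mult_eq_0_iff by (auto simp: complex_eq_iff)
  then have "(Re w)\<^sup>2 + (Im w)\<^sup>2 > 0" by (simp add: complex_neq_0)
  moreover have "Re (Complex x y - of_real x0) * Re w + Im (Complex x y - of_real x0) * Im w > 0"
    using p unfolding w by (simp add: power2_eq_square algebra_simps)
  ultimately show ?thesis unfolding w_def[symmetric] Re_divide by (intro divide_pos_pos)
qed

lemma Re_comparison_neg:
  assumes "\<bar>y\<bar> < d" "0 < x0"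
  shows "Re ((Complex 0 y - of_real x0) / ((Complex 0 y - Complex 0 (-d)) * (Complex 0 y - Complex 0 d))) < 0"
proof -
  have "(Complex 0 y - Complex 0 (-d)) * (Complex 0 y - Complex 0 d) = of_real (d\<^sup>2 - y\<^sup>2)"
    by (simp add: complex_eq_iff power2_eq_square algebra_simps)
  moreover have "y\<^sup>2 < d\<^sup>2" using assms by (metis abs_ge_zero power2_abs power_strict_mono zero_less_numeral)
  ultimately show ?thesis using assms by (simp add: Re_divide_of_real divide_neg_pos)
qed

section \<open>Lower bound for Re \<zeta>'/\<zeta> under the Riemann hypothesis\<close>

lemma zeta_zero_near_critical_line:
  assumes RH: riemann_hypothesis and z: "z \<in> ball (Complex (1/2) t) (1/4)" "zeta z = 0"
  shows "Re z = 1/2"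
proof -
  have "\<bar>Re (Complex (1/2) t - z)\<bar> < 1/4"
    using abs_Re_le_cmod[of "Complex (1/2) t - z"] z by (simp add: dist_norm)
  then have "0 < Re z" "Re z < 1" unfolding abs_less_iff by auto
  then show ?thesis using RH z unfolding riemann_hypothesis_def by blast
qed

text \<open>p is a base point on the critical line where Re H is known up to O(1), and the
  hypothesis on s - p says that s lies within 2 / ln \<gamma> of it. The constant C must be the same
  for all \<gamma>, p and s, since ln \<gamma> has to outgrow it.\<close>

lemma Re_zeta_log_deriv_lower_bound:
  assumes RH: riemann_hypothesis
  shows "\<exists>C. \<forall>\<gamma> \<gamma>' p s. \<gamma> \<ge> 20 \<and> \<gamma> < \<gamma>' \<and> \<gamma>' \<le> \<gamma> + 1/64 \<and> zeta (Complex (1/2) \<gamma>) = 0 \<and> zeta (Complex (1/2) \<gamma>') = 0 \<and>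
     p \<in> {\<gamma><..<\<gamma>'} \<and> zeta (Complex (1/2) p) \<noteq> 0 \<and>
     1/2 < Re s \<and> Re s \<le> 1/2 + 1/32 \<and> Im s \<in> {\<gamma>..\<gamma>'} \<and> norm (s - Complex (1/2) p) * ln \<gamma> \<le> 2 \<longrightarrow>
     Re (deriv zeta s / zeta s) \<ge> - (ln \<gamma> / 2) - C +
       Re (1 / (s - Complex (1/2) \<gamma>)) + Re (1 / (s - Complex (1/2) \<gamma>'))"
proof -
  obtain K where K: "K > 0" and decomp: "\<And>\<gamma>. \<gamma> \<ge> 20 \<Longrightarrow> \<exists>H m. H holomorphic_on ball (Complex (1/2) \<gamma>) (1/8) \<and>
     finite {z \<in> ball (Complex (1/2) \<gamma>) (1/4). zeta z = 0} \<and>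
     (\<forall>\<rho>\<in>{z \<in> ball (Complex (1/2) \<gamma>) (1/4). zeta z = 0}. (m \<rho> :: nat) \<ge> 1) \<and>
     (\<forall>s\<in>ball (Complex (1/2) \<gamma>) (1/8). norm (H s) \<le> K * ln \<gamma> \<and> (zeta s \<noteq> 0 \<longrightarrow>
        deriv zeta s / zeta s = H s + (\<Sum>\<rho>\<in>{z \<in> ball (Complex (1/2) \<gamma>) (1/4). zeta z = 0}. of_nat (m \<rho>) / (s - \<rho>))))"
    using zeta_local_log_deriv by blast
  obtain C where C: "\<And>t. t \<ge> 4 \<Longrightarrow> zeta (Complex (1/2) t) \<noteq> 0 \<Longrightarrow>
     \<bar>Re (deriv zeta (Complex (1/2) t) / zeta (Complex (1/2) t)) + ln t / 2\<bar> \<le> C"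
    using Re_zeta_log_deriv_critical_line by blast
  show ?thesis
  proof (intro exI[of _ "C + 1 + 32 * K"] allI impI, elim conjE)
    fix \<gamma> \<gamma>' p :: real and s
    assume g: "\<gamma> \<ge> 20" "\<gamma> < \<gamma>'" "\<gamma>' \<le> \<gamma> + 1/64" and z: "zeta (Complex (1/2) \<gamma>) = 0" "zeta (Complex (1/2) \<gamma>') = 0"
      and p: "p \<in> {\<gamma><..<\<gamma>'}" "zeta (Complex (1/2) p) \<noteq> 0"
      and s: "1/2 < Re s" "Re s \<le> 1/2 + 1/32" "Im s \<in> {\<gamma>..\<gamma>'}" and sp: "norm (s - Complex (1/2) p) * ln \<gamma> \<le> 2"
    define a where "a = Complex (1/2) \<gamma>"
    define Z where "Z = {z \<in> ball a (1/4). zeta z = 0}"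
    obtain H m where H: "H holomorphic_on ball a (1/8)" and finZ: "finite Z"
      and m: "\<And>\<rho>. \<rho> \<in> Z \<Longrightarrow> (m \<rho> :: nat) \<ge> 1"
      and Hbd: "\<And>s. s \<in> ball a (1/8) \<Longrightarrow> norm (H s) \<le> K * ln \<gamma>"
      and ld: "\<And>s. s \<in> ball a (1/8) \<Longrightarrow> zeta s \<noteq> 0 \<Longrightarrow>
        deriv zeta s / zeta s = H s + (\<Sum>\<rho>\<in>Z. of_nat (m \<rho>) / (s - \<rho>))"
      using decomp[OF g(1)] unfolding a_def[symmetric] Z_def[symmetric] by blast
    have ReZ: "Re \<rho> = 1/2" if "\<rho> \<in> Z" for \<rho>
      using zeta_zero_near_critical_line[OF RH, of \<rho> \<gamma>] that by (auto simp: Z_def a_def)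
    define P where "P = Complex (1/2) p"
    have near: "w \<in> ball a (1/16)" if "1/2 \<le> Re w" "Re w \<le> 1/2 + 1/32" "Im w \<in> {\<gamma>..\<gamma>'}" for w
    proof -
      have "norm (w - a) \<le> \<bar>Re (w - a)\<bar> + \<bar>Im (w - a)\<bar>" by (rule cmod_le)
      also have "\<dots> < 1/16" using that g by (auto simp: a_def)
      finally show ?thesis by (simp add: dist_norm norm_minus_commute)
    qed
    have Pb: "P \<in> ball a (1/16)" and sb: "s \<in> ball a (1/16)"
      by (rule near; use p s in \<open>auto simp: P_def\<close>)+
    have sub: "ball a (1/16) \<subseteq> ball a (1/8)" by (rule subset_ball) simp
    have L: "ln \<gamma> > 0" using g by simp
    \<comment> \<open>The loss 1/2 comes from ln p \<le> ln \<gamma> + 1, valid since p \<le> 2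
      \<gamma>.\<close>
    have HP: "Re (H P) \<ge> - (ln \<gamma> / 2) - C - 1/2"
    proof -
      have "Re (of_nat (m \<rho>) / (P - \<rho>)) = 0" if "\<rho> \<in> Z" for \<rho>
        using ReZ[OF that] by (simp add: P_def Re_divide)
      then have "Re (deriv zeta P / zeta P) = Re (H P)"
        using ld[of P] Pb sub p by (auto simp: P_def[symmetric])
      then have "Re (H P) \<ge> - (ln p / 2) - C" using C[of p] p g by (auto simp: P_def abs_le_iff)
      moreover have "ln p \<le> ln (\<gamma> * exp 1)"
      proof (rule ln_mono)
        have "2 \<le> exp (1::real)" using exp_ge_add_one_self[of 1] by simp
        then have "\<gamma> * 2 \<le> \<gamma> * exp 1" using g by (intro mult_left_mono) auto
        moreover have "p \<le> \<gamma> * 2" using p g by simp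
        ultimately show "p \<le> \<gamma> * exp 1" by (rule order_trans[rotated])
      qed (use p g in auto)
      moreover have "ln (\<gamma> * exp 1) = ln \<gamma> + 1" using g by (simp add: ln_mult)
      ultimately show ?thesis by linarith
    qed
    \<comment> \<open>Cauchy's inequality on discs of radius 1/16 gives |H'| \<le> 16 K ln \<gamma>,
      and |s - P| ln \<gamma> \<le> 2.\<close>
    have lip: "norm (H s - H P) \<le> 32 * K"
    proof -
      have "norm (H s - H P) \<le> (16 * K * ln \<gamma>) * norm (s - P)"
      proof (rule field_differentiable_bound[of "ball a (1/16)" H "deriv H"])
        fix w assume w: "w \<in> ball a (1/16)"
        have wb: "cball w (1/16) \<subseteq> ball a (1/8)"
        proof
          fix u assume "u \<in> cball w (1/16)"
          then show "u \<in> ball a (1/8)" using w dist_triangle[of a u w] by auto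
        qed
        show "(H has_field_derivative deriv H w) (at w within ball a (1/16))"
          using holomorphic_derivI[OF H] w sub by auto
        have "norm ((deriv ^^ 1) H w) \<le> fact 1 * (K * ln \<gamma>) / (1/16) ^ 1"
        proof (rule Cauchy_inequality)
          show "H holomorphic_on ball w (1/16)"
            using H by (rule holomorphic_on_subset) (use wb in auto)
          show "continuous_on (cball w (1/16)) H"
            using holomorphic_on_imp_continuous_on[OF holomorphic_on_subset[OF H wb]] .
          show "norm (H u) \<le> K * ln \<gamma>" if "norm (w - u) = 1/16" for u
            using that by (intro Hbd subsetD[OF wb]) (simp add: dist_norm)
        qed auto
        then show "norm (deriv H w) \<le> 16 * K * ln \<gamma>" by simp
      qed (use Pb sb in auto)
      also have "\<dots> = 16 * K * (norm (s - P) * ln \<gamma>)" by simp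
      also have "\<dots> \<le> 16 * K * 2" using sp K by (intro mult_left_mono) (auto simp: P_def)
      finally show ?thesis by simp
    qed
    have Hs: "Re (H s) \<ge> - (ln \<gamma> / 2) - (C + 1 + 32 * K)"
      using abs_Re_le_cmod[of "H s - H P"] lip HP by (auto simp: abs_le_iff)
    have snz: "zeta s \<noteq> 0" using ReZ[of s] s sb sub by (force simp: Z_def)
    define \<rho>1 \<rho>2 where "\<rho>1 = Complex (1/2) \<gamma>" and "\<rho>2 = Complex (1/2) \<gamma>'"
    have \<rho>Z: "{\<rho>1, \<rho>2} \<subseteq> Z"
      using near[of \<rho>1] near[of \<rho>2] z g subset_ball[of "1/16" "1/4" a]
      by (auto simp: Z_def \<rho>1_def \<rho>2_def)
    have ne: "\<rho>1 \<noteq> \<rho>2" using g by (simp add: \<rho>1_def \<rho>2_def)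
    have pos: "Re (1 / (s - \<rho>)) \<ge> 0" if "\<rho> \<in> Z" for \<rho>
      using ReZ[OF that] s Re_inverse_linear[of s "Re \<rho>" "Im \<rho>"] by (simp add: divide_nonneg_nonneg)
    have "Re (1 / (s - \<rho>1)) + Re (1 / (s - \<rho>2)) = (\<Sum>\<rho>\<in>{\<rho>1, \<rho>2}. Re (1 / (s - \<rho>)))" using ne by simp
    also have "\<dots> \<le> (\<Sum>\<rho>\<in>Z. Re (1 / (s - \<rho>)))" using pos \<rho>Z by (intro sum_mono2 finZ) auto
    also have "\<dots> \<le> (\<Sum>\<rho>\<in>Z. real (m \<rho>) * Re (1 / (s - \<rho>)))"
    proof (rule sum_mono)
      fix \<rho> assume "\<rho> \<in> Z"
      then have "1 * Re (1 / (s - \<rho>)) \<le> real (m \<rho>) * Re (1 / (s - \<rho>))"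
        using m by (intro mult_right_mono pos) auto
      then show "Re (1 / (s - \<rho>)) \<le> real (m \<rho>) * Re (1 / (s - \<rho>))" by simp
    qed
    also have "\<dots> = Re (\<Sum>\<rho>\<in>Z. of_nat (m \<rho>) / (s - \<rho>))"
      unfolding Re_sum by (intro sum.cong refl) (simp add: Re_divide)
    finally have "Re (deriv zeta s / zeta s) \<ge> Re (H s) + (Re (1 / (s - \<rho>1)) + Re (1 / (s - \<rho>2)))"
      using ld[OF _ snz] sb sub by auto
    then show "Re (deriv zeta s / zeta s) \<ge> - (ln \<gamma> / 2) - (C + 1 + 32 * K) +
       Re (1 / (s - Complex (1/2) \<gamma>)) + Re (1 / (s - Complex (1/2) \<gamma>'))"
      using Hs unfolding \<rho>1_def \<rho>2_def by linarith
  qed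
qed

text \<open>Isolates the topological half of the argument: given only the signs of Re
  \<zeta>'/\<zeta> on the four sides, count the zeros inside. Multiplicities of the corner zeros may
  be arbitrary.\<close>

lemma simple_critical_point_between_close_zeros:
  fixes \<gamma> \<gamma>' X :: real
  assumes RH: riemann_hypothesis
    and \<gamma>: "\<gamma> \<ge> 20" "\<gamma> < \<gamma>'" "\<gamma>' \<le> \<gamma> + 1/64"
    and z1: "zeta (Complex (1/2) \<gamma>) = 0" and z2: "zeta (Complex (1/2) \<gamma>') = 0"
    and between: "\<And>t. \<gamma> < t \<Longrightarrow> t < \<gamma>' \<Longrightarrow> zeta (Complex (1/2) t) \<noteq> 0"
    and X: "0 < X" "X \<le> 1/32"
    and left: "\<And>t. \<gamma> < t \<Longrightarrow> t < \<gamma>' \<Longrightarrow> Re (deriv zeta (Complex (1/2) t) / zeta (Complex (1/2) t)) < 0"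
    and right: "\<And>s. 1/2 < Re s \<Longrightarrow> Re s \<le> 1/2 + X \<Longrightarrow> Im s \<in> {\<gamma>..\<gamma>'} \<Longrightarrow>
       Re s = 1/2 + X \<or> Im s = \<gamma> \<or> Im s = \<gamma>' \<Longrightarrow> Re (deriv zeta s / zeta s) > 0"
  shows "\<exists>\<rho>. {s. 1/2 < Re s \<and> Re s < 1/2 + X \<and> \<gamma> \<le> Im s \<and> Im s \<le> \<gamma>' \<and> deriv zeta s = 0} = {\<rho>} \<and>
     zorder (deriv zeta) \<rho> = 1 \<and> \<rho> \<in> box (Complex (1/2) \<gamma>) (Complex (1/2 + X) \<gamma>')"
proof -
  define \<rho>1 \<rho>2 where "\<rho>1 = Complex (1/2) \<gamma>" and "\<rho>2 = Complex (1/2) \<gamma>'"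
  define b where "b = Complex (1/2 + X) \<gamma>'"
  define d where "d = (\<gamma>' - \<gamma>) / 2"
  define mid where "mid = Complex (1/2) ((\<gamma> + \<gamma>') / 2)"
  \<comment> \<open>The zero \<alpha> of the comparison function must lie in the box, and x0 < d
    gives the sign on the horizontal sides.\<close>
  define x0 where "x0 = min X d / 2"
  define \<alpha> where "\<alpha> = mid + of_real x0"
  have d: "d > 0" using \<gamma> by (simp add: d_def)
  have x0: "0 < x0" "x0 < X" "x0 < d" using d X by (auto simp: x0_def min_def)
  have \<rho>12: "\<rho>1 = mid + Complex 0 (-d)" "\<rho>2 = mid + Complex 0 d" "\<rho>1 \<noteq> \<rho>2"
    using \<gamma> by (auto simp: \<rho>1_def \<rho>2_def mid_def d_def complex_eq_iff field_simps)
  obtain K H m where H: "H holomorphic_on ball \<rho>1 (1/8)" and finZ: "finite {z \<in> ball \<rho>1 (1/4). zeta z = 0}"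
    and m: "\<forall>\<rho>\<in>{z \<in> ball \<rho>1 (1/4). zeta z = 0}. (m \<rho> :: nat) \<ge> 1"
    and ld: "\<forall>s\<in>ball \<rho>1 (1/8). norm (H s) \<le> K * ln \<gamma> \<and> (zeta s \<noteq> 0 \<longrightarrow>
        deriv zeta s / zeta s = H s + (\<Sum>\<rho>\<in>{z \<in> ball \<rho>1 (1/4). zeta z = 0}. of_nat (m \<rho>) / (s - \<rho>)))"
    using zeta_local_log_deriv \<gamma>(1) unfolding \<rho>1_def by blast
  define Z where "Z = {z \<in> ball \<rho>1 (1/4). zeta z = 0}"
  define Z' where "Z' = Z - {\<rho>1, \<rho>2}"
  have finZ': "finite Z'" using finZ by (simp add: Z'_def Z_def)
  have ReZ: "Re \<rho> = 1/2" if "\<rho> \<in> Z" for \<rho>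
    using zeta_zero_near_critical_line[OF RH, of \<rho> \<gamma>] that by (auto simp: Z_def \<rho>1_def)
  have cb: "s \<in> cbox \<rho>1 b \<longleftrightarrow> 1/2 \<le> Re s \<and> Re s \<le> 1/2 + X \<and> \<gamma> \<le> Im s \<and> Im s \<le> \<gamma>'" for s
    by (auto simp: in_cbox_complex_iff \<rho>1_def b_def)
  have ob: "s \<in> box \<rho>1 b \<longleftrightarrow> 1/2 < Re s \<and> Re s < 1/2 + X \<and> \<gamma> < Im s \<and> Im s < \<gamma>'" for s
    by (auto simp: in_box_complex_iff \<rho>1_def b_def)
  have near: "s \<in> ball \<rho>1 (1/8)" if "s \<in> cbox \<rho>1 b" for s
  proof -
    have "norm (s - \<rho>1) \<le> \<bar>Re (s - \<rho>1)\<bar> + \<bar>Im (s - \<rho>1)\<bar>" by (rule cmod_le)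
    also have "\<dots> < 1/8" using that \<gamma> X unfolding cb by (auto simp: \<rho>1_def)
    finally show ?thesis by (simp add: dist_norm norm_minus_commute)
  qed
  have sub: "ball \<rho>1 (1/8) \<subseteq> ball \<rho>1 (1/4)" by (rule subset_ball) simp
  have corners: "\<rho>1 \<in> cbox \<rho>1 b" "\<rho>2 \<in> cbox \<rho>1 b" using \<gamma> X unfolding cb by (auto simp: \<rho>1_def \<rho>2_def)
  have \<rho>Z: "{\<rho>1, \<rho>2} \<subseteq> Z"
    using corners[THEN near] sub z1 z2 unfolding Z_def \<rho>1_def[symmetric] \<rho>2_def[symmetric] by auto
  have mpos: "real (m \<rho>1) > 0" "real (m \<rho>2) > 0" using m \<rho>Z unfolding Z_def[symmetric] by force+
  define G where "G = (\<lambda>s. H s + (\<Sum>\<rho>\<in>Z'. of_nat (m \<rho>) / (s - \<rho>)))"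
  \<comment> \<open>(s - \<open>\<rho>1\<close>)(s - \<open>\<rho>2\<close>) \<zeta>'/\<zeta> with
    the corner terms multiplied out, so that it is holomorphic at the corners too.\<close>
  define F where "F = (\<lambda>s. (s - \<rho>1) * (s - \<rho>2) * G s + of_nat (m \<rho>1) * (s - \<rho>2) + of_nat (m \<rho>2) * (s - \<rho>1))"
  define U where "U = ball \<rho>1 (1/8) - Z'"
  have U: "open U" unfolding U_def using finZ' by (intro open_Diff finite_imp_closed) auto
  have holF: "F holomorphic_on U" unfolding F_def G_def
    by (intro holomorphic_intros holomorphic_on_subset[OF H]) (auto simp: U_def)
  have F_eq: "F s = (s - \<rho>1) * (s - \<rho>2) * (deriv zeta s / zeta s)" if "s \<in> ball \<rho>1 (1/8)" "zeta s \<noteq> 0" for s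
  proof -
    have ne: "s - \<rho>1 \<noteq> 0" "s - \<rho>2 \<noteq> 0" using that z1 z2 by (auto simp: \<rho>1_def \<rho>2_def)
    have "(\<Sum>\<rho>\<in>Z. of_nat (m \<rho>) / (s - \<rho>)) = (\<Sum>\<rho>\<in>Z'. of_nat (m \<rho>) / (s - \<rho>)) + (\<Sum>\<rho>\<in>{\<rho>1, \<rho>2}. of_nat (m \<rho>) / (s - \<rho>))"
      unfolding Z'_def using finZ \<rho>Z by (intro sum.subset_diff) (auto simp: Z_def)
    then have "deriv zeta s / zeta s = G s + (of_nat (m \<rho>1) / (s - \<rho>1) + of_nat (m \<rho>2) / (s - \<rho>2))"
      using ld that \<rho>12(3) unfolding Z_def[symmetric] G_def by auto
    moreover have "u * v * (g + (a / u + c / v)) = u * v * g + a * v + c * u" if "u \<noteq> 0" "v \<noteq> 0" for u v g a c :: complex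
      using that by (simp add: field_simps)
    ultimately show ?thesis using ne by (simp add: F_def)
  qed
  have znz: "zeta s \<noteq> 0" if "s \<in> cbox \<rho>1 b" "s \<noteq> \<rho>1" "s \<noteq> \<rho>2" for s
  proof
    assume "zeta s = 0"
    then have "s \<in> Z" using subsetD[OF sub near[OF that(1)]] by (simp add: Z_def)
    then have "s = Complex (1/2) (Im s)" using ReZ by (simp add: complex_eq_iff)
    moreover have "Im s \<noteq> \<gamma>" "Im s \<noteq> \<gamma>'" using calculation that by (auto simp: \<rho>1_def \<rho>2_def)
    ultimately show False using between[of "Im s"] \<open>zeta s = 0\<close> that unfolding cb by auto
  qed
  have boxU: "cbox \<rho>1 b \<subseteq> U"
    using near znz unfolding U_def Z'_def Z_def by auto
  have \<alpha>: "\<alpha> \<in> box \<rho>1 b" unfolding ob using x0 \<gamma> d by (auto simp: \<alpha>_def mid_def)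
  have q: "F s / (s - \<alpha>) \<notin> \<real>\<^sub>\<le>\<^sub>0" if s: "s \<in> cbox \<rho>1 b - box \<rho>1 b" for s
  proof -
    consider "s = \<rho>1" | "s = \<rho>2" | "s \<noteq> \<rho>1" "s \<noteq> \<rho>2" by blast
    then show ?thesis
    proof cases
      case 1
      \<comment> \<open>At a corner \<zeta>'/\<zeta> is undefined and the sign comparison fails, so
        F is evaluated directly; only the term of the other factor survives.\<close>
      have "F s / (s - \<alpha>) = of_nat (m \<rho>1) * (\<rho>1 - \<rho>2) / (\<rho>1 - \<alpha>)" by (simp add: 1 F_def)
      moreover have "\<rho>1 - \<rho>2 = Complex 0 (- 2 * d)" "\<rho>1 - \<alpha> = Complex (- x0) (- d)"
        by (simp_all add: \<rho>12 \<alpha>_def complex_eq_iff)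
      ultimately have "Re (F s / (s - \<alpha>)) = real (m \<rho>1) * (2 * d * d / (x0\<^sup>2 + d\<^sup>2))"
        by (simp add: Re_divide)
      also have "\<dots> > 0" using mpos d x0 by (intro mult_pos_pos divide_pos_pos add_pos_pos) auto
      finally show ?thesis by (auto elim!: nonpos_Reals_cases)
    next
      case 2
      have "F s / (s - \<alpha>) = of_nat (m \<rho>2) * (\<rho>2 - \<rho>1) / (\<rho>2 - \<alpha>)" by (simp add: 2 F_def)
      moreover have "\<rho>2 - \<rho>1 = Complex 0 (2 * d)" "\<rho>2 - \<alpha> = Complex (- x0) d"
        by (simp_all add: \<rho>12 \<alpha>_def complex_eq_iff)
      ultimately have "Re (F s / (s - \<alpha>)) = real (m \<rho>2) * (2 * d * d / (x0\<^sup>2 + d\<^sup>2))"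
        by (simp add: Re_divide)
      also have "\<dots> > 0" using mpos d x0 by (intro mult_pos_pos divide_pos_pos add_pos_pos) auto
      finally show ?thesis by (auto elim!: nonpos_Reals_cases)
    next
      case 3
      define x y where "x = Re s - 1/2" and "y = Im s - (\<gamma> + \<gamma>') / 2"
      have sxy: "s = mid + Complex x y" by (simp add: x_def y_def mid_def complex_eq_iff)
      define w where "w = deriv zeta s / zeta s"
      define g where "g = (s - \<alpha>) / ((s - \<rho>1) * (s - \<rho>2))"
      have g_eq: "g = (Complex x y - of_real x0) / ((Complex x y - Complex 0 (-d)) * (Complex x y - Complex 0 d))"
        unfolding g_def \<rho>12 \<alpha>_def sxy by simp
      have "F s = (s - \<rho>1) * (s - \<rho>2) * w"
        unfolding w_def by (rule F_eq) (use s 3 near znz in auto)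
      then have "F s / (s - \<alpha>) = w / g" by (simp add: g_def)
      moreover have "Re w * Re g > 0"
      proof (cases "Re s = 1/2")
        case True
        have "\<gamma> \<le> Im s" "Im s \<le> \<gamma>'" using s cb by auto
        moreover have "Im s \<noteq> \<gamma>" "Im s \<noteq> \<gamma>'" using 3 True by (auto simp: \<rho>1_def \<rho>2_def complex_eq_iff)
        ultimately have im: "\<gamma> < Im s" "Im s < \<gamma>'" by auto
        then have "\<bar>y\<bar> < d" by (auto simp: y_def d_def abs_less_iff field_simps)
        moreover have "x = 0" using True by (simp add: x_def)
        ultimately have "Re g < 0" using Re_comparison_neg[of y d x0] x0 unfolding g_eq by simp
        moreover have "s = Complex (1/2) (Im s)" using True by (simp add: complex_eq_iff)
        then have "Re w < 0" unfolding w_def using left[OF im] by metis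
        ultimately show ?thesis by (simp add: mult_neg_neg)
      next
        case False
        have edge: "1/2 < Re s" "Re s \<le> 1/2 + X" "Im s \<in> {\<gamma>..\<gamma>'}" "Re s = 1/2 + X \<or> Im s = \<gamma> \<or> Im s = \<gamma>'"
          using s False unfolding Diff_iff cb ob by auto
        have "Re w > 0" unfolding w_def by (rule right[OF edge])
        moreover have "Re g > 0" unfolding g_eq
          by (rule Re_comparison_pos[of x X y d x0])
             (use edge x0 in \<open>auto simp: x_def y_def d_def abs_le_iff abs_if field_simps\<close>)
        ultimately show ?thesis by simp
      qed
      ultimately show ?thesis by (simp add: quotient_not_nonpos_Reals)
    qed
  qed
  obtain \<rho> where \<rho>: "\<rho> \<in> box \<rho>1 b" "{s \<in> cbox \<rho>1 b. F s = 0} = {\<rho>}" "zorder F \<rho> = 1"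
    using unique_zero_in_box[OF U boxU holF \<alpha> q] by blast
  have F0: "F s = 0 \<longleftrightarrow> s = \<rho>" if "s \<in> cbox \<rho>1 b" for s using \<rho>(2) that by blast
  have dF: "deriv zeta s = F s * (zeta s / ((s - \<rho>1) * (s - \<rho>2)))" "zeta s \<noteq> 0" "(s - \<rho>1) * (s - \<rho>2) \<noteq> 0"
    if "s \<in> cbox \<rho>1 b" "s \<noteq> \<rho>1" "s \<noteq> \<rho>2" for s
    using F_eq[OF near[OF that(1)] znz[OF that]] znz[OF that] that by simp_all
  have in_box: "s \<in> cbox \<rho>1 b" "s \<noteq> \<rho>1" "s \<noteq> \<rho>2" if "s \<in> box \<rho>1 b" for s
    using that unfolding ob cb by (auto simp: \<rho>1_def \<rho>2_def)
  have "{s. 1/2 < Re s \<and> Re s < 1/2 + X \<and> \<gamma> \<le> Im s \<and> Im s \<le> \<gamma>' \<and> deriv zeta s = 0} = {\<rho>}"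
  proof (intro equalityI subsetI)
    fix s assume "s \<in> {s. 1/2 < Re s \<and> Re s < 1/2 + X \<and> \<gamma> \<le> Im s \<and> Im s \<le> \<gamma>' \<and> deriv zeta s = 0}"
    then have s: "s \<in> cbox \<rho>1 b" "s \<noteq> \<rho>1" "s \<noteq> \<rho>2" "deriv zeta s = 0"
      unfolding cb by (auto simp: \<rho>1_def \<rho>2_def)
    then show "s \<in> {\<rho>}" using dF[OF s(1-3)] F0[OF s(1)] by simp
  next
    fix s assume "s \<in> {\<rho>}"
    then show "s \<in> {s. 1/2 < Re s \<and> Re s < 1/2 + X \<and> \<gamma> \<le> Im s \<and> Im s \<le> \<gamma>' \<and> deriv zeta s = 0}"
      using \<rho>(1) dF(1)[OF in_box[OF \<rho>(1)]] F0[OF in_box(1)[OF \<rho>(1)]] unfolding ob by auto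
  qed
  moreover have "zorder (deriv zeta) \<rho> = 1"
  proof -
    \<comment> \<open>\<zeta>' = F k with k zero-free on the open box, so the orders of \<zeta>' and
      F at \<rho> agree.\<close>
    define k where "k = (\<lambda>s. zeta s / ((s - \<rho>1) * (s - \<rho>2)))"
    have "k holomorphic_on box \<rho>1 b" unfolding k_def
    proof (intro holomorphic_intros)
      show "zeta holomorphic_on box \<rho>1 b"
        using is_zeta_zeta by (auto simp: is_zeta_def ob elim!: holomorphic_on_subset) (use \<gamma> in simp)
    qed (use in_box in auto)
    then have kan: "k analytic_on {\<rho>}" using \<rho>(1) by (auto simp: analytic_at intro: open_box)
    have Fan: "F analytic_on {\<rho>}" using holF U boxU in_box(1)[OF \<rho>(1)] by (auto simp: analytic_at)
    have k\<rho>: "k \<rho> \<noteq> 0" using dF(2,3)[OF in_box[OF \<rho>(1)]] by (simp add: k_def)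
    have ev: "eventually (\<lambda>s. s \<in> box \<rho>1 b \<and> s \<noteq> \<rho>) (at \<rho>)"
      using eventually_at_in_open[OF open_box \<rho>(1)] by (simp add: eventually_mono)
    have "zorder (deriv zeta) \<rho> = zorder (\<lambda>s. F s * k s) \<rho>"
      by (rule zorder_cong[OF eventually_mono[OF ev] refl]) (use dF in_box in \<open>auto simp: k_def\<close>)
    also have "\<dots> = zorder F \<rho> + zorder k \<rho>"
      by (rule zorder_times_analytic[OF Fan kan eventually_mono[OF ev]])
         (use dF in_box F0 in \<open>auto simp: k_def\<close>)
    also have "\<dots> = 1" using \<rho>(3) zorder_eq_0I[OF kan k\<rho>] by simp
    finally show ?thesis .
  qed
  ultimately show ?thesis using \<rho>(1) unfolding \<rho>1_def b_def by blast
qed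

section \<open>Numerical estimates on the box\<close>

theorem theorem2:
  assumes RH: riemann_hypothesis
  shows "\<exists>c::real. c > 0 \<and> (\<exists>\<gamma>\<^sub>0::real. \<forall>v::real. v < c \<longrightarrow>
    (\<forall>\<gamma> \<gamma>'. 0 < \<gamma> \<and> \<gamma>\<^sub>0 < \<gamma> \<and> zero_ordinate \<gamma> \<and> next_ordinate \<gamma> \<gamma>' \<and> \<gamma>' - \<gamma> < v / ln \<gamma> \<longrightarrow>
      (\<exists>\<rho>. {s \<in> zero_box v \<gamma> \<gamma>'. deriv zeta s = 0} = {\<rho>} \<and>
           zorder (deriv zeta) \<rho> = 1 \<and>
           \<rho> \<notin> frontier (zero_box v \<gamma> \<gamma>'))))"
proof -
  obtain C where C: "\<And>\<gamma> \<gamma>' p s. \<gamma> \<ge> 20 \<and> \<gamma> < \<gamma>' \<and> \<gamma>' \<le> \<gamma> + 1/64 \<and> zeta (Complex (1/2) \<gamma>) = 0 \<and> zeta (Complex (1/2) \<gamma>') = 0 \<and>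
     p \<in> {\<gamma><..<\<gamma>'} \<and> zeta (Complex (1/2) p) \<noteq> 0 \<and>
     1/2 < Re s \<and> Re s \<le> 1/2 + 1/32 \<and> Im s \<in> {\<gamma>..\<gamma>'} \<and> norm (s - Complex (1/2) p) * ln \<gamma> \<le> 2 \<Longrightarrow>
     Re (deriv zeta s / zeta s) \<ge> - (ln \<gamma> / 2) - C +
       Re (1 / (s - Complex (1/2) \<gamma>)) + Re (1 / (s - Complex (1/2) \<gamma>'))"
    using Re_zeta_log_deriv_lower_bound[OF RH] by blast
  obtain D where D: "\<And>t. t \<ge> 4 \<Longrightarrow> zeta (Complex (1/2) t) \<noteq> 0 \<Longrightarrow>
     \<bar>Re (deriv zeta (Complex (1/2) t) / zeta (Complex (1/2) t)) + ln t / 2\<bar> \<le> D"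
    using Re_zeta_log_deriv_critical_line by blast
  \<comment> \<open>64 keeps the box within the required size, 2 |D| makes Re \<zeta>'/\<zeta>
    negative on the left, and 4 |C| leaves 4L/5 - L/2 = 3L/10 above C on the other sides.\<close>
  define L0 where "L0 = 64 + 4 * \<bar>C\<bar> + 2 * \<bar>D\<bar>"
  show ?thesis
  proof (rule exI[of _ 1], rule conjI[OF zero_less_one], rule exI[of _ "max 20 (exp L0)"], intro allI impI, goal_cases)
    case (1 v \<gamma> \<gamma>')
    then have v: "v < 1" and g: "\<gamma> > 20" "exp L0 < \<gamma>" and z1: "zeta (Complex (1/2) \<gamma>) = 0"
      and nx: "\<gamma> < \<gamma>'" "zeta (Complex (1/2) \<gamma>') = 0" "\<And>t. \<gamma> < t \<Longrightarrow> zeta (Complex (1/2) t) = 0 \<Longrightarrow> \<gamma>' \<le> t"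
      and gap: "\<gamma>' - \<gamma> < v / ln \<gamma>"
      by (auto simp: zero_ordinate_def next_ordinate_def)
    define L where "L = ln \<gamma>"
    have "L0 < L" unfolding L_def using g by (metis exp_gt_zero exp_less_cancel_iff exp_ln less_trans)
    then have L: "L > 64" "L > 64 + 4 * \<bar>C\<bar>" "L > 2 * \<bar>D\<bar>" by (auto simp: L0_def)
    have "v / L > 0" using gap nx(1) unfolding L_def by linarith
    \<comment> \<open>A positive gap below v/L rules out v \<le> 0.\<close>
    then have v0: "v > 0" using L by (simp add: zero_less_divide_iff)
    have vL: "v / L < 1/64" using v L by (simp add: divide_less_eq)
    define X where "X = v\<^sup>2 / (4 * L)"
    have v2: "v\<^sup>2 \<le> v" using v v0 by (simp add: power2_eq_square)
    have X: "0 < X" "X \<le> v / L / 4" "X \<le> 1/4 * (v / L)" using v0 L v2 by (auto simp: X_def field_simps)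
    have small_box: "\<gamma>' \<le> \<gamma> + 1/64" "X \<le> 1/32"
      using gap[folded L_def] vL X(3) by linarith+
    have box_eq: "{s \<in> zero_box v \<gamma> \<gamma>'. deriv zeta s = 0} =
      {s. 1/2 < Re s \<and> Re s < 1/2 + X \<and> \<gamma> \<le> Im s \<and> Im s \<le> \<gamma>' \<and> deriv zeta s = 0}"
      by (auto simp: zero_box_def X_def L_def)
    have btw: "zeta (Complex (1/2) t) \<noteq> 0" if "\<gamma> < t" "t < \<gamma>'" for t using nx(3)[of t] that by auto
    define p where "p = (\<gamma> + \<gamma>') / 2"
    have p: "\<gamma> < p" "p < \<gamma>'" using nx(1) by (auto simp: p_def)
    have "\<exists>\<rho>. {s. 1/2 < Re s \<and> Re s < 1/2 + X \<and> \<gamma> \<le> Im s \<and> Im s \<le> \<gamma>' \<and> deriv zeta s = 0} = {\<rho>} \<and>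
       zorder (deriv zeta) \<rho> = 1 \<and> \<rho> \<in> box (Complex (1/2) \<gamma>) (Complex (1/2 + X) \<gamma>')"
    proof (rule simple_critical_point_between_close_zeros[OF RH])
      show "\<gamma> \<ge> 20" "\<gamma> < \<gamma>'" "\<gamma>' \<le> \<gamma> + 1/64" "0 < X" "X \<le> 1/32"
        using g nx(1) small_box X by auto
    next
      fix t assume t: "\<gamma> < t" "t < \<gamma>'"
      have "L \<le> ln t" unfolding L_def using t g by simp
      then show "Re (deriv zeta (Complex (1/2) t) / zeta (Complex (1/2) t)) < 0"
        using D[OF _ btw[OF t]] t g L by (auto simp: abs_le_iff)
    next
      fix s assume s: "1/2 < Re s" "Re s \<le> 1/2 + X" "Im s \<in> {\<gamma>..\<gamma>'}" "Re s = 1/2 + X \<or> Im s = \<gamma> \<or> Im s = \<gamma>'"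
      define x where "x = Re s - 1/2"
      define A B where "A = x / (x\<^sup>2 + (Im s - \<gamma>)\<^sup>2)" and "B = x / (x\<^sup>2 + (Im s - \<gamma>')\<^sup>2)"
      have x: "0 < x" "x \<le> X" using s by (auto simp: x_def)
      have "norm (s - Complex (1/2) p) \<le> \<bar>Re (s - Complex (1/2) p)\<bar> + \<bar>Im (s - Complex (1/2) p)\<bar>" by (rule cmod_le)
      also have "\<dots> \<le> v / L + v / L"
        using s p X gap v0 L unfolding L_def[symmetric] by (intro add_mono) (auto simp: abs_le_iff)
      finally have "norm (s - Complex (1/2) p) * L \<le> (v / L + v / L) * L" using L by (intro mult_right_mono) auto
      also have "\<dots> \<le> 2" using L v by simp
      finally have sp: "norm (s - Complex (1/2) p) * ln \<gamma> \<le> 2" unfolding L_def .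
      have "Re (deriv zeta s / zeta s) \<ge> - (ln \<gamma> / 2) - C +
         Re (1 / (s - Complex (1/2) \<gamma>)) + Re (1 / (s - Complex (1/2) \<gamma>'))"
        by (rule C[of \<gamma> \<gamma>' p]) (use g(1) nx(1,2) z1 p btw[OF p] s(1-3) small_box sp in auto)
      then have bd: "Re (deriv zeta s / zeta s) \<ge> - (L / 2) - C + A + B"
        unfolding Re_inverse_linear A_def B_def x_def L_def .
      have AB0: "A \<ge> 0" "B \<ge> 0" using x by (auto simp: A_def B_def)
      \<comment> \<open>Right side: 1/16 + 1/4 = 5/16 from the width and half the gap. Dividing X by
        (5/16)(v/L)^2 cancels v^2.\<close>
      have small: "x / (x\<^sup>2 + e\<^sup>2) \<ge> 4/5 * L" if "x = X" "\<bar>e\<bar> \<le> v / (2 * L)" for e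
      proof -
        have "e\<^sup>2 \<le> (v / (2 * L))\<^sup>2" using that by (metis abs_ge_zero power2_abs power_mono)
        moreover have "X\<^sup>2 \<le> (v / L / 4)\<^sup>2" using X by (intro power_mono) auto
        ultimately have "X\<^sup>2 + e\<^sup>2 \<le> 5/16 * (v / L)\<^sup>2" by (simp add: power2_eq_square field_simps)
        then have "X / (5/16 * (v / L)\<^sup>2) \<le> X / (X\<^sup>2 + e\<^sup>2)"
          using X by (intro divide_left_mono mult_pos_pos) (auto intro!: add_pos_nonneg)
        moreover have "X / (5/16 * (v / L)\<^sup>2) = 4/5 * L" using v0 L by (simp add: X_def power2_eq_square field_simps)
        ultimately show ?thesis unfolding that(1) by (simp only:)
      qed
      \<comment> \<open>Horizontal sides: a corner is level with s, and the term is 1/x \<ge>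
        4L/v.\<close>
      have zero: "x / (x\<^sup>2 + 0\<^sup>2) \<ge> 4/5 * L"
      proof -
        have "4/5 * L \<le> L * 4" using L by simp
        also have "\<dots> \<le> L * 4 / v" using v v0 L by (simp add: le_divide_eq mult_left_le)
        also have "\<dots> = 1 / (v / L / 4)" by simp
        also have "\<dots> \<le> 1 / x" using x X(2) v0 L
          by (intro divide_left_mono mult_pos_pos divide_pos_pos) auto
        finally show ?thesis using x by (simp add: power2_eq_square)
      qed
      have "A + B \<ge> 4/5 * L"
      proof -
        \<comment> \<open>In each case the nearer corner alone supplies 4L/5; the other term is
          merely nonnegative.\<close>
        consider "Im s = \<gamma>" | "Im s = \<gamma>'" | "x = X" "Im s \<le> p" | "x = X" "Im s \<ge> p" using s by (force simp: x_def)
        then show ?thesis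
        proof cases
          case 1 then show ?thesis using zero AB0 by (simp add: A_def)
        next
          case 2 then show ?thesis using zero AB0 by (simp add: B_def)
        next
          case 3
          have "A \<ge> 4/5 * L" unfolding A_def using 3 s gap
            by (intro small) (auto simp: p_def L_def abs_le_iff field_simps)
          then show ?thesis using AB0 by simp
        next
          case 4
          have "B \<ge> 4/5 * L" unfolding B_def using 4 s gap
            by (intro small) (auto simp: p_def L_def abs_le_iff field_simps)
          then show ?thesis using AB0 by simp
        qed
      qed
      then show "Re (deriv zeta s / zeta s) > 0" using bd L by linarith
    qed (use z1 nx btw in auto)
    then obtain \<rho> where \<rho>: "{s \<in> zero_box v \<gamma> \<gamma>'. deriv zeta s = 0} = {\<rho>}" "zorder (deriv zeta) \<rho> = 1"
      "\<rho> \<in> box (Complex (1/2) \<gamma>) (Complex (1/2 + X) \<gamma>')" unfolding box_eq by blast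
    have "box (Complex (1/2) \<gamma>) (Complex (1/2 + X) \<gamma>') \<subseteq> interior (zero_box v \<gamma> \<gamma>')"
      by (rule interior_maximal) (auto simp: in_box_complex_iff zero_box_def X_def L_def intro: open_box)
    then show ?case using \<rho> by (auto simp: frontier_def)
  qed
qed

end
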